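(* Let $d=2$. For any $\delta>0$, the limiting density of the set of even integers $n$ for which $\theta_n \ge 3/2-\delta$ is equal to one.
   Context: $\mathbb{N}$ denotes the non-negative integers. A walk of length $n$ in $\mathbb{Z}^d$ is a map $\gamma:\{0,\dots,n\}\to\mathbb{Z}^d$ with $\|\gamma(i+1)-\gamma(i)\|=1$ (Euclidean norm) for each $i$; it is self-avoiding if it is injective. A self-avoiding walk $\gamma:\{0,\dots,n-1\}\to\mathbb{Z}^d$ is closing if $\gamma(n-1)$ and $\gamma(0)$ are at distance one; its polygon is the set of the $n$ nearest-neighbour edges consisting of the edges $\{\gamma(i-1),\gamma(i)\}$, $1\le i\le n-1$, together with the missing edge $\{\gamma(n-1),\gamma(0)\}$. A self-avoiding polygon is any polygon of a closing self-avoiding walk; its length is its cardinality (number of edges), which is even and at least $4$. $p_n$ denotes the number of self-avoiding polygons of length $n$ in $\mathbb{Z}^d$ up to translation. The limit $\mu=\lim_{n\in 2\mathbb{N}}p_n^{1/n}\in(0,\infty)$ exists (known) and is called the connective constant. For even $n\ge 4$, the real number $\theta_n$ is defined by $p_n=n^{-\theta_n}\mu^n$. The limit supremum density of a set $A$ of even (or of odd) integers is $\limsup_n n^{-1}|A\cap[0,2n]|$; the limit infimum density is the corresponding $\liminf$. When the two are equal, the common value is called the limiting density. *)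

theory Defs
  imports "HOL-Analysis.Analysis"
begin

text \<open>
  The lattice \<open>\<int>\<^sup>d\<close> is the type \<open>int ^ 'd\<close>; it has no norm of its own, so distances are measured
  after embedding it in \<open>\<real>\<^sup>d\<close>.
\<close>

definition lattice_dist :: "int ^ 'd::finite \<Rightarrow> int ^ 'd \<Rightarrow> real" where
  "lattice_dist x y = norm ((\<chi> i. real_of_int (x $ i - y $ i)) :: real ^ 'd)"

text \<open>
  A walk of length \<open>n\<close> is given by a function on all of \<open>nat\<close>, of which only the values on
  \<open>{0..n}\<close> matter.
\<close>

definition walk :: "nat \<Rightarrow> (nat \<Rightarrow> int ^ 'd::finite) \<Rightarrow> bool" where
  "walk n \<gamma> \<longleftrightarrow> (\<forall>i<n. lattice_dist (\<gamma> (i + 1)) (\<gamma> i) = 1)"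

definition self_avoiding_walk :: "nat \<Rightarrow> (nat \<Rightarrow> int ^ 'd::finite) \<Rightarrow> bool" where
  "self_avoiding_walk n \<gamma> \<longleftrightarrow> walk n \<gamma> \<and> inj_on \<gamma> {0..n}"

text \<open>In the next two definitions \<open>n\<close> is the number of vertices, so the walk has length \<open>n - 1\<close>.\<close>

definition closing_walk :: "nat \<Rightarrow> (nat \<Rightarrow> int ^ 'd::finite) \<Rightarrow> bool" where
  "closing_walk n \<gamma> \<longleftrightarrow>
     n \<ge> 1 \<and> self_avoiding_walk (n - 1) \<gamma> \<and> lattice_dist (\<gamma> (n - 1)) (\<gamma> 0) = 1"

definition polygon_of_walk :: "nat \<Rightarrow> (nat \<Rightarrow> int ^ 'd::finite) \<Rightarrow> (int ^ 'd) set set" where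
  "polygon_of_walk n \<gamma> = {{\<gamma> (i - 1), \<gamma> i} | i. 1 \<le> i \<and> i \<le> n - 1} \<union> {{\<gamma> (n - 1), \<gamma> 0}}"

text \<open>
  The condition \<open>n > 2\<close> excludes a single edge traversed back and forth: for \<open>n = 2\<close> the missing edge
  is not distinct from the edge of the walk. Parity of the lattice then forces \<open>n\<close> to be even and
  at least 4.
\<close>

definition self_avoiding_polygon :: "(int ^ 'd::finite) set set \<Rightarrow> bool" where
  "self_avoiding_polygon P \<longleftrightarrow> (\<exists>n \<gamma>. n > 2 \<and> closing_walk n \<gamma> \<and> P = polygon_of_walk n \<gamma>)"

definition translation_rel :: "((int ^ 'd::finite) set set \<times> (int ^ 'd) set set) set" where
  "translation_rel = {(P, Q). \<exists>v. Q = (\<lambda>e. (\<lambda>x. x + v) ` e) ` P}"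

definition num_polygons :: "'d::finite itself \<Rightarrow> nat \<Rightarrow> nat" where
  "num_polygons d n =
     card ({P :: (int ^ 'd) set set. self_avoiding_polygon P \<and> card P = n} // translation_rel)"

definition connective_constant :: "'d::finite itself \<Rightarrow> real" where
  "connective_constant d = lim (\<lambda>k. root (2 * k) (real (num_polygons d (2 * k))))"

text \<open>Meaningful for even \<open>n \<ge> 4\<close> only.\<close>

definition polygon_exponent :: "'d::finite itself \<Rightarrow> nat \<Rightarrow> real" where
  "polygon_exponent d n =
     (THE \<theta>. real (num_polygons d n) = real n powr (- \<theta>) * connective_constant d ^ n)"

text \<open>
  Densities relative to the even (or to the odd) integers: \<open>{0..2 * n}\<close> contains about \<open>n\<close> of them,
  whence the normalisation by \<open>n\<close>.
\<close>

definition limsup_density :: "nat set \<Rightarrow> ereal" where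
  "limsup_density A = limsup (\<lambda>n. ereal (real (card (A \<inter> {0..2 * n})) / real n))"

definition liminf_density :: "nat set \<Rightarrow> ereal" where
  "liminf_density A = liminf (\<lambda>n. ereal (real (card (A \<inter> {0..2 * n})) / real n))"

definition has_limiting_density :: "nat set \<Rightarrow> real \<Rightarrow> bool" where
  "has_limiting_density A x \<longleftrightarrow> limsup_density A = ereal x \<and> liminf_density A = ereal x"

end

theory Submission
  imports Defs "HOL-Real_Asymp.Real_Asymp"
begin

text \<open>Two polygons of comparable lengths \<open>j\<close> and \<open>k\<close> can be slid against each other at about
  \<open>\<surd>n\<close> relative heights and joined at the contact. This gives a polygon whose length differs from
  \<open>j + k\<close> by a bounded amount, together with a global cut, from which the two polygons can be
  recovered up to boundedly many choices. Polygons with \<open>n\<^sup>\<epsilon>\<close> or more global cuts are rare: exchanging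
  the two strands of the polygon at any subset of the cuts is injective, so that such a polygon
  accounts for exponentially many pairs of walks, while the resulting walks are bridges and the number
  of such pairs is at most \<open>\<mu>\<^sup>n\<close> times a polynomial in \<open>n\<close>. Hence
  \<open>\<surd>n \<Sum> p\<^sub>j p\<^sub>k\<close>, summed over \<open>j + k = n\<close>, is at most about \<open>n\<^sup>\<epsilon> p\<^sub>n\<close>. If \<open>\<theta>\<^sub>n \<le> 3/2 - \<delta>\<close>
  for a set of lengths of positive upper density, then the same holds near its popular sums with \<open>\<delta>\<close>
  replaced by \<open>3\<delta>/2\<close>, and by iteration with an arbitrarily large \<open>\<delta>\<close>. This contradicts
  \<open>p\<^sub>n \<le> \<mu>\<^sup>n\<close>.\<close>

section \<open>Lattice paths and polygons as edge sets\<close>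

text \<open>The exponent 3/2 is the fixed point of the join estimate. Suppose that
  \<open>pcount n\<close> is about \<open>n powr (- t) * \<mu> ^ n\<close>. A typical sum of two
  lengths arises from about n pairs, each with about sqrt n relative heights, so the joins have the
  exponent 3/2 - 2 t, which exceeds - t as soon as t < 3/2. With t = 3/2 - \<delta> the excess
  \<delta> would double; the weaker factor 3/2 leaves \<delta> / 4 for the multiplicity of the joins
  and \<delta> / 4 for the constants.

  The obstacle is that multiplicity: a joined polygon does not remember where it was joined. Hence
  the requirement that a cut be global, the first polygon being left of the second in every common
  row. This holds automatically for horizontal sliding, and it orders all cuts of a polygon along
  its two arcs, so that any subset of them can be swapped.

  The sqrt n heights come from area: a polygon with n vertices or its transpose has at least sqrt n
  rows.\<close>

type_synonym point = "int \<times> int"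

definition adj :: "point \<Rightarrow> point \<Rightarrow> bool" where
  "adj p q \<longleftrightarrow> \<bar>fst p - fst q\<bar> + \<bar>snd p - snd q\<bar> = 1"

lemma adj_sym: "adj p q \<longleftrightarrow> adj q p"
  by (auto simp: adj_def abs_minus_commute)

lemma adj_neq: "adj p q \<Longrightarrow> p \<noteq> q"
  by (auto simp: adj_def)

lemma adj_iff:
  "adj (x, y) q \<longleftrightarrow> q \<in> {(x + 1, y), (x - 1, y), (x, y + 1), (x, y - 1)}"
  by (cases q) (auto simp: adj_def)

definition saw :: "point list \<Rightarrow> bool" where
  "saw xs \<longleftrightarrow> distinct xs \<and> successively adj xs"

lemma saw_rev: "saw (rev xs) \<longleftrightarrow> saw xs"
proof -
  have "successively (\<lambda>x y. adj y x) xs = successively adj xs"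
    by (intro successively_cong) (auto simp: adj_sym)
  then show ?thesis by (simp add: saw_def)
qed

lemma saw_append:
  "saw (xs @ ys) \<longleftrightarrow> saw xs \<and> saw ys \<and> set xs \<inter> set ys = {} \<and>
     (xs = [] \<or> ys = [] \<or> adj (last xs) (hd ys))"
  by (auto simp: saw_def successively_append_iff)

lemma saw_Cons:
  "saw (x # xs) \<longleftrightarrow> saw xs \<and> x \<notin> set xs \<and> (xs = [] \<or> adj x (hd xs))"
  using saw_append[of "[x]" xs] by (auto simp: saw_def successively_Cons)

lemma saw_Nil: "saw []" by (simp add: saw_def)

fun path_edges :: "'a list \<Rightarrow> 'a set set" where
  "path_edges (x # y # xs) = insert {x, y} (path_edges (y # xs))"
| "path_edges xs = {}"

lemma path_edges_Cons:
  "path_edges (x # xs) = (if xs = [] then {} else insert {x, hd xs} (path_edges xs))"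
  by (cases xs) auto

lemma path_edges_append:
  "path_edges (xs @ ys) = path_edges xs \<union> path_edges ys \<union>
     (if xs = [] \<or> ys = [] then {} else {{last xs, hd ys}})"
  by (induction xs) (auto simp: path_edges_Cons)

lemma path_edges_rev: "path_edges (rev xs) = path_edges xs"
  by (induction xs) (auto simp: path_edges_append path_edges_Cons last_rev insert_commute)

lemma path_edges_subset: "e \<in> path_edges xs \<Longrightarrow> e \<subseteq> set xs"
  by (induction xs) (auto simp: path_edges_Cons split: if_splits)

lemma Union_path_edges: "length xs \<ge> 2 \<Longrightarrow> \<Union>(path_edges xs) = set xs"
proof (induction xs)
  case (Cons x xs)
  then show ?case
    by (cases xs; cases "tl xs") auto
qed simp

lemma finite_path_edges: "finite (path_edges xs)"
  by (induction xs) (auto simp: path_edges_Cons)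

lemma path_edges_split:
  "e \<in> path_edges xs \<Longrightarrow> \<exists>as a b bs. xs = as @ a # b # bs \<and> e = {a, b}"
proof (induction xs)
  case (Cons x xs)
  show ?case
  proof (cases "e \<in> path_edges xs")
    case True
    with Cons.IH obtain as a b bs where "xs = as @ a # b # bs" "e = {a, b}" by blast
    then have "x # xs = (x # as) @ a # b # bs \<and> e = {a, b}" by simp
    then show ?thesis by blast
  next
    case False
    with Cons.prems have "xs \<noteq> []" "e = {x, hd xs}"
      by (auto simp: path_edges_Cons split: if_splits)
    then have "x # xs = [] @ x # hd xs # tl xs \<and> e = {x, hd xs}" by simp
    then show ?thesis by blast
  qed
qed simp

lemma path_edges_nth: "Suc i < length xs \<Longrightarrow> {xs ! i, xs ! Suc i} \<in> path_edges xs"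
proof (induction xs arbitrary: i)
  case (Cons x xs)
  then show ?case
    by (cases i) (auto simp: path_edges_Cons hd_conv_nth)
qed simp

lemma path_edges_conv_nth:
  "path_edges xs = {{xs ! i, xs ! Suc i} | i. Suc i < length xs}"
proof (intro subset_antisym subsetI)
  fix e assume "e \<in> path_edges xs"
  then obtain as a b bs where "xs = as @ a # b # bs" "e = {a, b}"
    using path_edges_split by blast
  then have "e = {xs ! length as, xs ! Suc (length as)} \<and> Suc (length as) < length xs"
    by (simp add: nth_append)
  then show "e \<in> {{xs ! i, xs ! Suc i} | i. Suc i < length xs}" by blast
qed (auto simp: path_edges_nth)

lemma card_path_edges: "distinct xs \<Longrightarrow> card (path_edges xs) = length xs - 1"
proof (induction xs)
  case (Cons x xs)
  have "{x, hd xs} \<notin> path_edges xs"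
    using Cons.prems path_edges_subset by auto
  with Cons show ?case
    by (auto simp: path_edges_Cons finite_path_edges)
qed simp

lemma path_edges_adj: "saw xs \<Longrightarrow> e \<in> path_edges xs \<Longrightarrow> \<exists>p q. e = {p, q} \<and> adj p q"
  unfolding path_edges_conv_nth saw_def successively_conv_nth by blast

text \<open>From three vertices on the closing edge is new, whereas for two it would repeat the only
  edge of the path. Hence a cycle has as many edges as vertices.\<close>

lemma closing_edge_notin:
  assumes "distinct xs" "length xs \<ge> 3"
  shows "{last xs, hd xs} \<notin> path_edges xs"
proof
  assume "{last xs, hd xs} \<in> path_edges xs"
  then obtain as a b bs where xs: "xs = as @ a # b # bs" and e: "{last xs, hd xs} = {a, b}"
    using path_edges_split by blast
  show False
  proof (cases as)
    case Nil
    with xs e assms show False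
      by (cases bs) (auto simp: doubleton_eq_iff split: if_splits)
  next
    case (Cons c cs)
    with xs e assms show False by (auto simp: doubleton_eq_iff)
  qed
qed

definition cycle :: "point list \<Rightarrow> bool" where
  "cycle xs \<longleftrightarrow> saw xs \<and> length xs \<ge> 3 \<and> adj (last xs) (hd xs)"

definition cycle_edges :: "'a list \<Rightarrow> 'a set set" where
  "cycle_edges xs = insert {last xs, hd xs} (path_edges xs)"

definition polygon :: "point set set \<Rightarrow> bool" where
  "polygon P \<longleftrightarrow> (\<exists>xs. cycle xs \<and> P = cycle_edges xs)"

lemma cycle_swap:
  assumes "cycle (xs @ ys)"
  shows "cycle (ys @ xs)" "cycle_edges (ys @ xs) = cycle_edges (xs @ ys)"
proof -
  show "cycle (ys @ xs)"
    using assms by (cases "xs = []"; cases "ys = []") (auto simp: cycle_def saw_append)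
  show "cycle_edges (ys @ xs) = cycle_edges (xs @ ys)"
    by (cases "xs = []"; cases "ys = []") (auto simp: cycle_edges_def path_edges_append)
qed

lemma cycle_rev: "cycle (rev xs) \<longleftrightarrow> cycle xs"
  by (cases "xs = []") (auto simp: cycle_def saw_rev hd_rev last_rev adj_sym)

lemma cycle_edges_rev: "cycle_edges (rev xs) = cycle_edges xs"
  by (cases "xs = []") (auto simp: cycle_edges_def path_edges_rev hd_rev last_rev insert_commute)

lemma Union_cycle_edges: "cycle xs \<Longrightarrow> \<Union>(cycle_edges xs) = set xs"
  using Union_path_edges[of xs] by (cases "xs = []") (auto simp: cycle_def cycle_edges_def)

lemma card_cycle_edges: "cycle xs \<Longrightarrow> card (cycle_edges xs) = length xs"
  using closing_edge_notin[of xs]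
  by (auto simp: cycle_def cycle_edges_def saw_def finite_path_edges card_path_edges)

lemma finite_cycle_edges: "finite (cycle_edges xs)"
  by (simp add: cycle_edges_def finite_path_edges)

lemma finite_polygon: "polygon P \<Longrightarrow> finite P"
  by (auto simp: polygon_def finite_cycle_edges)

lemma finite_vertices: "polygon P \<Longrightarrow> finite (\<Union>P)"
  by (auto simp: polygon_def Union_cycle_edges)

lemma card_vertices: "polygon P \<Longrightarrow> card (\<Union>P) = card P"
  by (auto simp: polygon_def Union_cycle_edges card_cycle_edges distinct_card cycle_def saw_def)

lemma card_polygon_ge: "polygon P \<Longrightarrow> card P \<ge> 3"
  by (auto simp: polygon_def card_cycle_edges) (simp add: cycle_def)

lemma polygon_edge_adj: "polygon P \<Longrightarrow> e \<in> P \<Longrightarrow> \<exists>p q. e = {p, q} \<and> adj p q"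
  unfolding polygon_def cycle_edges_def cycle_def using path_edges_adj by blast

lemma polygon_adj: "polygon P \<Longrightarrow> {p, q} \<in> P \<Longrightarrow> adj p q"
  using polygon_edge_adj[of P "{p, q}"] by (auto simp: doubleton_eq_iff adj_sym)

lemma polygon_ne: "polygon P \<Longrightarrow> \<Union>P \<noteq> {}"
proof
  assume "polygon P" "\<Union>P = {}"
  with card_vertices[of P] card_polygon_ge[of P] show False by simp
qed

lemma polygon_start_at:
  assumes "polygon P" "v \<in> \<Union>P"
  obtains ys where "cycle (v # ys)" "P = cycle_edges (v # ys)"
proof -
  from assms obtain xs where xs: "cycle xs" "P = cycle_edges xs" "v \<in> set xs"
    unfolding polygon_def using Union_cycle_edges by blast
  then obtain as bs where "xs = as @ v # bs" by (meson split_list)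
  with xs cycle_swap[of as "v # bs"] that show thesis by force
qed

text \<open>The normal form for surgery: the polygon is opened at a prescribed edge with a
  prescribed orientation, and the operations below edit the resulting list.\<close>

lemma polygon_open:
  assumes "polygon P" "{p, q} \<in> P"
  obtains ys where "saw ys" "length ys \<ge> 3" "hd ys = p" "last ys = q"
    "P = insert {p, q} (path_edges ys)" "{p, q} \<notin> path_edges ys" "set ys = \<Union>P"
proof -
  have main: "\<exists>ys. cycle ys \<and> P = cycle_edges ys \<and> hd ys = p \<and> last ys = q"
  proof -
    from assms(1) obtain xs where xs: "cycle xs" "P = cycle_edges xs"
      by (auto simp: polygon_def)
    have ne: "xs \<noteq> []" using xs by (auto simp: cycle_def)
    have "\<exists>zs. cycle zs \<and> P = cycle_edges zs \<and> {last zs, hd zs} = {p, q}"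
    proof (cases "{p, q} = {last xs, hd xs}")
      case False
      with assms xs have "{p, q} \<in> path_edges xs" by (auto simp: cycle_edges_def)
      then obtain as a b bs where s: "xs = (as @ [a]) @ (b # bs)" "{p, q} = {a, b}"
        by (auto dest!: path_edges_split)
      have "cycle ((b # bs) @ (as @ [a]))" "cycle_edges ((b # bs) @ (as @ [a])) = P"
        using cycle_swap[of "as @ [a]" "b # bs"] xs s by auto
      moreover have "{last ((b # bs) @ (as @ [a])), hd ((b # bs) @ (as @ [a]))} = {p, q}"
        using s by auto
      ultimately show ?thesis by blast
    qed (use xs in auto)
    then obtain zs where zs: "cycle zs" "P = cycle_edges zs" "{last zs, hd zs} = {p, q}"
      by blast
    then have "zs \<noteq> []" by (auto simp: cycle_def)
    then have "(hd zs = p \<and> last zs = q) \<or> (hd (rev zs) = p \<and> last (rev zs) = q)"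
      using zs(3) by (auto simp: doubleton_eq_iff hd_rev last_rev)
    then show ?thesis using zs cycle_rev cycle_edges_rev by metis
  qed
  then obtain ys where ys: "cycle ys" "P = cycle_edges ys" "hd ys = p" "last ys = q" by blast
  show thesis
  proof (rule that)
    show "saw ys" "length ys \<ge> 3" using ys by (auto simp: cycle_def)
    show "P = insert {p, q} (path_edges ys)"
      using ys by (auto simp: cycle_edges_def insert_commute)
    show "{p, q} \<notin> path_edges ys"
      using closing_edge_notin[of ys] ys by (auto simp: cycle_def saw_def insert_commute)
    show "set ys = \<Union>P" using ys Union_cycle_edges by blast
  qed (use ys in auto)
qed

lemma polygonI:
  assumes "saw ys" "length ys \<ge> 3" "adj (last ys) (hd ys)"
  shows "polygon (insert {last ys, hd ys} (path_edges ys))"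
  using assms by (auto simp: polygon_def cycle_def cycle_edges_def intro!: exI[of _ ys])

lemma two_neighbours:
  assumes "polygon P" "v \<in> \<Union>P"
  obtains p q where "p \<noteq> q" "{v, p} \<in> P" "{v, q} \<in> P"
proof -
  from assms obtain ys where ys: "cycle (v # ys)" "P = cycle_edges (v # ys)"
    using polygon_start_at by blast
  then have len: "length ys \<ge> 2" by (auto simp: cycle_def)
  then have "hd ys \<noteq> last ys"
    using ys by (cases ys) (auto simp: cycle_def saw_def)
  moreover have "{v, hd ys} \<in> P" "{v, last ys} \<in> P"
    using ys len by (auto simp: cycle_edges_def path_edges_Cons)
  ultimately show thesis using that by blast
qed

section \<open>Local surgery on polygons\<close>

lemma replace_edge:
  assumes P: "polygon P" "{p, q} \<in> P" and mid: "saw (p # mid @ [q])" "set mid \<inter> \<Union>P = {}"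
  shows "polygon (P - {{p, q}} \<union> path_edges (p # mid @ [q]))" (is "polygon ?P'")
    and "\<Union>(P - {{p, q}} \<union> path_edges (p # mid @ [q])) = \<Union>P \<union> set mid"
proof -
  have "{q, p} \<in> P" using P by (simp add: insert_commute)
  from polygon_open[OF P(1) this] obtain ys where ys: "saw ys" "length ys \<ge> 3" "hd ys = q"
    "last ys = p" "P = insert {q, p} (path_edges ys)" "{q, p} \<notin> path_edges ys" "set ys = \<Union>P" .
  have ne: "ys \<noteq> []" using ys(2) by auto
  have P': "?P' = insert {last (ys @ mid), hd (ys @ mid)} (path_edges (ys @ mid))"
    using ys ne by (cases "mid = []") (auto simp: path_edges_append path_edges_Cons insert_commute)
  have "saw (ys @ mid)"
    using ys mid ne by (auto simp: saw_append saw_Cons)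
  moreover have "adj (last (ys @ mid)) (hd (ys @ mid))"
    using mid ys ne by (cases "mid = []") (auto simp: saw_append saw_Cons)
  ultimately show "polygon ?P'" unfolding P' using ys(2) by (intro polygonI) auto
  have "\<Union>?P' = set (ys @ mid)"
    unfolding P' using Union_path_edges[of "ys @ mid"] ys(2) ne
      hd_in_set[of "ys @ mid"] last_in_set[of "ys @ mid"] by auto
  then show "\<Union>?P' = \<Union>P \<union> set mid" using ys by auto
qed

text \<open>A move that preserves the length: as \<open>m'\<close> differs from \<open>m\<close>,
  the two are opposite corners of a unit square with \<open>p\<close> and \<open>q\<close>.
  \<open>ex_tip\<close> uses it where a vertex of the polygon blocks a detour.\<close>

lemma flip_corner:
  assumes P: "polygon P" "{p, m} \<in> P" "{m, q} \<in> P" "p \<noteq> q"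
    and m': "adj p m'" "adj m' q" "m' \<notin> \<Union>P"
  shows "polygon (P - {{p, m}, {m, q}} \<union> {{p, m'}, {m', q}})" (is "polygon ?P'")
    and "\<Union>(P - {{p, m}, {m, q}} \<union> {{p, m'}, {m', q}}) = insert m' (\<Union>P - {m})"
proof -
  from polygon_open[OF P(1,2)] obtain ys where ys: "saw ys" "length ys \<ge> 3" "hd ys = p"
    "last ys = m" "P = insert {p, m} (path_edges ys)" "{p, m} \<notin> path_edges ys" "set ys = \<Union>P" .
  define zs where "zs = butlast ys"
  have ne: "ys \<noteq> []" using ys(2) by auto
  then have ysz: "ys = zs @ [m]" using ys(4) zs_def append_butlast_last_id by fastforce
  have znr: "zs \<noteq> []" using ys(2) ysz by auto
  have mz: "m \<notin> set zs" using ys(1) ysz by (auto simp: saw_def)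
  have pe: "path_edges ys = insert {last zs, m} (path_edges zs)"
    using ysz znr by (simp add: path_edges_append)
  have nin: "e \<in> path_edges zs \<Longrightarrow> m \<notin> e" for e
    using path_edges_subset mz by blast
  have lz: "last zs = q"
  proof -
    have "{m, q} \<in> path_edges ys" using ys(5) P(3,4) adj_neq[OF polygon_adj[OF P(1,3)]]
      by (auto simp: doubleton_eq_iff)
    then have "{m, q} = {last zs, m}" using pe nin[of "{m, q}"] by auto
    then show ?thesis by (auto simp: doubleton_eq_iff)
  qed
  have hz: "hd zs = p" using ys(3) ysz znr by simp
  have len: "length zs \<ge> 2" using ys(2) ysz by simp
  have "m' \<notin> set zs" using m' ys(7) ysz by auto
  then have saw: "saw (zs @ [m'])"
    using ys(1) lz m' ysz by (auto simp: saw_append saw_Cons saw_Nil adj_sym)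
  have P0: "P - {{p, m}, {m, q}} = path_edges zs"
    using ys(5) pe lz nin by (auto simp: insert_commute)
  have P': "?P' = insert {last (zs @ [m']), hd (zs @ [m'])} (path_edges (zs @ [m']))"
    unfolding P0 using znr hz lz by (auto simp: path_edges_append insert_commute)
  show "polygon ?P'" unfolding P'
    using saw len hz znr m'(1) by (intro polygonI) (auto simp: adj_sym)
  have "\<Union>?P' = set (zs @ [m'])"
    unfolding P' using Union_path_edges[of "zs @ [m']"] len znr by auto
  also have "\<dots> = insert m' (\<Union>P - {m})" using ys(7) ysz mz by auto
  finally show "\<Union>?P' = insert m' (\<Union>P - {m})" .
qed

text \<open>The classical concatenation of polygons: two opposite vertical sides of a unit square
  are exchanged for its two horizontal sides. Two edges go and two come, so that lengths add
  exactly.\<close>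

definition plaquette_join :: "point set set \<Rightarrow> point set set \<Rightarrow> int \<Rightarrow> int \<Rightarrow> point set set" where
  "plaquette_join P Q x y =
     (P - {{(x, y), (x, y - 1)}}) \<union> (Q - {{(x + 1, y), (x + 1, y - 1)}})
     \<union> {{(x, y), (x + 1, y)}, {(x, y - 1), (x + 1, y - 1)}}"

lemma plaquette_join:
  assumes P: "polygon P" "{(x, y), (x, y - 1)} \<in> P"
    and Q: "polygon Q" "{(x + 1, y), (x + 1, y - 1)} \<in> Q"
    and disj: "\<Union>P \<inter> \<Union>Q = {}"
  shows "polygon (plaquette_join P Q x y)" (is "polygon ?J")
    and "card (plaquette_join P Q x y) = card P + card Q"
    and "\<Union>(plaquette_join P Q x y) = \<Union>P \<union> \<Union>Q"
proof -
  have "{(x, y - 1), (x, y)} \<in> P" using P by (simp add: insert_commute)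
  from polygon_open[OF P(1) this] obtain ys where ys: "saw ys" "length ys \<ge> 3"
    "hd ys = (x, y - 1)" "last ys = (x, y)" "P = insert {(x, y - 1), (x, y)} (path_edges ys)"
    "{(x, y - 1), (x, y)} \<notin> path_edges ys" "set ys = \<Union>P" .
  from polygon_open[OF Q] obtain zs where zs: "saw zs" "length zs \<ge> 3" "hd zs = (x + 1, y)"
    "last zs = (x + 1, y - 1)" "Q = insert {(x + 1, y), (x + 1, y - 1)} (path_edges zs)"
    "{(x + 1, y), (x + 1, y - 1)} \<notin> path_edges zs" "set zs = \<Union>Q" .
  have ne: "ys \<noteq> []" "zs \<noteq> []" using ys(2) zs(2) by auto
  have saw: "saw (ys @ zs)"
    using ys zs disj ne by (auto simp: saw_append adj_iff)
  have cl: "adj (last (ys @ zs)) (hd (ys @ zs))"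
    using ys zs ne by (auto simp: adj_iff)
  have P0: "P - {{(x, y), (x, y - 1)}} = path_edges ys"
    using ys(5,6) by (simp add: insert_commute)
  have Q0: "Q - {{(x + 1, y), (x + 1, y - 1)}} = path_edges zs"
    using zs(5,6) by simp
  have J: "?J = insert {last (ys @ zs), hd (ys @ zs)} (path_edges (ys @ zs))"
    unfolding plaquette_join_def P0 Q0 using ys zs ne
    by (auto simp: path_edges_append insert_commute)
  then show "polygon ?J" using saw cl ys(2) by (simp only:, intro polygonI) auto
  have c: "cycle (ys @ zs)" using saw cl ys(2) by (auto simp: cycle_def)
  have J': "?J = cycle_edges (ys @ zs)" unfolding J cycle_edges_def ..
  have cy: "cycle ys" "cycle zs"
    using ys(1-4) zs(1-4) by (auto simp: cycle_def adj_iff)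
  have "P = cycle_edges ys" "Q = cycle_edges zs"
    using ys zs by (auto simp: cycle_edges_def insert_commute)
  then show "card ?J = card P + card Q"
    unfolding J' using c cy by (simp add: card_cycle_edges)
  show "\<Union>?J = \<Union>P \<union> \<Union>Q"
    unfolding J' Union_cycle_edges[OF c] set_append ys(7) zs(7) ..
qed

text \<open>The two horizontal edges are the only ones between the two sides, so \<open>P\<close> and \<open>Q\<close> can be read
  off their vertex sets.\<close>

lemma plaquette_join_left:
  assumes P: "polygon P" "{(x, y), (x, y - 1)} \<in> P"
    and Q: "polygon Q" "{(x + 1, y), (x + 1, y - 1)} \<in> Q"
    and disj: "\<Union>P \<inter> \<Union>Q = {}"
  shows "P = insert {(x, y), (x, y - 1)} {e \<in> plaquette_join P Q x y. e \<subseteq> \<Union>P}"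
    and "Q = insert {(x + 1, y), (x + 1, y - 1)} {e \<in> plaquette_join P Q x y. e \<subseteq> \<Union>Q}"
proof -
  have v: "(x, y) \<in> \<Union>P" "(x, y - 1) \<in> \<Union>P" "(x + 1, y) \<in> \<Union>Q" "(x + 1, y - 1) \<in> \<Union>Q"
    using P Q by auto
  have *: "e \<in> P \<Longrightarrow> \<not> e \<subseteq> \<Union>Q" "e \<in> Q \<Longrightarrow> \<not> e \<subseteq> \<Union>P" for e
    using polygon_edge_adj[OF P(1)] polygon_edge_adj[OF Q(1)] disj by blast+
  have nv: "(x, y) \<notin> \<Union>Q" "(x, y - 1) \<notin> \<Union>Q" "(x + 1, y) \<notin> \<Union>P" "(x + 1, y - 1) \<notin> \<Union>P"
    using v disj by blast+
  have n: "\<not> {(x, y), (x + 1, y)} \<subseteq> \<Union>P" "\<not> {(x, y), (x + 1, y)} \<subseteq> \<Union>Q"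
    "\<not> {(x, y - 1), (x + 1, y - 1)} \<subseteq> \<Union>P" "\<not> {(x, y - 1), (x + 1, y - 1)} \<subseteq> \<Union>Q"
    using nv by (simp_all only: insert_subset) blast+
  have "{e \<in> plaquette_join P Q x y. e \<subseteq> \<Union>P} = P - {{(x, y), (x, y - 1)}}"
  proof (intro subset_antisym subsetI)
    fix e assume "e \<in> {e \<in> plaquette_join P Q x y. e \<subseteq> \<Union>P}"
    then have "e \<in> plaquette_join P Q x y" "e \<subseteq> \<Union>P" by auto
    then show "e \<in> P - {{(x, y), (x, y - 1)}}"
      unfolding plaquette_join_def using *(2)[of e] n by (elim UnE) (auto simp del: insert_subset)
  qed (auto simp: plaquette_join_def)
  then show "P = insert {(x, y), (x, y - 1)} {e \<in> plaquette_join P Q x y. e \<subseteq> \<Union>P}"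
    using P(2) by auto
  have "{e \<in> plaquette_join P Q x y. e \<subseteq> \<Union>Q} = Q - {{(x + 1, y), (x + 1, y - 1)}}"
  proof (intro subset_antisym subsetI)
    fix e assume "e \<in> {e \<in> plaquette_join P Q x y. e \<subseteq> \<Union>Q}"
    then have "e \<in> plaquette_join P Q x y" "e \<subseteq> \<Union>Q" by auto
    then show "e \<in> Q - {{(x + 1, y), (x + 1, y - 1)}}"
      unfolding plaquette_join_def using *(1)[of e] n by (elim UnE) (auto simp del: insert_subset)
  qed (auto simp: plaquette_join_def)
  then show "Q = insert {(x + 1, y), (x + 1, y - 1)} {e \<in> plaquette_join P Q x y. e \<subseteq> \<Union>Q}"
    using Q(2) by auto
qed

section \<open>Polygons up to translation\<close>

lemma path_edges_map: "path_edges (map f xs) = (`) f ` path_edges xs"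
  by (induction xs) (auto simp: path_edges_Cons hd_map)

lemma cycle_edges_map: "xs \<noteq> [] \<Longrightarrow> cycle_edges (map f xs) = (`) f ` cycle_edges xs"
  by (auto simp: cycle_edges_def path_edges_map hd_map last_map)

lemma polygon_image:
  assumes "inj f" "\<And>p q. adj p q \<Longrightarrow> adj (f p) (f q)" "polygon P"
  shows "polygon ((`) f ` P)"
proof -
  from assms(3) obtain xs where xs: "cycle xs" "P = cycle_edges xs" by (auto simp: polygon_def)
  then have ne: "xs \<noteq> []" by (auto simp: cycle_def)
  have "successively (\<lambda>x y. adj (f x) (f y)) xs"
    using xs assms(2) by (auto simp: cycle_def saw_def intro: successively_mono)
  then have "cycle (map f xs)"
    using xs ne assms by (auto simp: cycle_def saw_def successively_map distinct_map hd_map last_map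
        intro: inj_on_subset)
  then show ?thesis using xs cycle_edges_map[OF ne, of f] by (auto simp: polygon_def)
qed

lemma Union_image_image: "\<Union>((`) f ` P) = f ` \<Union>P"
  by auto

lemma inj_image_image: "inj f \<Longrightarrow> inj ((`) ((`) f))"
  by (simp add: inj_on_image inj_image_eq_iff inj_def)

lemma card_image_image: "inj f \<Longrightarrow> card ((`) f ` P) = card P"
  by (intro card_image) (auto simp: inj_on_def inj_image_eq_iff)

definition translate :: "point \<Rightarrow> point set set \<Rightarrow> point set set" where
  "translate v P = (`) ((+) v) ` P"

lemma translate_0 [simp]: "translate 0 P = P"
  by (simp add: translate_def)

lemma translate_translate: "translate v (translate w P) = translate (v + w) P"
  by (simp add: translate_def image_image add.assoc)

lemma Union_translate: "\<Union>(translate v P) = (+) v ` \<Union>P"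
  by (auto simp: translate_def)

lemma card_translate [simp]: "card (translate v P) = card P"
  by (simp add: translate_def card_image_image)

lemma adj_plus: "adj (v + p) (v + q) \<longleftrightarrow> adj p q"
  by (simp add: adj_def)

lemma polygon_translate: "polygon P \<Longrightarrow> polygon (translate v P)"
  unfolding translate_def by (intro polygon_image) (auto simp: adj_plus)

text \<open>The representative of a translation class whose lexicographically least vertex, row
  before column, is the origin. Comparing rows first makes the origin a lowest vertex, from which
  the two arcs of the polygon will start.\<close>

definition normalized :: "point set set \<Rightarrow> bool" where
  "normalized P \<longleftrightarrow> 0 \<in> \<Union>P \<and> (\<forall>p\<in>\<Union>P. 0 < snd p \<or> snd p = 0 \<and> 0 \<le> fst p)"

lemma ex_normalized:
  assumes "polygon P"
  obtains v where "normalized (translate v P)"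
proof -
  have fin: "finite (\<Union>P)" and ne: "\<Union>P \<noteq> {}"
    using assms finite_vertices polygon_ne by auto
  define y where "y = Min (snd ` \<Union>P)"
  define R where "R = {p \<in> \<Union>P. snd p = y}"
  have "y \<in> snd ` \<Union>P" unfolding y_def using fin ne by (intro Min_in) auto
  then obtain p where p: "p \<in> \<Union>P" "snd p = y" by blast
  have R: "R \<noteq> {}" "finite R"
    using p fin finite_subset[of R "\<Union>P"] unfolding R_def by blast+
  define x where "x = Min (fst ` R)"
  have "x \<in> fst ` R" unfolding x_def using R by (intro Min_in) auto
  then have "(x, y) \<in> R" by (auto simp: R_def)
  then have xy: "(x, y) \<in> \<Union>P" by (auto simp: R_def)
  have lx: "x \<le> fst p" if "p \<in> \<Union>P" "snd p = y" for p
    unfolding x_def using that R by (intro Min_le) (auto simp: R_def)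
  have ly: "y \<le> snd p" if "p \<in> \<Union>P" for p
    unfolding y_def using that fin by (intro Min_le) auto
  have "normalized (translate (- (x, y)) P)"
    unfolding normalized_def Union_translate
  proof (intro conjI ballI)
    have "0 = - (x, y) + (x, y)" by (simp add: zero_prod_def)
    then show "0 \<in> (+) (- (x, y)) ` \<Union>P" using xy by (rule image_eqI)
    fix p assume "p \<in> (+) (- (x, y)) ` \<Union>P"
    then obtain q where q: "q \<in> \<Union>P" "p = - (x, y) + q" by blast
    with lx[of q] ly[of q] show "0 < snd p \<or> snd p = 0 \<and> 0 \<le> fst p" by auto
  qed
  then show thesis by (rule that)
qed

lemma normalized_unique:
  assumes "normalized P" "normalized (translate v P)"
  shows "v = 0"
proof -
  have "v \<in> \<Union>(translate v P)" "- v \<in> \<Union>P"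
  proof -
    have "0 \<in> \<Union>P" using assms by (auto simp: normalized_def)
    then have "v + 0 \<in> (+) v ` \<Union>P" by (rule imageI)
    then show "v \<in> \<Union>(translate v P)" by (simp add: Union_translate)
    have "0 \<in> (+) v ` \<Union>P" using assms(2) unfolding normalized_def Union_translate by blast
    then obtain q where "q \<in> \<Union>P" "0 = v + q" by blast
    then show "- v \<in> \<Union>P" by (metis add_eq_0_iff)
  qed
  then have "0 < snd v \<or> snd v = 0 \<and> 0 \<le> fst v" "0 < snd (- v) \<or> snd (- v) = 0 \<and> 0 \<le> fst (- v)"
    using assms unfolding normalized_def by blast+
  then show ?thesis by (auto simp: prod_eq_iff)
qed

lemma normalized_eq:
  assumes "normalized P" "normalized Q" "translate v P = translate w Q"
  shows "P = Q \<and> v = w"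
proof -
  have "Q = translate (- w + v) P"
    using arg_cong[OF assms(3), of "translate (- w)"] by (simp add: translate_translate)
  then show ?thesis using normalized_unique[of P "- w + v"] assms by (auto simp: add_eq_0_iff)
qed

definition normal_polygons :: "nat \<Rightarrow> point set set set" where
  "normal_polygons n = {P. polygon P \<and> card P = n \<and> normalized P}"

definition pcount :: "nat \<Rightarrow> nat" where
  "pcount n = card (normal_polygons n)"

lemma card_lattice_walks:
  "finite {xs. length xs = Suc n \<and> hd xs = a \<and> successively adj xs} \<and>
   card {xs. length xs = Suc n \<and> hd xs = a \<and> successively adj xs} \<le> 4 ^ n"
proof (induction n arbitrary: a)
  case 0
  have "{xs. length xs = Suc 0 \<and> hd xs = a \<and> successively adj xs} \<subseteq> {[a]}"
    by (auto simp: length_Suc_conv)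
  from finite_subset[OF this] card_mono[OF _ this] show ?case by simp
next
  case (Suc n)
  let ?S = "\<lambda>a. {xs. length xs = Suc n \<and> hd xs = a \<and> successively adj xs}"
  obtain x y where a: "a = (x, y)" by fastforce
  let ?N = "{(x + 1, y), (x - 1, y), (x, y + 1), (x, y - 1)}"
  have sub: "{xs. length xs = Suc (Suc n) \<and> hd xs = a \<and> successively adj xs}
      \<subseteq> (\<Union>b\<in>?N. (#) a ` ?S b)" (is "?L \<subseteq> ?R")
  proof
    fix xs assume "xs \<in> ?L"
    then obtain b bs where "xs = a # b # bs" "length (b # bs) = Suc n" "adj a b"
        "successively adj (b # bs)"
      by (auto simp: length_Suc_conv)
    moreover have "b \<in> ?N" using \<open>adj a b\<close> unfolding a adj_iff .
    ultimately show "xs \<in> ?R" by auto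
  qed
  have fin: "finite ?R" using Suc.IH by blast
  have "card ?R \<le> (\<Sum>b\<in>?N. card ((#) a ` ?S b))"
    by (rule card_UN_le) simp
  also have "\<dots> \<le> (\<Sum>b\<in>?N. 4 ^ n)"
    using Suc.IH by (intro sum_mono order_trans[OF card_image_le]) auto
  also have "\<dots> = 4 ^ Suc n" by simp
  finally show ?case using sub fin card_mono[OF fin sub] finite_subset[OF sub fin] by linarith
qed

text \<open>Rooting a polygon at the origin makes it a lattice walk. The exponential bound keeps the
  logarithms of the counts linear, as Fekete's lemma requires for a finite limit.\<close>

lemma normal_polygons_bound: "finite (normal_polygons n) \<and> pcount n \<le> 4 ^ n"
proof (cases n)
  case 0
  then have "normal_polygons n = {}"
    using card_polygon_ge by (fastforce simp: normal_polygons_def)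
  then show ?thesis by (simp add: pcount_def)
next
  case (Suc m)
  let ?L = "{xs. length xs = Suc m \<and> hd xs = (0 :: point) \<and> successively adj xs}"
  have sub: "normal_polygons n \<subseteq> cycle_edges ` ?L"
  proof
    fix P assume P: "P \<in> normal_polygons n"
    then have "polygon P" "0 \<in> \<Union>P" "card P = n" by (auto simp: normal_polygons_def normalized_def)
    then obtain ys where "cycle (0 # ys)" "P = cycle_edges (0 # ys)"
      using polygon_start_at by blast
    moreover have "length (0 # ys) = Suc m"
      using card_cycle_edges[of "0 # ys"] calculation \<open>card P = n\<close> Suc by simp
    ultimately show "P \<in> cycle_edges ` ?L"
      by (intro image_eqI[of _ _ "0 # ys"]) (auto simp: cycle_def saw_def)
  qed
  have fin: "finite ?L" and le: "card ?L \<le> 4 ^ m" using card_lattice_walks by auto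
  have "pcount n \<le> card (cycle_edges ` ?L)"
    unfolding pcount_def using fin sub by (intro card_mono) auto
  also have "\<dots> \<le> 4 ^ m" using card_image_le[OF fin, of cycle_edges] le by linarith
  also have "\<dots> \<le> 4 ^ n" using Suc by simp
  finally show ?thesis using finite_subset[OF sub] fin by blast
qed

lemma finite_normal_polygons: "finite (normal_polygons n)"
  using normal_polygons_bound by blast

subsection \<open>Passage from vectors to pairs\<close>

definition vec_point :: "int ^ 2 \<Rightarrow> point" where
  "vec_point x = (x $ 1, x $ 2)"

definition point_vec :: "point \<Rightarrow> int ^ 2" where
  "point_vec p = (\<chi> i. if i = 1 then fst p else snd p)"

lemma vec_point_inverse [simp]: "point_vec (vec_point x) = x" "vec_point (point_vec p) = p"
  by (auto simp: point_vec_def vec_point_def vec_eq_iff forall_2)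

lemma inj_vec_point: "inj vec_point" and inj_point_vec: "inj point_vec"
  by (metis injI vec_point_inverse(1), metis injI vec_point_inverse(2))

lemma vec_point_plus: "vec_point (x + v) = vec_point v + vec_point x"
  by (simp add: vec_point_def)

lemma lattice_dist_eq_1: "lattice_dist x y = 1 \<longleftrightarrow> adj (vec_point x) (vec_point y)"
proof -
  define a b where "a = x $ 1 - y $ 1" and "b = x $ 2 - y $ 2"
  have "lattice_dist x y = sqrt ((real_of_int a)\<^sup>2 + (real_of_int b)\<^sup>2)"
    by (simp add: lattice_dist_def norm_vec_def L2_set_def sum_2 a_def b_def)
  then have "lattice_dist x y = 1 \<longleftrightarrow> (real_of_int a)\<^sup>2 + (real_of_int b)\<^sup>2 = 1"
    by simp
  also have "\<dots> \<longleftrightarrow> real_of_int (a\<^sup>2 + b\<^sup>2) = real_of_int 1"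
    by simp
  also have "\<dots> \<longleftrightarrow> a\<^sup>2 + b\<^sup>2 = 1"
    by (rule of_int_eq_iff)
  also have "\<dots> \<longleftrightarrow> \<bar>a\<bar> + \<bar>b\<bar> = 1"
  proof
    assume h: "a\<^sup>2 + b\<^sup>2 = 1"
    have "a\<^sup>2 \<le> 1" "b\<^sup>2 \<le> 1"
      using h zero_le_power2[of a] zero_le_power2[of b] by linarith+
    then have "\<bar>a\<bar> \<le> 1" "\<bar>b\<bar> \<le> 1"
      by (simp_all only: abs_square_le_1)
    then have "a \<in> {-1, 0, 1}" "b \<in> {-1, 0, 1}" by auto
    then show "\<bar>a\<bar> + \<bar>b\<bar> = 1" using h by auto
  next
    assume "\<bar>a\<bar> + \<bar>b\<bar> = 1"
    then have "(a = 0 \<and> (b = 1 \<or> b = -1)) \<or> (b = 0 \<and> (a = 1 \<or> a = -1))" by arith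
    then show "a\<^sup>2 + b\<^sup>2 = 1" by auto
  qed
  finally show ?thesis by (simp add: adj_def vec_point_def a_def b_def)
qed

lemma polygon_of_walk_image:
  assumes "n > 2"
  shows "(`) vec_point ` polygon_of_walk n \<gamma> = cycle_edges (map (vec_point \<circ> \<gamma>) [0..<n])"
proof -
  let ?xs = "map (vec_point \<circ> \<gamma>) [0..<n]"
  have *: "{{vec_point (\<gamma> (i - 1)), vec_point (\<gamma> i)} | i. 1 \<le> i \<and> i \<le> n - 1} = path_edges ?xs"
  proof (intro subset_antisym subsetI)
    fix f assume "f \<in> {{vec_point (\<gamma> (i - 1)), vec_point (\<gamma> i)} | i. 1 \<le> i \<and> i \<le> n - 1}"
    then obtain i where i: "1 \<le> i" "i \<le> n - 1" "f = {vec_point (\<gamma> (i - 1)), vec_point (\<gamma> i)}"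
      by blast
    then have "Suc (i - 1) < length ?xs" using assms by simp
    from path_edges_nth[OF this] show "f \<in> path_edges ?xs" using i by simp
  next
    fix f assume "f \<in> path_edges ?xs"
    then obtain i where "Suc i < n" "f = {vec_point (\<gamma> i), vec_point (\<gamma> (Suc i))}"
      by (auto simp: path_edges_conv_nth)
    then show "f \<in> {{vec_point (\<gamma> (i - 1)), vec_point (\<gamma> i)} | i. 1 \<le> i \<and> i \<le> n - 1}"
      by (intro CollectI exI[of _ "Suc i"]) auto
  qed
  have "(`) vec_point ` polygon_of_walk n \<gamma> =
      {{vec_point (\<gamma> (i - 1)), vec_point (\<gamma> i)} | i. 1 \<le> i \<and> i \<le> n - 1}
      \<union> {{vec_point (\<gamma> (n - 1)), vec_point (\<gamma> 0)}}"
    unfolding polygon_of_walk_def image_Un setcompr_eq_image image_image by simp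
  also have "\<dots> = cycle_edges ?xs"
    unfolding * using assms by (simp add: cycle_edges_def last_map hd_map)
  finally show ?thesis .
qed

lemma closing_walk_iff:
  assumes "n > 2"
  shows "closing_walk n \<gamma> \<longleftrightarrow> cycle (map (vec_point \<circ> \<gamma>) [0..<n])"
proof -
  let ?xs = "map (vec_point \<circ> \<gamma>) [0..<n]"
  have set: "{0..n - 1} = {0..<n}" using assms by auto
  have "inj_on \<gamma> {0..n - 1} \<longleftrightarrow> distinct ?xs"
    unfolding set using inj_vec_point by (auto simp: distinct_map inj_on_def inj_def)
  moreover have "walk (n - 1) \<gamma> \<longleftrightarrow> successively adj ?xs"
    unfolding walk_def successively_conv_nth lattice_dist_eq_1
    by (auto simp: adj_sym)
  moreover have "lattice_dist (\<gamma> (n - 1)) (\<gamma> 0) = 1 \<longleftrightarrow> adj (last ?xs) (hd ?xs)"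
    using assms by (simp add: lattice_dist_eq_1 last_map hd_map)
  ultimately show ?thesis
    using assms by (auto simp: closing_walk_def self_avoiding_walk_def cycle_def saw_def)
qed

lemma self_avoiding_polygon_iff:
  "self_avoiding_polygon P \<longleftrightarrow> polygon ((`) vec_point ` P)"
proof
  assume "self_avoiding_polygon P"
  then obtain n \<gamma> where "n > 2" "closing_walk n \<gamma>" "P = polygon_of_walk n \<gamma>"
    by (auto simp: self_avoiding_polygon_def)
  then show "polygon ((`) vec_point ` P)"
    using polygon_of_walk_image closing_walk_iff by (auto simp: polygon_def)
next
  assume "polygon ((`) vec_point ` P)"
  then obtain xs where xs: "cycle xs" "(`) vec_point ` P = cycle_edges xs"
    by (auto simp: polygon_def)
  define n \<gamma> where "n = length xs" and "\<gamma> = (\<lambda>i. point_vec (xs ! i))"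
  have n: "n > 2" using xs by (auto simp: cycle_def n_def)
  have eq: "map (vec_point \<circ> \<gamma>) [0..<n] = xs"
    by (intro nth_equalityI) (auto simp: n_def \<gamma>_def)
  have "(`) vec_point ` P = (`) vec_point ` polygon_of_walk n \<gamma>"
    unfolding polygon_of_walk_image[OF n] eq xs(2) ..
  then have "P = polygon_of_walk n \<gamma>"
    using inj_image_image[OF inj_vec_point] by (simp add: inj_eq)
  moreover have "closing_walk n \<gamma>" unfolding closing_walk_iff[OF n] eq by (rule xs)
  ultimately show "self_avoiding_polygon P" using n by (auto simp: self_avoiding_polygon_def)
qed

lemma translation_rel_iff:
  "(P, Q) \<in> translation_rel \<longleftrightarrow> (\<exists>v. (`) vec_point ` Q = translate v ((`) vec_point ` P))"
proof -
  have *: "(`) vec_point ` ((\<lambda>e. (\<lambda>x. x + v) ` e) ` P) = translate (vec_point v) ((`) vec_point ` P)"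
    for v :: "int ^ 2"
    unfolding translate_def by (simp add: image_image vec_point_plus)
  show ?thesis
  proof
    assume "(P, Q) \<in> translation_rel"
    then obtain v where "Q = (\<lambda>e. (\<lambda>x. x + v) ` e) ` P"
      by (auto simp: translation_rel_def)
    then show "\<exists>v. (`) vec_point ` Q = translate v ((`) vec_point ` P)" using * by blast
  next
    assume "\<exists>v. (`) vec_point ` Q = translate v ((`) vec_point ` P)"
    then obtain v where "(`) vec_point ` Q = translate (vec_point (point_vec v)) ((`) vec_point ` P)"
      by auto
    then have "(`) vec_point ` Q = (`) vec_point ` ((\<lambda>e. (\<lambda>x. x + point_vec v) ` e) ` P)"
      unfolding * .
    then have "Q = (\<lambda>e. (\<lambda>x. x + point_vec v) ` e) ` P"
      using inj_image_image[OF inj_vec_point] by (simp only: inj_eq)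
    then show "(P, Q) \<in> translation_rel" by (auto simp: translation_rel_def)
  qed
qed

text \<open>Every translation class contains exactly one normalized polygon, so that a quotient set
  can be traded for a set of representatives.\<close>

lemma num_polygons_eq: "num_polygons TYPE(2) n = pcount n"
proof -
  let ?S = "{P :: (int ^ 2) set set. self_avoiding_polygon P \<and> card P = n}"
  let ?\<Phi> = "\<lambda>P. (`) vec_point ` P" and ?\<Psi> = "\<lambda>P. (`) point_vec ` P"
  define g where "g P = translation_rel `` {?\<Psi> P}" for P
  have \<Phi>\<Psi>: "?\<Phi> (?\<Psi> P) = P" "?\<Psi> (?\<Phi> Q) = Q" for P Q
    by (simp_all add: image_image)
  have cl: "translation_rel `` {P} = {Q. \<exists>v. ?\<Phi> Q = translate v (?\<Phi> P)}" for P
    by (simp add: translation_rel_iff Image_def)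
  have "bij_betw g (normal_polygons n) (?S // translation_rel)"
    unfolding bij_betw_def
  proof
    show "inj_on g (normal_polygons n)"
    proof
      fix P Q assume P: "P \<in> normal_polygons n" and Q: "Q \<in> normal_polygons n" and eq: "g P = g Q"
      have "?\<Psi> Q \<in> g Q" unfolding g_def cl mem_Collect_eq \<Phi>\<Psi>
        by (rule exI[of _ 0]) simp
      then have "?\<Psi> Q \<in> g P" using eq by simp
      then have "\<exists>v. ?\<Phi> (?\<Psi> Q) = translate v (?\<Phi> (?\<Psi> P))"
        by (simp only: g_def cl mem_Collect_eq)
      then obtain v where "Q = translate v P" unfolding \<Phi>\<Psi> by auto
      then have "translate v P = translate 0 Q" by simp
      moreover have "normalized P" "normalized Q" using P Q by (simp_all add: normal_polygons_def)
      ultimately show "P = Q" using normalized_eq by blast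
    qed
    show "g ` normal_polygons n = ?S // translation_rel"
    proof (intro subset_antisym subsetI)
      fix X assume "X \<in> g ` normal_polygons n"
      then obtain P where P: "P \<in> normal_polygons n" "X = g P" by blast
      then have "?\<Psi> P \<in> ?S"
        by (auto simp: self_avoiding_polygon_iff \<Phi>\<Psi> normal_polygons_def
            card_image_image[OF inj_point_vec])
      then show "X \<in> ?S // translation_rel" using P unfolding g_def by (auto intro: quotientI)
    next
      fix X assume "X \<in> ?S // translation_rel"
      then obtain P where P: "self_avoiding_polygon P" "card P = n" "X = translation_rel `` {P}"
        by (auto elim!: quotientE)
      then have pol: "polygon (?\<Phi> P)" by (simp add: self_avoiding_polygon_iff)
      then obtain v where v: "normalized (translate v (?\<Phi> P))" using ex_normalized by blast
      have "translate v (?\<Phi> P) \<in> normal_polygons n"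
        using v pol P by (auto simp: normal_polygons_def polygon_translate
            card_image_image[OF inj_vec_point])
      moreover have "g (translate v (?\<Phi> P)) = X"
        unfolding g_def P cl \<Phi>\<Psi>
      proof (intro Collect_cong iffI)
        fix Q assume "\<exists>w. ?\<Phi> Q = translate w (translate v (?\<Phi> P))"
        then show "\<exists>w. ?\<Phi> Q = translate w (?\<Phi> P)"
          unfolding translate_translate by blast
      next
        fix Q assume "\<exists>w. ?\<Phi> Q = translate w (?\<Phi> P)"
        then obtain w where "?\<Phi> Q = translate w (?\<Phi> P)" by blast
        then have "?\<Phi> Q = translate (w - v) (translate v (?\<Phi> P))"
          by (simp add: translate_translate)
        then show "\<exists>w. ?\<Phi> Q = translate w (translate v (?\<Phi> P))" by blast
      qed
      ultimately show "X \<in> g ` normal_polygons n" by blast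
    qed
  qed
  then show ?thesis unfolding num_polygons_def pcount_def by (simp add: bij_betw_same_card)
qed

section \<open>The connective constant\<close>

text \<open>An injection that is given only as a relation. The joins involve shifts whose mere
  existence is known; it suffices that the source can be recovered from the image whatever shifts
  were chosen.\<close>

lemma card_le_by_relation:
  assumes "finite X" and ex: "\<And>t. t \<in> T \<Longrightarrow> \<exists>x\<in>X. R t x"
    and uniq: "\<And>s t x. s \<in> T \<Longrightarrow> t \<in> T \<Longrightarrow> x \<in> X \<Longrightarrow> R s x \<Longrightarrow> R t x \<Longrightarrow> s = t"
  shows "card T \<le> card X"
proof -
  define f where "f t = (SOME x. x \<in> X \<and> R t x)" for t
  have f: "f t \<in> X \<and> R t (f t)" if "t \<in> T" for t
    unfolding f_def by (rule someI_ex) (use ex[OF that] in blast)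
  have "inj_on f T"
  proof
    fix s t assume "s \<in> T" "t \<in> T" "f s = f t"
    then show "s = t" using uniq[of s t "f s"] f[of s] f[of t] by simp
  qed
  moreover have "f ` T \<subseteq> X" using f by blast
  ultimately show ?thesis using assms(1) card_inj_on_le by blast
qed

text \<open>A rightmost vertex has two neighbours in the polygon, none on its right and at most one
  on its left, so one of them is vertical.\<close>

lemma ex_rightmost_edge:
  assumes "polygon P"
  obtains x y where "{(x, y), (x, y - 1)} \<in> P" "\<forall>p\<in>\<Union>P. fst p \<le> x"
proof -
  have fin: "finite (\<Union>P)" "\<Union>P \<noteq> {}" using assms finite_vertices polygon_ne by auto
  define x where "x = Max (fst ` \<Union>P)"
  have "x \<in> fst ` \<Union>P" unfolding x_def using fin by (intro Max_in) auto
  then obtain y where v: "(x, y) \<in> \<Union>P" by fastforce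
  have le: "fst p \<le> x" if "p \<in> \<Union>P" for p
    unfolding x_def using fin that by (intro Max_ge) auto
  from two_neighbours[OF assms v] obtain p q
    where pq: "p \<noteq> q" "{(x, y), p} \<in> P" "{(x, y), q} \<in> P" .
  have "fst p \<le> x" "fst q \<le> x" using le pq by blast+
  moreover have "adj (x, y) p" "adj (x, y) q" using pq assms polygon_adj by blast+
  ultimately have "p \<in> {(x - 1, y), (x, y + 1), (x, y - 1)}" "q \<in> {(x - 1, y), (x, y + 1), (x, y - 1)}"
    by (auto simp: adj_iff)
  then have "{(x, y), (x, y + 1)} \<in> P \<or> {(x, y), (x, y - 1)} \<in> P" using pq by auto
  then show thesis
  proof
    assume "{(x, y), (x, y + 1)} \<in> P"
    then have "{(x, y + 1), (x, (y + 1) - 1)} \<in> P" by (simp add: insert_commute)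
    then show thesis using le by (intro that[of x "y + 1"]) auto
  next
    assume "{(x, y), (x, y - 1)} \<in> P"
    then show thesis using le by (intro that[of x y]) auto
  qed
qed

definition mirror :: "point \<Rightarrow> point" where
  "mirror p = (- fst p, snd p)"

lemma mirror_mirror [simp]: "mirror (mirror p) = p"
  by (simp add: mirror_def)

lemma inj_mirror: "inj mirror"
  by (metis injI mirror_mirror)

lemma adj_mirror: "adj (mirror p) (mirror q) \<longleftrightarrow> adj p q"
  by (auto simp: adj_def mirror_def)

lemma ex_leftmost_edge:
  assumes "polygon P"
  obtains x y where "{(x, y), (x, y - 1)} \<in> P" "\<forall>p\<in>\<Union>P. x \<le> fst p"
proof -
  have "polygon ((`) mirror ` P)"
    using assms by (intro polygon_image) (auto simp: inj_mirror adj_mirror)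
  then obtain x y where xy: "{(x, y), (x, y - 1)} \<in> (`) mirror ` P"
    "\<forall>p\<in>\<Union>((`) mirror ` P). fst p \<le> x"
    by (rule ex_rightmost_edge)
  from xy(1) obtain e where e: "e \<in> P" "{(x, y), (x, y - 1)} = mirror ` e" by blast
  have "e = mirror ` mirror ` e" unfolding image_image by simp
  then have "e = {(- x, y), (- x, y - 1)}" unfolding e(2)[symmetric] by (simp add: mirror_def)
  then have "{(- x, y), (- x, y - 1)} \<in> P" using e by simp
  moreover have "- x \<le> fst p" if "p \<in> \<Union>P" for p
  proof -
    have "mirror p \<in> \<Union>((`) mirror ` P)" unfolding Union_image_image using that by (rule imageI)
    then have "fst (mirror p) \<le> x" by (rule xy(2)[rule_format])
    then show ?thesis by (simp add: mirror_def)
  qed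
  ultimately show thesis using that by blast
qed

lemma plaquette_join_crossing:
  assumes P: "polygon P" and Q: "polygon Q" and disj: "\<Union>P \<inter> \<Union>Q = {}"
    and e: "e \<in> plaquette_join P Q x y" "p \<in> e" "p \<in> \<Union>P" "q \<in> e" "q \<in> \<Union>Q"
  shows "e = {(x, y), (x + 1, y)} \<or> e = {(x, y - 1), (x + 1, y - 1)}"
proof -
  have "e \<notin> P" "e \<notin> Q" using e disj by blast+
  then show ?thesis using e(1) by (auto simp: plaquette_join_def)
qed

lemma column_separated:
  assumes "\<forall>p\<in>V. fst p \<le> (x :: int)" "\<forall>p\<in>W. x + 1 \<le> fst p"
  shows "V \<inter> W = {}" "V = {p \<in> V \<union> W. fst p \<le> x}" "W = (V \<union> W) - V"
  using assms by force+

text \<open>A rightmost vertical edge of the first polygon is placed beside a leftmost one of the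
  second. No constant is lost, because the known number \<open>n\<close> of vertices on the left
  tells where the join was made.\<close>

lemma pcount_mult: "pcount n * pcount m \<le> pcount (n + m)"
proof -
  define R where "R = (\<lambda>(A, B) C. \<exists>v w x y.
     {(x, y), (x, y - 1)} \<in> translate v A \<and> {(x + 1, y), (x + 1, y - 1)} \<in> translate w B \<and>
     (\<forall>p\<in>\<Union>(translate v A). fst p \<le> x) \<and> (\<forall>p\<in>\<Union>(translate w B). x + 1 \<le> fst p) \<and>
     C = plaquette_join (translate v A) (translate w B) x y)"
  have "card (normal_polygons n \<times> normal_polygons m) \<le> card (normal_polygons (n + m))"
  proof (rule card_le_by_relation[where R = R])
    fix t assume "t \<in> normal_polygons n \<times> normal_polygons m"
    then obtain A B where t: "t = (A, B)" "A \<in> normal_polygons n" "B \<in> normal_polygons m" by blast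
    then have A: "polygon A" "card A = n" and B: "polygon B" "card B = m"
      by (auto simp: normal_polygons_def)
    obtain x y where xy: "{(x, y), (x, y - 1)} \<in> A" "\<forall>p\<in>\<Union>A. fst p \<le> x"
      using ex_rightmost_edge[OF A(1)] .
    obtain x' y' where xy': "{(x', y'), (x', y' - 1)} \<in> B" "\<forall>p\<in>\<Union>B. x' \<le> fst p"
      using ex_leftmost_edge[OF B(1)] .
    define B' where "B' = translate (x + 1 - x', y - y') B"
    have B': "polygon B'" "card B' = m" using B by (auto simp: B'_def polygon_translate)
    have eB: "{(x + 1, y), (x + 1, y - 1)} \<in> B'"
      unfolding B'_def translate_def using xy'(1) by (rule rev_image_eqI) simp
    have vB: "x + 1 \<le> fst p" if "p \<in> \<Union>B'" for p
    proof -
      from that obtain q where "q \<in> \<Union>B" "p = (x + 1 - x', y - y') + q"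
        unfolding B'_def Union_translate by blast
      with xy'(2) show ?thesis by auto
    qed
    have vB': "\<forall>p\<in>\<Union>B'. x + 1 \<le> fst p" using vB by blast
    have disj: "\<Union>A \<inter> \<Union>B' = {}" using column_separated(1)[OF xy(2) vB'] .
    note J = plaquette_join[OF A(1) xy(1) B'(1) eB disj]
    obtain u where u: "normalized (translate u (plaquette_join A B' x y))"
      using ex_normalized[OF J(1)] .
    have Ceq: "translate u (plaquette_join A B' x y) =
        plaquette_join (translate u A) (translate u B') (x + fst u) (y + snd u)"
    proof -
      have i: "inj ((`) ((+) u))" by (simp add: inj_on_image inj_image_eq_iff inj_def)
      have "u + (a, b) = (a + fst u, b + snd u)" for a b by (simp add: prod_eq_iff)
      then show ?thesis
        unfolding plaquette_join_def translate_def image_Un image_set_diff[OF i] by (simp add: algebra_simps)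
    qed
    have "translate u (plaquette_join A B' x y) \<in> normal_polygons (n + m)"
      using J A B' u by (simp add: normal_polygons_def polygon_translate)
    then have "plaquette_join (translate u A) (translate u B') (x + fst u) (y + snd u)
        \<in> normal_polygons (n + m)" unfolding Ceq .
    moreover have "R t (plaquette_join (translate u A) (translate u B') (x + fst u) (y + snd u))"
      unfolding R_def t prod.case
    proof (intro exI conjI)
      have m: "u + (a, b) = (a + fst u, b + snd u)" for a b by (simp add: prod_eq_iff)
      show "{(x + fst u, y + snd u), (x + fst u, y + snd u - 1)} \<in> translate u A"
        unfolding translate_def using xy(1) by (rule rev_image_eqI) (simp add: m algebra_simps)
      show "{(x + fst u + 1, y + snd u), (x + fst u + 1, y + snd u - 1)} \<in>
          translate (u + (x + 1 - x', y - y')) B"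
        unfolding translate_translate[symmetric] B'_def[symmetric] unfolding translate_def
        using eB by (rule rev_image_eqI) (simp add: m algebra_simps)
      show "\<forall>p\<in>\<Union>(translate u A). fst p \<le> x + fst u"
        using xy(2) unfolding Union_translate by auto
      show "\<forall>p\<in>\<Union>(translate (u + (x + 1 - x', y - y')) B). x + fst u + 1 \<le> fst p"
        unfolding translate_translate[symmetric] B'_def[symmetric]
        unfolding Union_translate[of u] using vB by auto
    qed (simp add: B'_def translate_translate)
    ultimately show "\<exists>C\<in>normal_polygons (n + m). R t C" by (rule rev_bexI)
  next
    fix s t C
    assume "s \<in> normal_polygons n \<times> normal_polygons m" "t \<in> normal_polygons n \<times> normal_polygons m"
      and "R s C" "R t C"
    then obtain A B A' B' v w x y v' w' x' y' where
      st: "s = (A, B)" "t = (A', B')" "A \<in> normal_polygons n" "B \<in> normal_polygons m"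
        "A' \<in> normal_polygons n" "B' \<in> normal_polygons m" and
      1: "{(x, y), (x, y - 1)} \<in> translate v A" "{(x + 1, y), (x + 1, y - 1)} \<in> translate w B"
        "\<forall>p\<in>\<Union>(translate v A). fst p \<le> x" "\<forall>p\<in>\<Union>(translate w B). x + 1 \<le> fst p"
        "C = plaquette_join (translate v A) (translate w B) x y" and
      2: "{(x', y'), (x', y' - 1)} \<in> translate v' A'" "{(x' + 1, y'), (x' + 1, y' - 1)} \<in> translate w' B'"
        "\<forall>p\<in>\<Union>(translate v' A'). fst p \<le> x'" "\<forall>p\<in>\<Union>(translate w' B'). x' + 1 \<le> fst p"
        "C = plaquette_join (translate v' A') (translate w' B') x' y'"
      unfolding R_def by auto
    define A1 B1 A2 B2 where d: "A1 = translate v A" "B1 = translate w B"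
      "A2 = translate v' A'" "B2 = translate w' B'"
    have p: "polygon A1" "polygon B1" "polygon A2" "polygon B2" "card A1 = n" "card A2 = n"
      and nz: "normalized A" "normalized B" "normalized A'" "normalized B'"
      using st by (auto simp: d normal_polygons_def polygon_translate)
    note 1 = 1[folded d] and 2 = 2[folded d]
    note disj = column_separated(1)[OF 1(3,4)] column_separated(1)[OF 2(3,4)]
    note J1 = plaquette_join[OF p(1) 1(1) p(2) 1(2) disj(1)]
    note J2 = plaquette_join[OF p(3) 2(1) p(4) 2(2) disj(2)]
    have V1: "\<Union>A1 = {p \<in> \<Union>C. fst p \<le> x}" and W1: "\<Union>B1 = \<Union>C - \<Union>A1"
      unfolding 1(5) J1(3) by (rule column_separated[OF 1(3,4)])+
    have V2: "\<Union>A2 = {p \<in> \<Union>C. fst p \<le> x'}" and W2: "\<Union>B2 = \<Union>C - \<Union>A2"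
      unfolding 2(5) J2(3) by (rule column_separated[OF 2(3,4)])+
    have cV: "card (\<Union>A1) = n" "card (\<Union>A2) = n" using p by (simp_all add: card_vertices)
    have fin: "finite (\<Union>A1)" "finite (\<Union>A2)" using p by (simp_all add: finite_vertices)
    \<comment> \<open>The left parts of two decompositions of \<open>C\<close> are cut out by half
      planes. They are therefore nested, and both have \<open>n\<close> vertices.\<close>
    have V: "\<Union>A1 = \<Union>A2"
    proof (cases "x \<le> x'")
      case True
      then have "\<Union>A1 \<subseteq> \<Union>A2" unfolding V1 V2 by auto
      then show ?thesis using card_subset_eq[OF fin(2)] cV by metis
    next
      case False
      then have "\<Union>A2 \<subseteq> \<Union>A1" unfolding V1 V2 by auto
      then show ?thesis using card_subset_eq[OF fin(1)] cV by metis
    qed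
    have W: "\<Union>B1 = \<Union>B2" unfolding W1 W2 V ..
    have xeq: "x = x'"
    proof -
      have "(x, y) \<in> \<Union>A2" "(x', y') \<in> \<Union>A1" using 1(1) 2(1) V by blast+
      then show ?thesis using 1(3) 2(3) by force
    qed
    have v: "(x, y) \<in> \<Union>A1" "(x + 1, y) \<in> \<Union>B1" "(x', y') \<in> \<Union>A2" "(x' + 1, y') \<in> \<Union>B2"
      using 1 2 by blast+
    \<comment> \<open>The upper connecting edge of each join must be a connecting edge of the other.
      This gives \<open>y \<le> y'\<close> in one direction and \<open>y' \<le> y\<close> in the
      other.\<close>
    have eC: "{(x, y), (x + 1, y)} \<in> plaquette_join A2 B2 x' y'"
      unfolding 2(5)[symmetric] unfolding 1(5) plaquette_join_def by simp
    have eC': "{(x', y'), (x' + 1, y')} \<in> plaquette_join A1 B1 x y"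
      unfolding 1(5)[symmetric] unfolding 2(5) plaquette_join_def by simp
    have v': "(x, y) \<in> \<Union>A2" "(x + 1, y) \<in> \<Union>B2" "(x', y') \<in> \<Union>A1" "(x' + 1, y') \<in> \<Union>B1"
      using v unfolding V W .
    have "y \<in> {y', y' - 1}"
      using plaquette_join_crossing[OF p(3,4) disj(2) eC _ v'(1) _ v'(2)]
      by (auto simp: doubleton_eq_iff)
    moreover have "y' \<in> {y, y - 1}"
      using plaquette_join_crossing[OF p(1,2) disj(1) eC' _ v'(3) _ v'(4)]
      by (auto simp: doubleton_eq_iff)
    ultimately have yeq: "y = y'" by auto
    have eqs: "A1 = insert {(x, y), (x, y - 1)} {e \<in> C. e \<subseteq> \<Union>A1}"
      "B1 = insert {(x + 1, y), (x + 1, y - 1)} {e \<in> C. e \<subseteq> \<Union>B1}"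
      unfolding 1(5) by (rule plaquette_join_left[OF p(1) 1(1) p(2) 1(2) disj(1)])+
    have eqs': "A2 = insert {(x', y'), (x', y' - 1)} {e \<in> C. e \<subseteq> \<Union>A2}"
      "B2 = insert {(x' + 1, y'), (x' + 1, y' - 1)} {e \<in> C. e \<subseteq> \<Union>B2}"
      unfolding 2(5) by (rule plaquette_join_left[OF p(3) 2(1) p(4) 2(2) disj(2)])+
    have "A1 = A2" "B1 = B2"
      using trans[OF eqs(1)[unfolded V xeq yeq] eqs'(1)[symmetric]]
        trans[OF eqs(2)[unfolded W xeq yeq] eqs'(2)[symmetric]] .
    then have "A = A'" "B = B'" unfolding d using normalized_eq nz by metis+
    then show "s = t" using st by simp
  qed (rule finite_normal_polygons)
  then show ?thesis by (simp add: pcount_def card_cartesian_product)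
qed

lemma pcount_eq_0: "n < 3 \<Longrightarrow> pcount n = 0"
proof -
  assume "n < 3"
  then have "P \<notin> normal_polygons n" for P
    using card_polygon_ge[of P] by (auto simp: normal_polygons_def)
  then have "normal_polygons n = {}" by blast
  then show ?thesis by (simp add: pcount_def)
qed

lemma pcount_pos:
  assumes "even n" "n \<ge> 4"
  shows "pcount n \<ge> 1"
proof -
  have base: "pcount (length xs) \<ge> 1" if "cycle xs" for xs
  proof -
    have "polygon (cycle_edges xs)" using that by (auto simp: polygon_def)
    then obtain v where "normalized (translate v (cycle_edges xs))" using ex_normalized by blast
    then have "translate v (cycle_edges xs) \<in> normal_polygons (length xs)"
      using that \<open>polygon (cycle_edges xs)\<close>
      by (simp add: normal_polygons_def polygon_translate card_cycle_edges)
    then have "pcount (length xs) \<noteq> 0"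
      using finite_normal_polygons unfolding pcount_def by (auto simp: card_eq_0_iff)
    then show ?thesis by simp
  qed
  \<comment> \<open>Two base cases are required, since joining a unit square raises the length by
    4.\<close>
  have 4: "pcount 4 \<ge> 1"
    using base[of "[(0, 0), (1, 0), (1, 1), (0, 1)]"]
    by (auto simp: cycle_def saw_def adj_def numeral_eq_Suc)
  have 6: "pcount 6 \<ge> 1"
    using base[of "[(0, 0), (1, 0), (2, 0), (2, 1), (1, 1), (0, 1)]"]
    by (auto simp: cycle_def saw_def adj_def numeral_eq_Suc)
  show ?thesis using assms
  proof (induction n rule: less_induct)
    case (less n)
    show ?case
    proof (cases "n = 4 \<or> n = 6")
      case False
      with less.prems have n: "n \<ge> 8" by (auto elim!: evenE)
      then have "pcount (n - 4) \<ge> 1" using less by auto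
      then have "1 * 1 \<le> pcount (n - 4) * pcount 4" using 4 by (intro mult_le_mono)
      also have "\<dots> \<le> pcount n" using pcount_mult[of "n - 4" 4] n by simp
      finally show ?thesis by simp
    qed (use 4 6 in auto)
  qed
qed

text \<open>Fekete's lemma with indices from 2 on: there is no polygon of length 2, so the logarithm
  of \<open>pcount (2 * k)\<close> is meaningful from \<open>k = 2\<close> only.\<close>

lemma superadditive_limit:
  fixes a :: "nat \<Rightarrow> real" and C :: real
  assumes add: "\<And>j k. j \<ge> 2 \<Longrightarrow> k \<ge> 2 \<Longrightarrow> a j + a k \<le> a (j + k)"
    and nonneg: "\<And>k. k \<ge> 2 \<Longrightarrow> 0 \<le> a k" and bound: "\<And>k. k \<ge> 2 \<Longrightarrow> a k \<le> C * k"
  obtains L where "(\<lambda>k. a k / k) \<longlonglongrightarrow> L" "\<forall>k\<ge>2. a k \<le> L * real k" "L \<ge> 0"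
proof -
  define S where "S = (\<lambda>k. a k / k) ` {2..}"
  define L where "L = Sup S"
  have bdd: "bdd_above S" unfolding S_def
    by (rule bdd_aboveI2[where M = C]) (use bound in \<open>auto simp: field_simps\<close>)
  have up: "a k / k \<le> L" if "k \<ge> 2" for k
    unfolding L_def using bdd that by (intro cSup_upper) (auto simp: S_def)
  have mult: "real q * a m \<le> a (q * m)" if "q \<ge> 1" "m \<ge> 2" for q m
    using that(1)
  proof (induction q rule: dec_induct)
    case (step q)
    have "q * m \<ge> 2" using step that by (metis le_trans mult_le_mono1 nat_mult_1)
    from add[OF this that(2)] step show ?case by (simp add: algebra_simps)
  qed simp
  have "(\<lambda>k. a k / k) \<longlonglongrightarrow> L"
  proof (rule LIMSEQ_I)
    fix e :: real assume "e > 0"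
    obtain x where "x \<in> S" "L - e / 2 < x"
      using less_cSupD[of S "L - e / 2"] \<open>e > 0\<close> unfolding L_def S_def by auto
    then obtain m where m: "m \<ge> 2" "L - e / 2 < a m / m" by (auto simp: S_def)
    obtain N :: nat where N: "real N > 4 * a m / e" using reals_Archimedean2 by blast
    have "norm (a k / k - L) < e" if "k \<ge> max (2 * m) (N + 2)" for k
    proof -
      \<comment> \<open>One block fewer than fits into \<open>k\<close>, so that the remainder
        \<open>r\<close> is at least \<open>m\<close> and superadditivity applies to it as
        well.\<close>
      define q where "q = k div m - 1"
      have k: "k \<ge> 2 * m" "k \<ge> 2" "k > N" using that by auto
      have "k div m \<ge> 2" using k m by (simp add: less_eq_div_iff_mult_less_eq)
      then have q: "q \<ge> 1" "k div m = q + 1" by (auto simp: q_def)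
      define r where "r = k - q * m"
      have kd: "k = (q + 1) * m + k mod m" using q div_mult_mod_eq[of k m] by simp
      then have r: "r = m + k mod m" unfolding r_def by simp
      have kq: "k = q * m + r" using kd r by simp
      have qm: "q * m \<ge> 2" using q m by (metis le_trans mult_le_mono1 nat_mult_1)
      have r2: "2 \<le> r" using r m by linarith
      have "real q * a m + 0 \<le> a (q * m) + a r"
        by (intro add_mono mult[OF q(1) m(1)] nonneg[OF r2])
      also have "\<dots> \<le> a (q * m + r)" by (rule add[OF qm r2])
      also have "q * m + r = k" by (rule kq[symmetric])
      finally have 1: "real q * a m \<le> a k" by simp
      have "k \<le> (q + 2) * m" 
      proof -
        have "(q + 2) * m = (q + 1) * m + m" "k mod m < m" using m by simp_all
        with kd show ?thesis by linarith
      qed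
      then have "real k \<le> real ((q + 2) * m)" by (simp only: of_nat_le_iff)
      then have "real k \<le> (real q + 2) * m" by (simp add: algebra_simps)
      then have "real k / m - 2 \<le> q" using m by (simp add: field_simps)
      then have "(real k / m - 2) * a m \<le> a k"
        using mult_right_mono[of "real k / m - 2" q "a m"] nonneg[OF m(1)] 1 by linarith
      then have "(real k / m - 2) * a m / k \<le> a k / k" by (intro divide_right_mono) auto
      moreover have "(real k / m - 2) * a m / k = a m / m - 2 * a m / k"
        using k m by (simp add: field_simps)
      moreover have "2 * a m / k < e / 2"
      proof -
        have "4 * a m / e < k" using N k by linarith
        then show ?thesis using \<open>e > 0\<close> k by (simp add: field_simps)
      qed
      ultimately have "L - e < a k / k" using m by linarith
      then show ?thesis using up[OF k(2)] \<open>e > 0\<close> by auto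
    qed
    then show "\<exists>no. \<forall>k\<ge>no. norm (a k / k - L) < e" by blast
  qed
  moreover have "\<forall>k\<ge>2. a k \<le> L * real k"
    using up by (simp add: field_simps)
  moreover have "L \<ge> 0" using up[of 2] nonneg[of 2] by auto
  ultimately show thesis using that by blast
qed

abbreviation \<mu> :: real where
  "\<mu> \<equiv> connective_constant TYPE(2)"

lemma connective_constant_bounds: "\<mu> \<ge> 1" "pcount n \<le> \<mu> ^ n"
proof -
  define a where "a k = ln (real (pcount (2 * k)))" for k
  have pos: "real (pcount (2 * k)) \<ge> 1" if "k \<ge> 2" for k
    using pcount_pos[of "2 * k"] that by simp
  have sup: "a j + a k \<le> a (j + k)" if "j \<ge> 2" "k \<ge> 2" for j k
  proof -
    have "a j + a k = ln (real (pcount (2 * j) * pcount (2 * k)))"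
      unfolding a_def using pos[OF that(1)] pos[OF that(2)] by (simp add: ln_mult)
    also have "\<dots> \<le> a (j + k)"
      unfolding a_def
    proof (subst ln_le_cancel_iff)
      have "0 < pcount (2 * j) * pcount (2 * k)" using pos[OF that(1)] pos[OF that(2)] by simp
      then show "0 < real (pcount (2 * j) * pcount (2 * k))" by (simp only: of_nat_0_less_iff)
      show "0 < real (pcount (2 * (j + k)))" using pos[of "j + k"] that by simp
      show "real (pcount (2 * j) * pcount (2 * k)) \<le> real (pcount (2 * (j + k)))"
        using pcount_mult[of "2 * j" "2 * k"] by (simp only: of_nat_le_iff distrib_left)
    qed
    finally show ?thesis .
  qed
  have nonneg: "0 \<le> a k" if "k \<ge> 2" for k using pos[OF that] by (simp add: a_def)
  have bd: "a k \<le> (2 * ln 4) * real k" if "k \<ge> 2" for k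
  proof -
    have "real (pcount (2 * k)) \<le> 4 ^ (2 * k)"
      using normal_polygons_bound[of "2 * k"] by (metis of_nat_le_iff of_nat_numeral of_nat_power)
    then have "a k \<le> ln (4 ^ (2 * k))"
      unfolding a_def using pos[OF that] by (subst ln_le_cancel_iff) auto
    then show ?thesis by (simp add: ln_realpow algebra_simps)
  qed
  obtain L where L: "(\<lambda>k. a k / k) \<longlonglongrightarrow> L" "\<forall>k\<ge>2. a k \<le> L * real k" "L \<ge> 0"
    using superadditive_limit[OF sup nonneg bd] .
  have "(\<lambda>k. exp (a k / k / 2)) \<longlonglongrightarrow> exp (L / 2)"
    by (intro tendsto_intros L) simp
  moreover have "\<forall>\<^sub>F k in sequentially. exp (a k / k / 2) = root (2 * k) (real (num_polygons TYPE(2) (2 * k)))"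
  proof (rule eventually_sequentiallyI)
    fix k :: nat assume k: "2 \<le> k"
    have "root (2 * k) (real (pcount (2 * k))) = real (pcount (2 * k)) powr (1 / (2 * k))"
      using k pos[OF k] by (subst root_powr_inverse) auto
    also have "\<dots> = exp (a k / k / 2)" using pos[OF k] by (simp add: powr_def a_def)
    finally show "exp (a k / k / 2) = root (2 * k) (real (num_polygons TYPE(2) (2 * k)))"
      by (simp add: num_polygons_eq)
  qed
  ultimately have "(\<lambda>k. root (2 * k) (real (num_polygons TYPE(2) (2 * k)))) \<longlonglongrightarrow> exp (L / 2)"
    using tendsto_cong by fast
  then have mu: "\<mu> = exp (L / 2)"
    unfolding connective_constant_def by (rule limI)
  then show "\<mu> \<ge> 1" using L(3) by simp
  have even: "pcount (2 * k) \<le> \<mu> ^ (2 * k)" for k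
  proof (cases "k \<ge> 2")
    case True
    have "real (pcount (2 * k)) = exp (a k)" using pos[OF True] by (simp add: a_def)
    also have "\<dots> \<le> exp (L * k)" using L(2) True by simp
    also have "\<dots> = \<mu> ^ (2 * k)" unfolding mu by (simp flip: exp_of_nat_mult)
    finally show ?thesis .
  next
    case False
    then have "pcount (2 * k) = 0" by (intro pcount_eq_0) auto
    then show ?thesis by (simp add: mu)
  qed
  \<comment> \<open>Squaring reduces an arbitrary length to an even one.\<close>
  have "real (pcount n * pcount n) \<le> real (pcount (2 * n))"
    using pcount_mult[of n n] unfolding of_nat_le_iff mult_2 .
  then have "(real (pcount n))\<^sup>2 \<le> real (pcount (2 * n))" by (simp add: power2_eq_square)
  also have "\<dots> \<le> (\<mu> ^ n)\<^sup>2" using even[of n] by (simp add: power_mult mult.commute)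
  finally show "pcount n \<le> \<mu> ^ n" by (rule power2_le_imp_le) (simp add: mu)
qed

section \<open>Bridges\<close>

text \<open>Copies of bridges with common displacement, every second one mirrored, are stacked in two
  parallel columns. The two columns are joined to a polygon at a cost that does not depend on the
  number of copies, whence the exact bound \<open>\<mu> ^ (m + 1)\<close>.\<close>

definition bridges :: "nat \<Rightarrow> point list set" where
  "bridges m = {\<omega>. saw \<omega> \<and> length \<omega> = Suc m \<and> hd \<omega> = 0 \<and>
     (\<forall>p\<in>set \<omega>. 0 \<le> snd p \<and> snd p \<le> snd (last \<omega>))}"

definition bridges_to :: "nat \<Rightarrow> point \<Rightarrow> point list set" where
  "bridges_to m q = {\<omega> \<in> bridges m. last \<omega> = q}"

lemma walk_coordinates_le:
  assumes "successively adj xs" "p \<in> set xs"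
  shows "\<bar>fst p - fst (hd xs)\<bar> + \<bar>snd p - snd (hd xs)\<bar> \<le> int (length xs) - 1"
  using assms
proof (induction xs)
  case (Cons x xs)
  show ?case
  proof (cases "p \<in> set xs")
    case True
    then have "xs \<noteq> []" by auto
    then have "adj x (hd xs)" "successively adj xs" using Cons.prems by (auto simp: successively_Cons)
    with Cons.IH[OF _ True] show ?thesis by (simp add: adj_def)
  next
    case False
    then have "p = x" using Cons.prems by auto
    then show ?thesis by simp
  qed
qed simp

lemma bridges_subset: "bridges m \<subseteq> {xs. length xs = Suc m \<and> hd xs = 0 \<and> successively adj xs}"
  by (auto simp: bridges_def saw_def)

lemma finite_bridges: "finite (bridges m)"
  by (rule finite_subset[OF bridges_subset]) (use card_lattice_walks in blast)

lemma saw_map: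
  assumes "inj f" "\<And>p q. adj p q \<Longrightarrow> adj (f p) (f q)" "saw xs"
  shows "saw (map f xs)"
proof -
  have "successively (\<lambda>p q. adj (f p) (f q)) xs"
    using assms by (auto simp: saw_def intro: successively_mono)
  then show ?thesis using assms by (auto simp: saw_def successively_map distinct_map intro: inj_on_subset)
qed

lemma saw_translate: "saw (map ((+) v) xs) \<longleftrightarrow> saw xs"
proof
  assume "saw (map ((+) v) xs)"
  then have "saw (map ((+) (- v)) (map ((+) v) xs))"
    by (intro saw_map[of "(+) (- v)"]) (auto simp: adj_def)
  moreover have "(+) (- v) \<circ> (+) v = id" by (auto simp: fun_eq_iff)
  ultimately show "saw xs" by simp
qed (auto intro: saw_map simp: adj_plus)

text \<open>A bridge is followed by a vertical step and by the mirror image of a second bridge. The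
  mirroring cancels the horizontal displacement, so that stacks of the result do not drift sideways;
  the vertical step accounts for both occurrences of \<open>+ 1\<close>.\<close>

lemma card_bridges_to_le:
  "(card (bridges_to m (w, h)))\<^sup>2 \<le> card (bridges_to (2 * m + 1) (0, 2 * h + 1))"
proof -
  define r where "r p = (w - fst p, h + 1 + snd p)" for p :: point
  have r: "inj r" "\<And>p q. adj p q \<Longrightarrow> adj (r p) (r q)"
    by (auto simp: r_def inj_def adj_def prod_eq_iff)
  let ?W = "bridges_to m (w, h)"
  define f where "f = (\<lambda>(\<omega>, \<omega>'). \<omega> @ map r \<omega>')"
  have fin: "finite (bridges_to (2 * m + 1) (0, 2 * h + 1))"
    using finite_bridges by (simp add: bridges_to_def)
  have "inj_on f (?W \<times> ?W)"
  proof
    fix s t assume st: "s \<in> ?W \<times> ?W" "t \<in> ?W \<times> ?W" "f s = f t"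
    then have "length (fst s) = length (fst t)" by (auto simp: bridges_to_def bridges_def)
    then have "fst s = fst t \<and> map r (snd s) = map r (snd t)"
      using st by (auto simp: f_def case_prod_beta)
    then show "s = t" using r(1) by (simp add: prod_eq_iff)
  qed
  moreover have "f ` (?W \<times> ?W) \<subseteq> bridges_to (2 * m + 1) (0, 2 * h + 1)"
  proof
    fix x assume "x \<in> f ` (?W \<times> ?W)"
    then obtain \<omega> \<omega>' where x: "x = \<omega> @ map r \<omega>'" and \<omega>: "\<omega> \<in> ?W" "\<omega>' \<in> ?W" by (auto simp: f_def)
    have 1: "saw \<omega>" "length \<omega> = Suc m" "hd \<omega> = 0" "last \<omega> = (w, h)"
      "\<forall>p\<in>set \<omega>. 0 \<le> snd p \<and> snd p \<le> h"
      and 2: "saw \<omega>'" "length \<omega>' = Suc m" "hd \<omega>' = 0" "last \<omega>' = (w, h)"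
      "\<forall>p\<in>set \<omega>'. 0 \<le> snd p \<and> snd p \<le> h"
      using \<omega> by (auto simp: bridges_to_def bridges_def)
    have ne: "\<omega> \<noteq> []" "\<omega>' \<noteq> []" using 1 2 by auto
    have h: "0 \<le> h" using 1(5) last_in_set[OF ne(1)] 1(4) by force
    have rr: "h + 1 \<le> snd p \<and> snd p \<le> 2 * h + 1" if "p \<in> set (map r \<omega>')" for p
      using that 2(5) by (auto simp: r_def)
    have "set \<omega> \<inter> set (map r \<omega>') = {}"
      using 1(5) rr by fastforce
    moreover have "adj (last \<omega>) (hd (map r \<omega>'))"
      using 1 2 ne by (simp add: hd_map r_def adj_def)
    ultimately have "saw x" unfolding x using 1(1) saw_map[OF r 2(1)] by (simp add: saw_append)
    moreover have "last x = (0, 2 * h + 1)" using 2 ne by (simp add: x last_map r_def)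
    moreover have "0 \<le> snd p \<and> snd p \<le> 2 * h + 1" if "p \<in> set x" for p
    proof (cases "p \<in> set \<omega>")
      case True
      then show ?thesis using 1(5) h by force
    next
      case False
      then have "p \<in> set (map r \<omega>')" using that x by simp
      then show ?thesis using rr[of p] h by auto
    qed
    ultimately show "x \<in> bridges_to (2 * m + 1) (0, 2 * h + 1)"
      using 1 2 ne by (simp add: bridges_to_def bridges_def x)
  qed
  ultimately have "card (?W \<times> ?W) \<le> card (bridges_to (2 * m + 1) (0, 2 * h + 1))"
    using fin by (rule card_inj_on_le)
  then show ?thesis by (simp add: card_cartesian_product power2_eq_square)
qed

text \<open>For bridges that end at \<open>(0, h)\<close>, consecutive copies occupy disjoint sets
  of rows and are linked by one vertical step, whence the shift by \<open>h + 1\<close>.\<close>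

fun stack :: "int \<Rightarrow> point list list \<Rightarrow> point list" where
  "stack h [] = []"
| "stack h (\<omega> # \<omega>s) = \<omega> @ map ((+) (0, h + 1)) (stack h \<omega>s)"

lemma stack_inj:
  assumes "\<forall>\<omega>\<in>set xs \<union> set ys. length \<omega> = l" "length xs = length ys" "stack h xs = stack h ys"
  shows "xs = ys"
  using assms(2,1,3)
proof (induction xs ys rule: list_induct2)
  case (Cons x xs y ys)
  then have "x = y \<and> map ((+) (0, h + 1)) (stack h xs) = map ((+) (0, h + 1)) (stack h ys)"
    by (auto simp: append_eq_append_conv)
  moreover then have "stack h xs = stack h ys"
    using inj_map_eq_map[of "(+) (0, h + 1)"] by auto
  ultimately show ?case using Cons by auto
qed simp

lemma stack_props:
  assumes "set \<omega>s \<subseteq> bridges_to m (0, h)" "\<omega>s \<noteq> []"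
  shows "saw (stack h \<omega>s) \<and> length (stack h \<omega>s) = length \<omega>s * Suc m \<and> stack h \<omega>s \<noteq> [] \<and>
    hd (stack h \<omega>s) = 0 \<and> last (stack h \<omega>s) = (0, int (length \<omega>s) * (h + 1) - 1) \<and>
    (\<forall>p\<in>set (stack h \<omega>s). 0 \<le> snd p \<and> snd p < int (length \<omega>s) * (h + 1) \<and> \<bar>fst p\<bar> \<le> int m)"
  using assms(2,1)
proof (induction \<omega>s rule: list_nonempty_induct)
  case (single \<omega>)
  then have "\<omega> \<in> bridges_to m (0, h)" by simp
  then have \<omega>: "saw \<omega>" "length \<omega> = Suc m" "hd \<omega> = 0" "last \<omega> = (0, h)"
      "\<forall>p\<in>set \<omega>. 0 \<le> snd p \<and> snd p \<le> h"
    by (auto simp: bridges_to_def bridges_def)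
  then have "\<bar>fst p\<bar> \<le> int m" if "p \<in> set \<omega>" for p
    using walk_coordinates_le[of \<omega> p] that by (auto simp: saw_def)
  with \<omega> show ?case by auto
next
  case (cons \<omega> \<omega>s)
  then have "\<omega> \<in> bridges_to m (0, h)" by simp
  then have \<omega>: "saw \<omega>" "length \<omega> = Suc m" "hd \<omega> = 0" "last \<omega> = (0, h)"
      "\<forall>p\<in>set \<omega>. 0 \<le> snd p \<and> snd p \<le> h"
    by (auto simp: bridges_to_def bridges_def)
  then have x: "\<bar>fst p\<bar> \<le> int m" if "p \<in> set \<omega>" for p
    using walk_coordinates_le[of \<omega> p] that by (auto simp: saw_def)
  have ne: "\<omega> \<noteq> []" using \<omega> by auto
  let ?S = "map ((+) (0, h + 1)) (stack h \<omega>s)"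
  define K where "K = int (length \<omega>s) * (h + 1)"
  have S: "saw (stack h \<omega>s)" "length (stack h \<omega>s) = length \<omega>s * Suc m" "stack h \<omega>s \<noteq> []"
    "hd (stack h \<omega>s) = 0" "last (stack h \<omega>s) = (0, K - 1)"
    "\<forall>p\<in>set (stack h \<omega>s). 0 \<le> snd p \<and> snd p < K \<and> \<bar>fst p\<bar> \<le> int m"
    using cons unfolding K_def by auto
  have h: "0 \<le> h" using \<omega>(5) last_in_set[OF ne] \<omega>(4) by force
  then have K: "K \<ge> 0" by (simp add: K_def)
  have SS: "h + 1 \<le> snd p \<and> snd p < K + (h + 1) \<and> \<bar>fst p\<bar> \<le> int m" if "p \<in> set ?S" for p
    using that S(6) by auto
  have "set \<omega> \<inter> set ?S = {}" using \<omega>(5) SS by fastforce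
  moreover have "adj (last \<omega>) (hd ?S)" using \<omega> S by (simp add: hd_map adj_def)
  ultimately have "saw (\<omega> @ ?S)" using \<omega>(1) S(1) by (simp add: saw_append saw_translate)
  moreover have "last (\<omega> @ ?S) = (0, K + (h + 1) - 1)" using S by (simp add: last_map)
  moreover have "0 \<le> snd p \<and> snd p < K + (h + 1) \<and> \<bar>fst p\<bar> \<le> int m" if "p \<in> set (\<omega> @ ?S)" for p
  proof (cases "p \<in> set \<omega>")
    case True
    then show ?thesis using \<omega>(5) x[OF True] h K by force
  next
    case False
    then have "p \<in> set ?S" using that by simp
    from SS[OF this] h show ?thesis by auto
  qed
  moreover have "int (length (\<omega> # \<omega>s)) * (h + 1) = K + (h + 1)" by (simp add: K_def algebra_simps)
  ultimately show ?case using \<omega> ne S by simp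
qed

text \<open>Induction from the head, at which the path has just one edge.\<close>

lemma path_edges_inj:
  assumes "distinct xs" "distinct ys" "path_edges xs = path_edges ys" "hd xs = hd ys"
    "xs \<noteq> []" "ys \<noteq> []"
  shows "xs = ys"
  using assms
proof (induction xs arbitrary: ys)
  case (Cons x xs)
  then obtain zs where ys: "ys = x # zs" by (cases ys) auto
  show ?case
  proof (cases "xs = [] \<or> zs = []")
    case True
    then show ?thesis using Cons.prems(3) ys by (cases xs; cases zs) auto
  next
    case False
    have nx: "e \<in> path_edges xs \<Longrightarrow> x \<notin> e" for e using path_edges_subset Cons.prems(1) by fastforce
    have nz: "e \<in> path_edges zs \<Longrightarrow> x \<notin> e" for e
      using path_edges_subset[of e zs] Cons.prems(2) ys by auto
    have eq: "insert {x, hd xs} (path_edges xs) = insert {x, hd zs} (path_edges zs)"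
      using Cons.prems(3) False ys by (simp add: path_edges_Cons)
    have "{x, hd xs} \<in> insert {x, hd zs} (path_edges zs)" unfolding eq[symmetric] by (rule insertI1)
    then have "{x, hd xs} = {x, hd zs}" using nz[of "{x, hd xs}"] by auto
    then have h: "hd xs = hd zs" by (auto simp: doubleton_eq_iff)
    have "{x, hd zs} \<notin> path_edges xs" "{x, hd zs} \<notin> path_edges zs"
      using nx[of "{x, hd zs}"] nz[of "{x, hd zs}"] by auto
    then have "path_edges xs = path_edges zs"
      using eq[unfolded h] by (rule insert_ident[THEN iffD1])
    then have "xs = zs" using Cons.IH[of zs] Cons.prems False ys h by auto
    then show ?thesis using ys by simp
  qed
qed simp

text \<open>The edge set fixes a cyclic list up to rotation and reversal; prescribing both ends of
  the closing edge removes that freedom.\<close>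

lemma cycle_edges_inj:
  assumes "cycle xs" "cycle ys" "cycle_edges xs = cycle_edges ys" "hd xs = hd ys" "last xs = last ys"
  shows "xs = ys"
proof (rule path_edges_inj)
  have "{last xs, hd xs} \<notin> path_edges xs" "{last ys, hd ys} \<notin> path_edges ys"
    using assms(1,2) closing_edge_notin[of xs] closing_edge_notin[of ys]
    by (simp_all add: cycle_def saw_def)
  then show "path_edges xs = path_edges ys"
    using assms(3-) by (simp add: cycle_edges_def insert_ident)
qed (use assms in \<open>auto simp: cycle_def saw_def\<close>)

lemma saw_horizontal: "saw (map (\<lambda>i. (int i, y)) [0..<n])"
  by (auto simp: saw_def distinct_map inj_on_def successively_conv_nth adj_def)

text \<open>One stack upwards, a row across the top, the other stack downwards and a row back along
  the bottom. A stack stays within \<open>m\<close> of its axis, so the distance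
  \<open>2 * m + 1\<close> keeps the two apart, and the two rows cost \<open>2 * Suc X\<close>
  vertices however large \<open>k\<close> is. The bottom row starts at the origin, which makes the
  polygon normalized; the known ends make the list recoverable from its edges.\<close>

lemma columns_polygon:
  assumes "set as \<subseteq> bridges_to m (0, h)" "length as = k" "set bs \<subseteq> bridges_to m (0, h)" "length bs = k"
    and "k \<ge> 1"
  defines "X \<equiv> 2 * m + 1"
  defines "C \<equiv> map ((+) (0, 1)) (stack h as)" and "C' \<equiv> map ((+) (int X, 1)) (stack h bs)"
    and "T \<equiv> map (\<lambda>i. (int i, int k * (h + 1) + 1)) [0..<Suc X]"
    and "B \<equiv> map (\<lambda>i. (int i, 0 :: int)) [0..<Suc X]"
  shows "cycle (C @ T @ rev C' @ rev B)" (is "cycle ?xs")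
    and "hd (C @ T @ rev C' @ rev B) = (0, 1)" "last (C @ T @ rev C' @ rev B) = (0, 0)"
    and "length (C @ T @ rev C' @ rev B) = 2 * (k * Suc m) + 2 * Suc X"
    and "normalized (cycle_edges (C @ T @ rev C' @ rev B))"
proof -
  define K where "K = int k * (h + 1)"
  have ne: "as \<noteq> []" "bs \<noteq> []" using assms(2,4,5) by auto
  note a = stack_props[OF assms(1) ne(1), unfolded assms(2), folded K_def]
  note b = stack_props[OF assms(3) ne(2), unfolded assms(4), folded K_def]
  have "stack h as \<noteq> []" "hd (stack h as) = 0" using a by simp_all
  then have "0 \<in> set (stack h as)" using hd_in_set[of "stack h as"] by simp
  moreover have "\<forall>p\<in>set (stack h as). snd p < K" using a by simp
  ultimately have "snd (0 :: point) < K" by (rule bspec[rotated])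
  then have K: "K \<ge> 1" by simp
  have C: "saw C" "C \<noteq> []" "hd C = (0, 1)" "last C = (0, K)" "length C = k * Suc m"
    "\<forall>p\<in>set C. 1 \<le> snd p \<and> snd p \<le> K \<and> \<bar>fst p\<bar> \<le> int m"
    using a by (auto simp: C_def saw_translate hd_map last_map zero_prod_def)
  have C': "saw (rev C')" "C' \<noteq> []" "hd C' = (int X, 1)" "last C' = (int X, K)" "length C' = k * Suc m"
    "\<forall>p\<in>set C'. 1 \<le> snd p \<and> snd p \<le> K \<and> int m < fst p"
    using b by (auto simp: C'_def saw_translate saw_rev hd_map last_map zero_prod_def X_def)
  have T: "saw T" "T \<noteq> []" "hd T = (0, K + 1)" "last T = (int X, K + 1)" "length T = Suc X"
    "\<forall>p\<in>set T. snd p = K + 1"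
    using saw_horizontal[of "K + 1" "Suc X"] unfolding T_def K_def[symmetric]
    by (auto simp: hd_map last_map simp del: upt_Suc)
  have B: "saw (rev B)" "B \<noteq> []" "hd B = (0, 0)" "last B = (int X, 0)" "length B = Suc X"
    "\<forall>p\<in>set B. snd p = 0 \<and> 0 \<le> fst p"
    using saw_horizontal[of 0 "Suc X"] unfolding B_def
    by (auto simp: saw_rev hd_map last_map simp del: upt_Suc)
  have d: "set C \<inter> set C' = {}" "set C \<inter> set T = {}" "set C' \<inter> set T = {}"
    "set C \<inter> set B = {}" "set C' \<inter> set B = {}" "set T \<inter> set B = {}"
    using C(6) C'(6) T(6) B(6) K by fastforce+
  have "saw ?xs"
    using C C' T B d by (auto simp: saw_append hd_rev last_rev adj_def)
  moreover show hd: "hd ?xs = (0, 1)" and last: "last ?xs = (0, 0)"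
    using C B by (auto simp: last_rev)
  moreover show len: "length ?xs = 2 * (k * Suc m) + 2 * Suc X"
    using C C' T B by simp
  ultimately show cyc: "cycle ?xs" by (simp add: cycle_def adj_def X_def)
  have set: "\<Union>(cycle_edges ?xs) = set C \<union> set T \<union> set C' \<union> set B"
    unfolding Union_cycle_edges[OF cyc] set_append set_rev by (simp only: Un_assoc)
  have "0 \<in> set B" using hd_in_set[OF B(2)] B(3) by (simp add: zero_prod_def)
  moreover have "0 < snd p \<or> snd p = 0 \<and> 0 \<le> fst p" if "p \<in> set C \<union> set T \<union> set C' \<union> set B" for p
  proof -
    have "p \<in> set C \<or> p \<in> set T \<or> p \<in> set C' \<or> p \<in> set B" using that by blast
    then show ?thesis
      using C(6)[rule_format, of p] C'(6)[rule_format, of p] T(6)[rule_format, of p]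
        B(6)[rule_format, of p] K by linarith
  qed
  ultimately show "normalized (cycle_edges ?xs)" unfolding normalized_def set by blast
qed

section \<open>Upper bounds on the number of bridges\<close>

lemma power_le_imp_base_le:
  fixes x y c :: real
  assumes "\<And>k. k \<ge> 1 \<Longrightarrow> x ^ k \<le> c * y ^ k" "y > 0"
  shows "x \<le> y"
proof (rule ccontr)
  assume "\<not> x \<le> y"
  then have "1 < x / y" using assms by simp
  then obtain n where n: "c < (x / y) ^ n" using real_arch_pow by blast
  also have "\<dots> \<le> (x / y) ^ Suc n"
    using \<open>1 < x / y\<close> by (intro power_increasing) auto
  also have "\<dots> \<le> c"
    using assms(1)[of "Suc n"] assms(2) by (simp add: power_divide field_simps)
  finally show False by simp
qed

text \<open>Pairs of stacks of \<open>k\<close> bridges inject into the polygons of length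
  \<open>2 * (k * Suc m)\<close> plus a constant. Taking roots as \<open>k\<close> grows removes the
  constant, so that not even a polynomial factor remains.\<close>

lemma card_columns_le:
  "real (card (bridges_to m (0, h))) \<le> \<mu> ^ Suc m"
proof -
  let ?V = "bridges_to m (0, h)" and ?X = "2 * m + 1"
  have fin: "finite ?V" using finite_bridges by (simp add: bridges_to_def)
  have mu: "\<mu> \<ge> 1" by (rule connective_constant_bounds)
  have key: "((real (card ?V))\<^sup>2) ^ k \<le> \<mu> ^ (2 * Suc ?X) * ((\<mu> ^ Suc m)\<^sup>2) ^ k" if k: "k \<ge> 1" for k
  proof -
    let ?L = "{xs. set xs \<subseteq> ?V \<and> length xs = k}"
    define n where "n = 2 * (k * Suc m) + 2 * Suc ?X"
    define g where "g = (\<lambda>(as, bs). map ((+) (0, 1)) (stack h as)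
      @ map (\<lambda>i. (int i, int k * (h + 1) + 1)) [0..<Suc ?X]
      @ rev (map ((+) (int ?X, 1)) (stack h bs)) @ rev (map (\<lambda>i. (int i, 0 :: int)) [0..<Suc ?X]))"
    note col = columns_polygon[where m = m and h = h and k = k, OF _ _ _ _ k]
    have "inj_on (\<lambda>t. cycle_edges (g t)) (?L \<times> ?L)"
    proof
      fix s t assume st: "s \<in> ?L \<times> ?L" "t \<in> ?L \<times> ?L" "cycle_edges (g s) = cycle_edges (g t)"
      obtain as bs as' bs' where s: "s = (as, bs)" and t: "t = (as', bs')" by fastforce
      have V: "set as \<subseteq> ?V" "length as = k" "set bs \<subseteq> ?V" "length bs = k"
        "set as' \<subseteq> ?V" "length as' = k" "set bs' \<subseteq> ?V" "length bs' = k" using st s t by auto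
      have "g s = g t"
        using st(3) col(1-3)[OF V(1-4)] col(1-3)[OF V(5-8)]
        unfolding s t g_def prod.case by (intro cycle_edges_inj) simp_all
      moreover have "length (stack h as) = length (stack h as')" "length (stack h bs) = length (stack h bs')"
        using stack_props[of as m h] stack_props[of as' m h] stack_props[of bs m h] stack_props[of bs' m h]
          V k by fastforce+
      ultimately have "map ((+) (0, 1)) (stack h as) = map ((+) (0, 1)) (stack h as')"
        "map ((+) (int ?X, 1)) (stack h bs) = map ((+) (int ?X, 1)) (stack h bs')"
        unfolding s t g_def prod.case by (auto simp: append_eq_append_conv simp del: upt_Suc)
      then have "stack h as = stack h as'" "stack h bs = stack h bs'"
        using inj_map_eq_map[of "(+) (0, 1)"] inj_map_eq_map[of "(+) (int ?X, 1)"] by auto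
      moreover have "\<forall>\<omega>\<in>set as \<union> set as'. length \<omega> = Suc m" "\<forall>\<omega>\<in>set bs \<union> set bs'. length \<omega> = Suc m"
        using V by (auto simp: bridges_to_def bridges_def)
      ultimately show "s = t"
        using stack_inj[of as as' "Suc m" h] stack_inj[of bs bs' "Suc m" h] V s t by auto
    qed
    moreover have "(\<lambda>t. cycle_edges (g t)) ` (?L \<times> ?L) \<subseteq> normal_polygons n"
    proof
      fix P assume "P \<in> (\<lambda>t. cycle_edges (g t)) ` (?L \<times> ?L)"
      then obtain as bs where V: "set as \<subseteq> ?V" "length as = k" "set bs \<subseteq> ?V" "length bs = k"
        and P: "P = cycle_edges (g (as, bs))" by auto
      have "cycle (g (as, bs))" "length (g (as, bs)) = n" "normalized P"
        using col[OF V] unfolding P n_def g_def prod.case by simp_all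
      then show "P \<in> normal_polygons n"
        unfolding normal_polygons_def P by (auto simp: card_cycle_edges polygon_def)
    qed
    ultimately have "card (?L \<times> ?L) \<le> pcount n"
      unfolding pcount_def using finite_normal_polygons by (rule card_inj_on_le)
    then have "real (card (?L \<times> ?L)) \<le> \<mu> ^ n"
      using connective_constant_bounds(2)[of n] by linarith
    moreover have "card (?L \<times> ?L) = (card ?V ^ k) * (card ?V ^ k)"
      unfolding card_cartesian_product card_lists_length_eq[OF fin] ..
    moreover have "\<mu> ^ n = \<mu> ^ (2 * Suc ?X) * ((\<mu> ^ Suc m)\<^sup>2) ^ k"
    proof -
      have "((\<mu> ^ Suc m)\<^sup>2) ^ k = \<mu> ^ (2 * (k * Suc m))"
        unfolding power_mult[symmetric] by (rule arg_cong[of _ _ "(^) \<mu>"]) simp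
      then show ?thesis unfolding n_def power_add by (simp only: mult.commute)
    qed
    ultimately show ?thesis by (simp add: power2_eq_square power_mult_distrib)
  qed
  have "(real (card ?V))\<^sup>2 \<le> (\<mu> ^ Suc m)\<^sup>2"
    by (rule power_le_imp_base_le[OF key]) (use mu in \<open>auto intro!: zero_less_power\<close>)
  then show ?thesis by (rule power2_le_imp_le) (use mu in simp)
qed

text \<open>An arbitrary displacement is reduced to a vertical one. The doubled bridge has
  \<open>2 * Suc m\<close> vertices, so the square root loses nothing.\<close>

lemma card_bridges_to_bound: "real (card (bridges_to m q)) \<le> \<mu> ^ Suc m"
proof -
  obtain w h where q: "q = (w, h)" by fastforce
  have "(real (card (bridges_to m q)))\<^sup>2 \<le> real (card (bridges_to (2 * m + 1) (0, 2 * h + 1)))"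
    unfolding q using card_bridges_to_le[of m w h] by (metis of_nat_le_iff of_nat_power)
  also have "\<dots> \<le> \<mu> ^ Suc (2 * m + 1)" by (rule card_columns_le)
  also have "\<dots> = (\<mu> ^ Suc m)\<^sup>2"
    unfolding power_mult[symmetric] by (rule arg_cong[of _ _ "(^) \<mu>"]) simp
  finally show ?thesis
    by (rule power2_le_imp_le) (use connective_constant_bounds(1) in simp)
qed

text \<open>The square counts the possible end points, whose coordinates are bounded by the number
  of steps.\<close>

lemma card_bridges_bound: "real (card (bridges m)) \<le> (2 * real m + 1)\<^sup>2 * \<mu> ^ Suc m"
proof -
  let ?I = "{- int m..int m} \<times> {- int m..int m}"
  have "bridges m = (\<Union>q\<in>?I. bridges_to m q)"
  proof (intro subset_antisym subsetI)
    fix \<omega> assume \<omega>: "\<omega> \<in> bridges m"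
    then have "saw \<omega>" "\<omega> \<noteq> []" "hd \<omega> = 0" "length \<omega> = Suc m" by (auto simp: bridges_def)
    then have "\<bar>fst (last \<omega>)\<bar> + \<bar>snd (last \<omega>)\<bar> \<le> int m"
      using walk_coordinates_le[of \<omega> "last \<omega>"] by (simp add: saw_def)
    then have "last \<omega> \<in> ?I" unfolding mem_Times_iff atLeastAtMost_iff by linarith
    then show "\<omega> \<in> (\<Union>q\<in>?I. bridges_to m q)" using \<omega> by (auto simp: bridges_to_def)
  qed (auto simp: bridges_to_def)
  then have "card (bridges m) \<le> (\<Sum>q\<in>?I. card (bridges_to m q))"
    by (simp add: card_UN_le)
  then have "real (card (bridges m)) \<le> (\<Sum>q\<in>?I. real (card (bridges_to m q)))"
    by (metis of_nat_le_iff of_nat_sum)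
  also have "\<dots> \<le> (\<Sum>q\<in>?I. \<mu> ^ Suc m)" by (intro sum_mono card_bridges_to_bound)
  also have "\<dots> = (2 * real m + 1)\<^sup>2 * \<mu> ^ Suc m"
    by (simp add: power2_eq_square algebra_simps)
  finally show ?thesis .
qed

section \<open>Global cuts and the swapping of strands\<close>

text \<open>The row condition is what horizontal sliding produces and what later orders the cuts.
  The conditions after it force the origin, a lowest vertex, into \<open>P\<close> and every highest
  vertex into \<open>Q\<close>, so that both arcs in between must pass the cut; \<open>1 < y\<close>
  keeps the ends of the cut away from the origin.\<close>

definition global_cut :: "point set set \<Rightarrow> int \<Rightarrow> int \<Rightarrow> point set set \<Rightarrow> point set set \<Rightarrow> bool" where
  "global_cut G x y P Q \<longleftrightarrow> polygon P \<and> polygon Q \<and> \<Union>P \<inter> \<Union>Q = {} \<and>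
     {(x, y), (x, y - 1)} \<in> P \<and> {(x + 1, y), (x + 1, y - 1)} \<in> Q \<and> G = plaquette_join P Q x y \<and>
     (\<forall>p\<in>\<Union>P. \<forall>q\<in>\<Union>Q. snd p = snd q \<longrightarrow> fst p < fst q) \<and>
     (\<forall>q\<in>\<Union>Q. 0 < snd q) \<and> (\<exists>q\<in>\<Union>Q. \<forall>p\<in>\<Union>P. snd p < snd q) \<and> 1 < y"

definition cuts :: "point set set \<Rightarrow> (int \<times> int \<times> point set set \<times> point set set) set" where
  "cuts G = {(x, y, P, Q). global_cut G x y P Q}"

text \<open>The two arcs of a normalized polygon between the origin and a highest vertex. As their
  ends lie in the extreme rows, the arcs are bridges, and so is every self-avoiding recombination
  with the same ends. In \<open>n + 2\<close> both ends are counted twice.\<close>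

definition strands :: "nat \<Rightarrow> (point list \<times> point list) set" where
  "strands n = {(U, D). saw U \<and> saw D \<and> length U \<ge> 2 \<and> length D \<ge> 2 \<and> hd U = 0 \<and> hd D = 0 \<and>
     last U = last D \<and> set U \<inter> set D = {0, last U} \<and> length U + length D = n + 2 \<and>
     (\<forall>p\<in>set U \<union> set D. 0 \<le> snd p \<and> snd p \<le> snd (last U))}"

lemma strands_sym: "(U, D) \<in> strands n \<Longrightarrow> (D, U) \<in> strands n"
  unfolding strands_def mem_Collect_eq prod.case by (metis Int_commute Un_commute add.commute)

lemma cycle_edges_append:
  assumes "xs \<noteq> []"
  shows "cycle_edges (xs @ r # bs) = path_edges (xs @ [r]) \<union> path_edges (hd xs # rev bs @ [r])"
proof -
  have "path_edges (hd xs # rev bs @ [r]) = path_edges (rev (r # bs @ [hd xs]))" by simp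
  also have "\<dots> = path_edges (r # bs @ [hd xs])" by (rule path_edges_rev)
  finally show ?thesis
    using assms by (auto simp: cycle_edges_def path_edges_append path_edges_Cons insert_commute)
qed

lemma ex_strands:
  assumes "G \<in> normal_polygons n"
  obtains U D where "(U, D) \<in> strands n" "G = path_edges U \<union> path_edges D"
proof -
  have G: "polygon G" "card G = n" "0 \<in> \<Union>G"
    and pos: "\<And>p. p \<in> \<Union>G \<Longrightarrow> 0 < snd p \<or> snd p = 0 \<and> 0 \<le> fst p"
    using assms unfolding normal_polygons_def normalized_def by blast+
  have fin: "finite (\<Union>G)" using G finite_vertices by blast
  define h where "h = Max (snd ` \<Union>G)"
  have "h \<in> snd ` \<Union>G" unfolding h_def using fin G(3) by (intro Max_in) auto
  then obtain r where r: "r \<in> \<Union>G" "snd r = h" by blast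
  have le: "snd p \<le> h" if "p \<in> \<Union>G" for p
    unfolding h_def using fin that by (intro Max_ge) auto
  \<comment> \<open>Otherwise the polygon lies in a single row, in which the origin is leftmost and
    has only one possible neighbour.\<close>
  have "r \<noteq> 0"
  proof
    assume "r = 0"
    then have h: "h = 0" using r by simp
    from two_neighbours[OF G(1) G(3)] obtain p q
      where pq: "p \<noteq> q" "{0, p} \<in> G" "{0, q} \<in> G" .
    then have "adj (0, 0) p" "adj (0, 0) q" using G(1) polygon_adj by (metis zero_prod_def)+
    moreover have "p \<in> \<Union>G" "q \<in> \<Union>G" using pq by blast+
    then have "snd p = 0 \<and> 0 \<le> fst p" "snd q = 0 \<and> 0 \<le> fst q"
      using pos[of p] pos[of q] le[of p] le[of q] h by linarith+
    ultimately have "p = (1, 0)" "q = (1, 0)" by (auto simp: adj_iff)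
    then show False using pq(1) by simp
  qed
  obtain ys where ys: "cycle (0 # ys)" "G = cycle_edges (0 # ys)"
    using polygon_start_at[OF G(1,3)] .
  have set: "\<Union>G = set (0 # ys)" using Union_cycle_edges ys by blast
  then have "r \<in> set ys" using r \<open>r \<noteq> 0\<close> by auto
  then obtain as bs where ab: "ys = as @ r # bs" by (meson split_list)
  define U D where "U = 0 # as @ [r]" and "D = 0 # rev bs @ [r]"
  have c: "saw (U @ bs)" "adj (last (U @ bs)) 0" "length (U @ bs) = n"
    using ys(1) card_cycle_edges[OF ys(1)] G(2) ys(2) by (auto simp: cycle_def ab U_def)
  have "saw (r # bs)" "saw U" and disj: "set U \<inter> set bs = {}"
    using c(1) by (auto simp: saw_append U_def saw_Cons saw_Nil hd_append split: if_splits)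
  moreover have "0 \<notin> set (r # bs)" using disj \<open>r \<noteq> 0\<close> by (auto simp: U_def)
  moreover have "adj (last (r # bs)) 0" using c(2) by (auto simp: U_def)
  ultimately have "saw ((r # bs) @ [0])" by (auto simp: saw_append saw_Cons saw_Nil hd_append)
  then have "saw (rev ((r # bs) @ [0]))" by (simp only: saw_rev)
  then have "saw D" by (simp add: D_def)
  moreover have "set U \<inter> set D = {0, last U}" using disj by (auto simp: U_def D_def)
  moreover have "0 \<le> snd p \<and> snd p \<le> snd (last U)" if "p \<in> set U \<union> set D" for p
  proof -
    have "p \<in> \<Union>G" using that unfolding set ab by (auto simp: U_def D_def)
    then show ?thesis using le[of p] pos[of p] r by (auto simp: U_def)
  qed
  moreover have "length U + length D = n + 2" using c(3) by (simp add: U_def D_def)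
  ultimately have "(U, D) \<in> strands n"
    using \<open>saw U\<close> by (simp add: strands_def) (simp add: U_def D_def)
  moreover have "G = path_edges U \<union> path_edges D"
    using cycle_edges_append[of "0 # as" r bs] ys(2) by (simp add: ab U_def D_def)
  ultimately show thesis by (rule that)
qed

section \<open>Cuts as seen on the strands, and their order\<close>

text \<open>The trace of a global cut on the strands. The polygons \<open>P\<close> and
  \<open>Q\<close> are replaced by the initial and the final pieces, which makes the cuts of one
  polygon comparable by their indices.\<close>

definition strand_cut :: "point list \<Rightarrow> point list \<Rightarrow> nat \<Rightarrow> nat \<Rightarrow> bool" where
  "strand_cut U D i j \<longleftrightarrow> Suc i < length U \<and> Suc j < length D \<and> 0 < i \<and> 0 < j \<and>
     fst (U ! i) = fst (D ! j) \<and> \<bar>snd (U ! i) - snd (D ! j)\<bar> = 1 \<and>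
     U ! Suc i = U ! i + (1, 0) \<and> D ! Suc j = D ! j + (1, 0) \<and>
     (\<forall>p\<in>set (take (Suc i) U) \<union> set (take (Suc j) D).
        \<forall>q\<in>set (drop (Suc i) U) \<union> set (drop (Suc j) D). snd p = snd q \<longrightarrow> fst p < fst q)"

lemma strand_cut_sym: "strand_cut U D i j \<longleftrightarrow> strand_cut D U j i"
  by (auto simp: strand_cut_def abs_minus_commute)

lemma strand_cut_separates:
  assumes "strand_cut U D i j" "snd p = snd q"
    and "p \<in> set (take (Suc i) U) \<or> p \<in> set (take (Suc j) D)"
    and "q \<in> set (drop (Suc i) U) \<or> q \<in> set (drop (Suc j) D)"
  shows "fst p < fst q"
  using assms unfolding strand_cut_def by blast

lemma nth_in_take: "k \<le> i \<Longrightarrow> k < length xs \<Longrightarrow> xs ! k \<in> set (take (Suc i) xs)"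
  by (auto simp: in_set_conv_nth intro!: exI[of _ k])

lemma nth_in_drop: "i < k \<Longrightarrow> k < length xs \<Longrightarrow> xs ! k \<in> set (drop (Suc i) xs)"
  by (auto simp: in_set_conv_nth intro!: exI[of _ "k - Suc i"])

text \<open>A discrete intermediate value theorem, as a step changes the row by at most one.\<close>

lemma walk_intermediate_row:
  assumes "saw xs" "a \<le> b" "b < length xs"
    and "min (snd (xs ! a)) (snd (xs ! b)) \<le> r" "r \<le> max (snd (xs ! a)) (snd (xs ! b))"
  obtains k where "a \<le> k" "k \<le> b" "snd (xs ! k) = r"
proof -
  have step: "\<bar>snd (xs ! Suc i) - snd (xs ! i)\<bar> \<le> 1" if "a \<le> i \<and> i < b" for i
  proof -
    have "adj (xs ! i) (xs ! Suc i)"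
      using assms that by (auto simp: saw_def successively_conv_nth)
    then show ?thesis by (simp add: adj_def)
  qed
  show thesis
  proof (cases "snd (xs ! a) \<le> snd (xs ! b)")
    case True
    then show thesis
      using nat_intermed_int_val[of a b "\<lambda>i. snd (xs ! i)" r] step assms that by auto
  next
    case False
    then show thesis
      using nat_intermed_int_val[of a b "\<lambda>i. - snd (xs ! i)" "- r"] step assms that
      by (auto simp: abs_minus_commute)
  qed
qed

text \<open>One interval lies entirely above the other. If, say, \<open>a = d + 1\<close> and
  \<open>b = c + 1\<close>, then \<open>a > c\<close> and \<open>b > d\<close> leave only
  \<open>c = d\<close>.\<close>

lemma disjoint_int_ranges:
  fixes a b c d :: int
  assumes "\<And>r. min a b \<le> r \<Longrightarrow> r \<le> max a b \<Longrightarrow> min c d \<le> r \<Longrightarrow> r \<le> max c d \<Longrightarrow> False"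
    and "\<bar>a - d\<bar> = 1" "\<bar>b - c\<bar> = 1"
  shows "a = b \<and> c = d"
proof -
  have 1: "\<not> (min c d \<le> r \<and> r \<le> max c d)" if "r = a \<or> r = b" for r
    using assms(1)[of r] that by auto
  have 2: "\<not> (min a b \<le> r \<and> r \<le> max a b)" if "r = c \<or> r = d" for r
    using assms(1)[of r] that by auto
  show ?thesis
    using 1[of a] 1[of b] 2[of c] 2[of d] assms(2,3)
    by (cases "a \<le> b"; cases "c \<le> d") (simp add: min_def max_def; linarith)+
qed

text \<open>The cuts are ordered in the same way along both strands. This replaces an appeal to planarity:
  the two strand segments between a crossing pair of cuts would have to be on the left of each other
  in every common row, and the end points leave them no way to avoid a common row.\<close>

lemma strand_cut_unique:
  assumes UD: "(U, D) \<in> strands n" and c: "strand_cut U D i j" "strand_cut U D i j'"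
  shows "j = j'"
proof -
  have no: False if c: "strand_cut U D i j" "strand_cut U D i j'" and "j < j'" for j j'
  proof -
    have "distinct D" "saw D" using UD by (auto simp: strands_def saw_def)
    then have "D ! j \<noteq> D ! j'" using c \<open>j < j'\<close> by (auto simp: strand_cut_def nth_eq_iff_index_eq)
    then have "snd (D ! j) \<noteq> snd (D ! j')" using c by (auto simp: strand_cut_def prod_eq_iff)
    moreover have "snd (D ! Suc j) = snd (D ! j)" using c by (auto simp: strand_cut_def)
    \<comment> \<open>\<open>D ! j\<close> and \<open>D ! j'\<close> lie in the column of
      \<open>U ! i\<close>, one of them a row above and the other a row below, so \<open>D\<close>
      meets the row of \<open>U ! i\<close> in between. The two cuts place that vertex strictly
      between \<open>U ! i\<close> and its right neighbour.\<close>
    ultimately have "min (snd (D ! Suc j)) (snd (D ! j')) \<le> snd (U ! i)"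
      "snd (U ! i) \<le> max (snd (D ! Suc j)) (snd (D ! j'))"
      using c unfolding strand_cut_def by linarith+
    moreover have "Suc j \<le> j'" "j' < length D" using c \<open>j < j'\<close> by (auto simp: strand_cut_def)
    ultimately obtain k where k: "Suc j \<le> k" "k \<le> j'" "snd (D ! k) = snd (U ! i)"
      using walk_intermediate_row[OF \<open>saw D\<close>] by blast
    have len: "Suc i < length U" "k < length D" using c(2) k by (auto simp: strand_cut_def)
    have "D ! k \<in> set (drop (Suc j) D)" "D ! k \<in> set (take (Suc j') D)"
      using k len by (auto intro!: nth_in_take nth_in_drop)
    moreover have "U ! i \<in> set (take (Suc i) U)" "U ! Suc i \<in> set (drop (Suc i) U)"
      using len by (auto intro!: nth_in_take nth_in_drop)
    moreover have "snd (U ! Suc i) = snd (U ! i)" using c by (auto simp: strand_cut_def)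
    ultimately have "fst (U ! i) < fst (D ! k)" "fst (D ! k) < fst (U ! Suc i)"
      using strand_cut_separates[OF c(1), of "U ! i" "D ! k"]
        strand_cut_separates[OF c(2), of "D ! k" "U ! Suc i"] k(3) by simp_all
    then show False using c by (auto simp: strand_cut_def)
  qed
  show ?thesis using no[OF c] no[OF c(2,1)] by (meson linorder_neqE_nat)
qed

lemma strand_cut_mono:
  assumes UD: "(U, D) \<in> strands n" and c: "strand_cut U D i j" "strand_cut U D i' j'" and "i < i'"
  shows "j < j'"
proof (rule ccontr)
  assume "\<not> j < j'"
  moreover have "j \<noteq> j'"
    using strand_cut_unique[OF strands_sym[OF UD], of j i i'] c \<open>i < i'\<close> strand_cut_sym by auto
  ultimately have jj: "j' < j" by simp
  have saw: "saw U" "saw D" using UD by (auto simp: strands_def)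
  have len: "Suc i < length U" "Suc j < length D" "Suc i' < length U" "Suc j' < length D"
    using c by (auto simp: strand_cut_def)
  have sep: "snd p = snd q \<Longrightarrow> fst p < fst q"
    if "p \<in> set (take (Suc i) U) \<union> set (take (Suc j) D)"
      "q \<in> set (drop (Suc i) U) \<union> set (drop (Suc j) D)" for p q
    using c(1) that unfolding strand_cut_def by blast
  have sep': "snd p = snd q \<Longrightarrow> fst p < fst q"
    if "p \<in> set (take (Suc i') U) \<union> set (take (Suc j') D)"
      "q \<in> set (drop (Suc i') U) \<union> set (drop (Suc j') D)" for p q
    using c(2) that unfolding strand_cut_def by blast
  have e: "fst (U ! i) = fst (D ! j)" "\<bar>snd (U ! i) - snd (D ! j)\<bar> = 1"
    "U ! Suc i = U ! i + (1, 0)" "D ! Suc j = D ! j + (1, 0)"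
    "fst (U ! i') = fst (D ! j')" "\<bar>snd (U ! i') - snd (D ! j')\<bar> = 1"
    "U ! Suc i' = U ! i' + (1, 0)" "D ! Suc j' = D ! j' + (1, 0)"
    using c by (auto simp: strand_cut_def)
  \<comment> \<open>Each of the two segments lies behind one cut and before the other, in opposite
    roles. In a common row each would have to be left of the other.\<close>
  have no: "snd (U ! k) \<noteq> snd (D ! l)" if "i < k" "k \<le> i'" "j' < l" "l \<le> j" for k l
  proof
    assume eq: "snd (U ! k) = snd (D ! l)"
    have "U ! k \<in> set (drop (Suc i) U)" "U ! k \<in> set (take (Suc i') U)"
      "D ! l \<in> set (drop (Suc j') D)" "D ! l \<in> set (take (Suc j) D)"
      using that len by (auto intro!: nth_in_take nth_in_drop)
    then have "fst (D ! l) < fst (U ! k)" "fst (U ! k) < fst (D ! l)"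
      using sep[of "D ! l" "U ! k"] sep'[of "U ! k" "D ! l"] eq by auto
    then show False by simp
  qed
  have row: "snd (U ! Suc i) = snd (U ! i)" "snd (D ! Suc j') = snd (D ! j')"
    using e by auto
  have U_row: "\<exists>k. i < k \<and> k \<le> i' \<and> snd (U ! k) = r"
    if "min (snd (U ! i)) (snd (U ! i')) \<le> r" "r \<le> max (snd (U ! i)) (snd (U ! i'))" for r
    using walk_intermediate_row[of U "Suc i" i' r] saw len \<open>i < i'\<close> that row by (metis Suc_le_eq Suc_lessD)
  have D_row: "\<exists>l. j' < l \<and> l \<le> j \<and> snd (D ! l) = r"
    if "min (snd (D ! j')) (snd (D ! j)) \<le> r" "r \<le> max (snd (D ! j')) (snd (D ! j))" for r
    using walk_intermediate_row[of D "Suc j'" j r] saw len jj that row by (metis Suc_le_eq Suc_lessD)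
  have disj: False
    if R: "min (snd (U ! i)) (snd (U ! i')) \<le> r" "r \<le> max (snd (U ! i)) (snd (U ! i'))"
      "min (snd (D ! j')) (snd (D ! j)) \<le> r" "r \<le> max (snd (D ! j')) (snd (D ! j))" for r
  proof -
    obtain k where k: "i < k" "k \<le> i'" "snd (U ! k) = r" using U_row[OF R(1,2)] by blast
    obtain l where l: "j' < l" "l \<le> j" "snd (D ! l) = r" using D_row[OF R(3,4)] by blast
    show False using no[OF k(1,2) l(1,2)] k(3) l(3) by simp
  qed
  have "snd (U ! i) = snd (U ! i') \<and> snd (D ! j') = snd (D ! j)"
    by (rule disjoint_int_ranges[OF _ e(2,6)]) (rule disj)
  then have yy: "snd (U ! i) = snd (U ! i')" "snd (D ! j) = snd (D ! j')" by simp_all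
  \<comment> \<open>The cut at \<open>(i, j)\<close> now orders the columns in contradictory ways,
    as \<open>U ! i\<close> shares its column with \<open>D ! j\<close> and \<open>U ! i'\<close>
    with \<open>D ! j'\<close>.\<close>
  have "U ! i \<in> set (take (Suc i) U)" "U ! i' \<in> set (drop (Suc i) U)"
    "D ! j' \<in> set (take (Suc j) D)" "D ! Suc j \<in> set (drop (Suc j) D)"
    using len jj \<open>i < i'\<close> by (auto intro!: nth_in_take nth_in_drop)
  then have "fst (U ! i) < fst (U ! i')" "fst (D ! j') < fst (D ! Suc j)"
    using sep[of "U ! i" "U ! i'"] sep[of "D ! j'" "D ! Suc j"] yy e by auto
  then show False using e by auto
qed

lemma first_crossing:
  assumes "xs \<noteq> []" "hd xs \<in> A" "last xs \<in> B" "A \<inter> B = {}" "set xs \<subseteq> A \<union> B"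
  obtains i where "Suc i < length xs" "\<forall>k\<le>i. xs ! k \<in> A" "xs ! Suc i \<in> B"
proof -
  define m where "m = (LEAST k. k < length xs \<and> xs ! k \<in> B)"
  have ex: "length xs - 1 < length xs \<and> xs ! (length xs - 1) \<in> B"
    using assms by (simp add: last_conv_nth)
  have m: "m < length xs \<and> xs ! m \<in> B" unfolding m_def using ex by (rule LeastI)
  have less: "xs ! k \<in> A" if "k < m" for k
  proof -
    have "\<not> (k < length xs \<and> xs ! k \<in> B)" using that unfolding m_def by (rule not_less_Least)
    moreover have "k < length xs" using that m by simp
    moreover from this have "xs ! k \<in> A \<union> B" using assms(5) nth_mem by blast
    ultimately show ?thesis by simp
  qed
  have "m \<noteq> 0" using m assms by (auto simp: hd_conv_nth)
  then obtain i where "m = Suc i" using not0_implies_Suc by blast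
  then show thesis using that[of i] m less by auto
qed

text \<open>A return from \<open>B\<close> to \<open>A\<close> would have to enter at
  \<open>a\<close> or \<open>b\<close>. One of these is the vertex at which the path has left
  \<open>A\<close>, and the other is not on the path.\<close>

lemma strand_crosses_once:
  assumes saw: "saw xs" "xs \<noteq> []" and P: "hd xs \<in> A" "last xs \<in> B" "A \<inter> B = {}" "set xs \<subseteq> A \<union> B"
    and cross: "\<And>k. Suc k < length xs \<Longrightarrow> (xs ! k \<in> A) \<noteq> (xs ! Suc k \<in> A) \<Longrightarrow>
      {xs ! k, xs ! Suc k} = {a, a + (1, 0)} \<or> {xs ! k, xs ! Suc k} = {b, b + (1, 0)}"
    and ab: "a \<in> A" "b \<in> A" "a + (1, 0) \<in> B" "b + (1, 0) \<in> B" "\<not> (a \<in> set xs \<and> b \<in> set xs)"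
  obtains i where "Suc i < length xs" "xs ! i \<in> {a, b}" "xs ! Suc i = xs ! i + (1, 0)"
    "set (take (Suc i) xs) \<subseteq> A" "set (drop (Suc i) xs) \<subseteq> B"
proof -
  obtain i where i: "Suc i < length xs" "\<forall>k\<le>i. xs ! k \<in> A" "xs ! Suc i \<in> B"
    using first_crossing[OF saw(2) P] .
  have AB: "p \<in> A \<Longrightarrow> p \<notin> B" for p using P(3) by blast
  have cr: "xs ! k \<in> {a, b} \<and> xs ! Suc k = xs ! k + (1, 0)"
    if "Suc k < length xs" "xs ! k \<in> A" "xs ! Suc k \<in> B" for k
    using cross[OF that(1)] that AB[of "xs ! Suc k"] AB[of a] AB[of b] ab by (auto simp: doubleton_eq_iff)
  have rest: "xs ! k \<in> B" if "Suc i \<le> k" "k < length xs" for k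
    using that
  proof (induction k rule: dec_induct)
    case (step k)
    show ?case
    proof (rule ccontr)
      assume "xs ! Suc k \<notin> B"
      then have kA: "xs ! Suc k \<in> A" using P(4) step nth_mem by blast
      moreover have kB: "xs ! k \<in> B" using step by simp
      ultimately have "xs ! Suc k \<noteq> a + (1, 0)" "xs ! Suc k \<noteq> b + (1, 0)" "xs ! k \<notin> A"
        using AB ab by metis+
      then have "xs ! Suc k \<in> {a, b}"
        using cross[of k] step kA by (auto simp: doubleton_eq_iff)
      moreover have "xs ! i \<in> {a, b}" using cr[of i] i by blast
      moreover have "xs ! Suc k \<noteq> xs ! i"
        using saw step i by (simp add: saw_def nth_eq_iff_index_eq)
      moreover have "xs ! Suc k \<in> set xs" "xs ! i \<in> set xs" using step i by auto
      ultimately show False using ab(5) by auto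
    qed
  qed (use i in simp)
  have "set (take (Suc i) xs) \<subseteq> A"
  proof
    fix p assume "p \<in> set (take (Suc i) xs)"
    then obtain k where "k < Suc i" "p = xs ! k" unfolding in_set_conv_nth by auto
    then show "p \<in> A" using i(2) by simp
  qed
  moreover have "set (drop (Suc i) xs) \<subseteq> B"
  proof
    fix p assume "p \<in> set (drop (Suc i) xs)"
    then obtain k where "k < length xs - Suc i" "p = xs ! (Suc i + k)" unfolding in_set_conv_nth by auto
    then show "p \<in> B" using rest[of "Suc i + k"] by simp
  qed
  ultimately show thesis using that[of i] i cr[of i] by blast
qed

text \<open>Both strands lead from \<open>P\<close> to \<open>Q\<close>, only two edges connect
  these, and the strands share only their ends. Hence each strand uses exactly one of the two
  edges.\<close>

lemma strand_cut_of_global_cut: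
  assumes UD: "(U, D) \<in> strands n" and G: "G = path_edges U \<union> path_edges D"
    and c: "global_cut G x y P Q"
  obtains i j where "strand_cut U D i j" "{U ! i, D ! j} = {(x, y), (x, y - 1)}"
    "\<Union>P = set (take (Suc i) U) \<union> set (take (Suc j) D)"
proof -
  define A B where "A = \<Union>P" and "B = \<Union>Q"
  note AB = A_def[symmetric] B_def[symmetric]
  have P: "polygon P" "{(x, y), (x, y - 1)} \<in> P" and Q: "polygon Q" "{(x + 1, y), (x + 1, y - 1)} \<in> Q"
    and disj: "A \<inter> B = {}" and GJ: "G = plaquette_join P Q x y"
    and left: "\<And>p q. p \<in> A \<Longrightarrow> q \<in> B \<Longrightarrow> snd p = snd q \<Longrightarrow> fst p < fst q"
    and Q0: "\<And>q. q \<in> B \<Longrightarrow> 0 < snd q" and y: "1 < y"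
    using c unfolding global_cut_def AB by blast+
  obtain t where t: "t \<in> B" "\<And>p. p \<in> A \<Longrightarrow> snd p < snd t"
    using c unfolding global_cut_def AB by blast
  have U: "saw U" "length U \<ge> 2" "hd U = 0" and D: "saw D" "length D \<ge> 2" "hd D = 0"
    and last: "last D = last U" and int: "set U \<inter> set D = {0, last U}"
    using UD by (auto simp: strands_def)
  have top: "snd p \<le> snd (last U)" if "p \<in> set U \<union> set D" for p
    using UD that unfolding strands_def by blast
  have ne: "U \<noteq> []" "D \<noteq> []" using U D by auto
  have VG: "set U \<union> set D = A \<union> B"
    using plaquette_join(3)[OF P Q disj[unfolded A_def B_def]] Union_path_edges[OF U(2)] Union_path_edges[OF D(2)]
    unfolding GJ[symmetric] G AB by (simp only: Union_Un_distrib)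
  have v: "(x, y) \<in> A" "(x, y - 1) \<in> A" "(x + 1, y) \<in> B" "(x + 1, y - 1) \<in> B"
    using P(2) Q(2) unfolding A_def B_def by blast+
  have "0 \<in> set U" "last U \<in> set U" using U ne hd_in_set last_in_set by metis+
  then have "0 \<in> A \<union> B" "last U \<in> A \<union> B" using VG by blast+
  moreover have "0 \<notin> B" using Q0[of 0] by force
  moreover have "t \<in> set U \<union> set D" using t(1) VG by blast
  then have "last U \<notin> A" using t(2)[of "last U"] top[of t] by linarith
  ultimately have z: "0 \<in> A" and l: "last U \<in> B" by blast+
  have cross: "{xs ! k, xs ! Suc k} = {(x, y), (x, y) + (1, 0)} \<or>
      {xs ! k, xs ! Suc k} = {(x, y - 1), (x, y - 1) + (1, 0)}"
    if "path_edges xs \<subseteq> G" "Suc k < length xs" "(xs ! k \<in> A) \<noteq> (xs ! Suc k \<in> A)"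
      "set xs \<subseteq> A \<union> B" for xs k
  proof -
    have e: "{xs ! k, xs ! Suc k} \<in> plaquette_join P Q x y"
      using subsetD[OF that(1) path_edges_nth[OF that(2)]] unfolding GJ .
    have "xs ! k \<in> A \<union> B" "xs ! Suc k \<in> A \<union> B"
      using that(2) by (intro subsetD[OF that(4)] nth_mem; simp)+
    then have "(xs ! k \<in> A \<and> xs ! Suc k \<in> B) \<or> (xs ! Suc k \<in> A \<and> xs ! k \<in> B)"
      using that(3) by blast
    then show ?thesis
    proof (elim disjE conjE)
      assume h: "xs ! k \<in> A" "xs ! Suc k \<in> B"
      show ?thesis using plaquette_join_crossing[OF P(1) Q(1) disj[unfolded A_def B_def] e _ h(1)[unfolded A_def] _ h(2)[unfolded B_def]] by simp
    next
      assume h: "xs ! Suc k \<in> A" "xs ! k \<in> B"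
      show ?thesis using plaquette_join_crossing[OF P(1) Q(1) disj[unfolded A_def B_def] e _ h(1)[unfolded A_def] _ h(2)[unfolded B_def]] by simp
    qed
  qed
  have nz: "(x, y) \<noteq> 0" "(x, y - 1) \<noteq> 0" using y by (auto simp: zero_prod_def)
  have nl: "(x, y) \<noteq> last U" "(x, y - 1) \<noteq> last U" using v(1,2) l disj by (metis disjoint_iff)+
  have both: "\<not> (p \<in> set U \<and> p \<in> set D)" if "p \<in> {(x, y), (x, y - 1)}" for p
  proof
    assume "p \<in> set U \<and> p \<in> set D"
    then have "p \<in> {0, last U}" unfolding int[symmetric] by blast
    then show False using that nz nl by auto
  qed
  have inD: "\<not> ((x, y) \<in> set U \<and> (x, y - 1) \<in> set U)" if "\<exists>p\<in>{(x, y), (x, y - 1)}. p \<in> set D"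
    using that both by blast
  have inU: "\<not> ((x, y) \<in> set D \<and> (x, y - 1) \<in> set D)" if "\<exists>p\<in>{(x, y), (x, y - 1)}. p \<in> set U"
    using that both by blast
  have sub: "set U \<subseteq> A \<union> B" "set D \<subseteq> A \<union> B" using VG by blast+
  have a: "(x, y) + (1, 0) \<in> B" "(x, y - 1) + (1, 0) \<in> B"
    using v(3,4) unfolding plus_prod_def by simp_all
  \<comment> \<open>A strand contains at least one left end of the connecting edges. These are
    interior vertices, so the other strand misses that one and cannot contain both.\<close>
  have some: "\<exists>p\<in>{(x, y), (x, y - 1)}. p \<in> set xs"
    if xs: "xs \<noteq> []" "hd xs = 0" "last xs = last U" "set xs \<subseteq> A \<union> B" "path_edges xs \<subseteq> G" for xs
  proof -
    obtain i where i: "Suc i < length xs" "\<forall>k\<le>i. xs ! k \<in> A" "xs ! Suc i \<in> B"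
      using first_crossing[OF xs(1) _ _ disj xs(4)] z l xs(2,3) by metis
    have "xs ! i \<in> A" "xs ! Suc i \<notin> A" using i disj by blast+
    then have "{xs ! i, xs ! Suc i} = {(x, y), (x, y) + (1, 0)} \<or>
        {xs ! i, xs ! Suc i} = {(x, y - 1), (x, y - 1) + (1, 0)}"
      using cross[OF xs(5) i(1) _ xs(4)] by metis
    moreover have "xs ! i \<noteq> (x, y) + (1, 0)" "xs ! i \<noteq> (x, y - 1) + (1, 0)"
      using \<open>xs ! i \<in> A\<close> a disj by (metis IntI emptyE)+
    ultimately have "xs ! i \<in> {(x, y), (x, y - 1)}"
      by (metis doubleton_eq_iff insertCI)
    moreover have "xs ! i \<in> set xs" using i by auto
    ultimately show ?thesis by blast
  qed
  have sU: "path_edges U \<subseteq> G" "path_edges D \<subseteq> G" using G by auto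
  have nU: "\<not> ((x, y) \<in> set U \<and> (x, y - 1) \<in> set U)"
    using inD some[OF ne(2) D(3) last sub(2) sU(2)] .
  have nD: "\<not> ((x, y) \<in> set D \<and> (x, y - 1) \<in> set D)"
    using inU some[OF ne(1) U(3) refl sub(1) sU(1)] .
  obtain i where i: "Suc i < length U" "U ! i \<in> {(x, y), (x, y - 1)}" "U ! Suc i = U ! i + (1, 0)"
    "set (take (Suc i) U) \<subseteq> A" "set (drop (Suc i) U) \<subseteq> B"
    using strand_crosses_once[OF U(1) ne(1) _ _ disj sub(1) cross[OF sU(1) _ _ sub(1)] v(1,2) a nU]
      z l U(3) by metis
  obtain j where j: "Suc j < length D" "D ! j \<in> {(x, y), (x, y - 1)}" "D ! Suc j = D ! j + (1, 0)"
    "set (take (Suc j) D) \<subseteq> A" "set (drop (Suc j) D) \<subseteq> B"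
    using strand_crosses_once[OF D(1) ne(2) _ _ disj sub(2) cross[OF sU(2) _ _ sub(2)] v(1,2) a nD]
      z l D(3) last by metis
  have mem: "U ! i \<in> set U" "D ! j \<in> set D" using i j by auto
  have UDn: "U ! i \<noteq> D ! j" using both[OF i(2)] mem by metis
  have ij: "{U ! i, D ! j} = {(x, y), (x, y - 1)}" using i(2) j(2) UDn by auto
  have pos: "0 < i" "0 < j"
    using i(2) j(2) nz U D ne by (metis gr0I hd_conv_nth insertE singletonD)+
  have VP: "A = set (take (Suc i) U) \<union> set (take (Suc j) D)"
  proof (intro subset_antisym subsetI)
    fix p assume p: "p \<in> A"
    then have "p \<notin> B" using disj by blast
    have "p \<in> set U \<union> set D" using p VG by blast
    then have "p \<in> set (take (Suc i) U @ drop (Suc i) U) \<union> set (take (Suc j) D @ drop (Suc j) D)" by simp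
    then show "p \<in> set (take (Suc i) U) \<union> set (take (Suc j) D)"
      using i(5) j(5) \<open>p \<notin> B\<close> unfolding set_append by blast
  qed (use i(4) j(4) in blast)
  have "strand_cut U D i j"
    unfolding strand_cut_def
  proof (intro conjI ballI impI)
    show "fst (U ! i) = fst (D ! j)" "\<bar>snd (U ! i) - snd (D ! j)\<bar> = 1"
      using i(2) j(2) UDn by auto
  next
    fix p q
    assume "p \<in> set (take (Suc i) U) \<union> set (take (Suc j) D)"
      "q \<in> set (drop (Suc i) U) \<union> set (drop (Suc j) D)" "snd p = snd q"
    moreover from this have "p \<in> A" "q \<in> B" using i j by blast+
    ultimately show "fst p < fst q" using left by blast
  qed (use i j pos in auto)
  then show thesis using ij VP unfolding A_def by (rule that)
qed

text \<open>The position on \<open>U\<close> suffices to identify a cut, by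
  \<open>strand_cut_unique\<close>.\<close>

definition cut_indices :: "point list \<Rightarrow> point list \<Rightarrow> nat set" where
  "cut_indices U D = {i. \<exists>j. strand_cut U D i j}"

lemma cut_indices_subset: "cut_indices U D \<subseteq> {..<length U}"
  by (auto simp: cut_indices_def strand_cut_def)

lemma finite_cut_indices: "finite (cut_indices U D)"
  using cut_indices_subset finite_subset by blast

text \<open>The vertices of \<open>Q\<close> are the complement of those of \<open>P\<close>, and
  each polygon consists of the edges of \<open>G\<close> within its vertex set and of the one edge
  removed by the join.\<close>

lemma global_cut_unique:
  assumes "global_cut G x y P Q" "global_cut G x y P' Q'" "\<Union>P = \<Union>P'"
  shows "P = P' \<and> Q = Q'"
proof -
  have 1: "polygon P" "{(x, y), (x, y - 1)} \<in> P" "polygon Q" "{(x + 1, y), (x + 1, y - 1)} \<in> Q"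
    "\<Union>P \<inter> \<Union>Q = {}" "G = plaquette_join P Q x y"
    using assms(1) unfolding global_cut_def by blast+
  have 2: "polygon P'" "{(x, y), (x, y - 1)} \<in> P'" "polygon Q'" "{(x + 1, y), (x + 1, y - 1)} \<in> Q'"
    "\<Union>P' \<inter> \<Union>Q' = {}" "G = plaquette_join P' Q' x y"
    using assms(2) unfolding global_cut_def by blast+
  have "\<Union>Q = \<Union>G - \<Union>P" unfolding 1(6) plaquette_join(3)[OF 1(1-5)] using 1(5) by blast
  moreover have "\<Union>Q' = \<Union>G - \<Union>P'" unfolding 2(6) plaquette_join(3)[OF 2(1-5)] using 2(5) by blast
  ultimately have Q: "\<Union>Q = \<Union>Q'" using assms(3) by simp
  note l1 = plaquette_join_left[OF 1(1-5), folded 1(6)]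
  note l2 = plaquette_join_left[OF 2(1-5), folded 2(6)]
  show ?thesis
    using trans[OF l1(1)[unfolded assms(3)] l2(1)[symmetric]] trans[OF l1(2)[unfolded Q] l2(2)[symmetric]]
    by blast
qed

lemma card_cuts_le:
  assumes UD: "(U, D) \<in> strands n" and G: "G = path_edges U \<union> path_edges D"
  shows "card (cuts G) \<le> card (cut_indices U D)"
proof -
  define R where "R = (\<lambda>(x, y, P, Q) i. \<exists>j. strand_cut U D i j \<and>
    {U ! i, D ! j} = {(x :: int, y :: int), (x, y - 1)} \<and> \<Union>P = set (take (Suc i) U) \<union> set (take (Suc j) D) \<and>
    global_cut G x y P Q)"
  show ?thesis
  proof (rule card_le_by_relation[where R = R])
  fix t assume "t \<in> cuts G"
  then obtain x y P Q where t: "t = (x, y, P, Q)" "global_cut G x y P Q" by (auto simp: cuts_def)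
  show "\<exists>i\<in>cut_indices U D. R t i"
    unfolding t(1) R_def prod.case cut_indices_def
    using strand_cut_of_global_cut[OF UD G t(2)] t(2) by (metis mem_Collect_eq)
next
  fix s t i
  assume "s \<in> cuts G" "t \<in> cuts G" and R: "R s i" "R t i"
  obtain x y P Q where s: "s = (x, y, P, Q)" "global_cut G x y P Q"
    using \<open>s \<in> cuts G\<close> by (auto simp: cuts_def)
  obtain x' y' P' Q' where t: "t = (x', y', P', Q')" "global_cut G x' y' P' Q'"
    using \<open>t \<in> cuts G\<close> by (auto simp: cuts_def)
  obtain j where j: "strand_cut U D i j" "{U ! i, D ! j} = {(x, y), (x, y - 1)}"
    "\<Union>P = set (take (Suc i) U) \<union> set (take (Suc j) D)"
    using R(1) unfolding s(1) R_def prod.case by blast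
  obtain j' where j': "strand_cut U D i j'" "{U ! i, D ! j'} = {(x', y'), (x', y' - 1)}"
    "\<Union>P' = set (take (Suc i) U) \<union> set (take (Suc j') D)"
    using R(2) unfolding t(1) R_def prod.case by blast
  have "j = j'" using strand_cut_unique[OF UD j(1) j'(1)] .
  then have "{(x, y), (x, y - 1)} = {(x', y'), (x', y' - 1)}" and VP: "\<Union>P = \<Union>P'"
    using j j' by simp_all
  then have xy: "x = x'" "y = y'" by (auto simp: doubleton_eq_iff)
  show "s = t" using global_cut_unique[OF s(2) _ VP] t xy s by auto
  qed (rule finite_cut_indices)
qed

section \<open>Swapping the strands at a chain of cuts\<close>

text \<open>Each strand runs up to its end of the cut, takes the vertical step to the other strand
  and follows that one. Both \<open>U ! i\<close> and \<open>D ! j\<close> end up on both strands.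
  This adds two to the total length, and the common vertices are the marks by which the swap can be
  found again.\<close>

definition swap_at :: "nat \<times> nat \<Rightarrow> 'a list \<times> 'a list \<Rightarrow> 'a list \<times> 'a list" where
  "swap_at = (\<lambda>(i, j) (U, D). (take (Suc i) U @ D ! j # drop (Suc j) D, take (Suc j) D @ U ! i # drop (Suc i) U))"

lemma swap_at_apply:
  "swap_at (i, j) (U, D) =
     (take (Suc i) U @ D ! j # drop (Suc j) D, take (Suc j) D @ U ! i # drop (Suc i) U)"
  by (simp add: swap_at_def)

text \<open>\<open>foldr\<close> performs the last swap first. As a swap changes neither strand up
  to the cut, the indices of the cuts still to come remain valid.\<close>

definition cut_chain :: "point list \<Rightarrow> point list \<Rightarrow> (nat \<times> nat) list \<Rightarrow> bool" where
  "cut_chain U D cs \<longleftrightarrow> (\<forall>(i, j)\<in>set cs. strand_cut U D i j) \<and>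
     sorted_wrt (\<lambda>c c'. fst c < fst c' \<and> snd c < snd c') cs"

lemma cut_chain_Cons:
  "cut_chain U D ((i, j) # cs) \<longleftrightarrow>
     strand_cut U D i j \<and> (\<forall>c\<in>set cs. i < fst c \<and> j < snd c) \<and> cut_chain U D cs"
  by (auto simp: cut_chain_def)

lemma strand_cut_interior:
  assumes UD: "(U, D) \<in> strands n" and "strand_cut U D i j"
  shows "U ! i \<noteq> 0" "U ! i \<noteq> last U" "U ! i \<in> set U" "U ! i \<notin> set D"
proof -
  have U: "distinct U" "hd U = 0" "U \<noteq> []" "Suc i < length U" "0 < i"
    and int: "set U \<inter> set D = {0, last U}"
    using assms by (auto simp: strands_def strand_cut_def saw_def)
  show n0: "U ! i \<noteq> 0"
    using U nth_eq_iff_index_eq[of U i 0] by (auto simp: hd_conv_nth)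
  show nl: "U ! i \<noteq> last U"
    using U nth_eq_iff_index_eq[of U i "length U - 1"] by (auto simp: last_conv_nth)
  show m: "U ! i \<in> set U" using U by simp
  then have "U ! i \<in> set D \<Longrightarrow> U ! i \<in> {0, last U}" unfolding int[symmetric] by simp
  then show "U ! i \<notin> set D" using n0 nl by auto
qed

text \<open>Pieces of one strand are disjoint by self-avoidance. Pieces of different strands could
  meet only in \<open>0\<close> or \<open>last U\<close>, of which the former lies on no final piece
  and the latter not on the initial piece of \<open>U\<close>.\<close>

lemma strands_separate:
  assumes UD: "(U, D) \<in> strands n" and "strand_cut U D i j"
  shows "set (take (Suc i) U) \<inter> (set (drop (Suc i) U) \<union> set (drop (Suc j) D)) = {}"
proof -
  have U: "distinct U" "hd U = 0" "U \<noteq> []" "Suc i < length U"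
    and D: "distinct D" "hd D = 0" "D \<noteq> []" "Suc j < length D"
    and int: "set U \<inter> set D = {0, last U}"
    using assms by (auto simp: strands_def strand_cut_def saw_def)
  have t: "set (take (Suc i) U) \<inter> set (drop (Suc i) U) = {}"
    using U(1) set_take_disj_set_drop_if_distinct by blast
  have "last U \<in> set (drop (Suc i) U)"
    using U by (metis drop_eq_Nil last_drop last_in_set linorder_not_le)
  then have nl: "last U \<notin> set (take (Suc i) U)" using t by blast
  have "D = hd D # drop 1 D" using D(3) by (cases D) auto
  then have "hd D \<notin> set (drop 1 D)" using D(1) by (metis distinct.simps(2))
  then have n0: "0 \<notin> set (drop (Suc j) D)"
    using D(2) set_drop_subset_set_drop[of 1 "Suc j" D] by auto
  have False if "p \<in> set (take (Suc i) U)" "p \<in> set (drop (Suc j) D)" for p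
  proof -
    have "p \<in> set U \<inter> set D" using that by (meson IntI in_set_dropD in_set_takeD)
    then have "p \<in> {0, last U}" unfolding int .
    then show False using that n0 nl by auto
  qed
  then show ?thesis using t by blast
qed

text \<open>One side of a swap, performed when the parts behind the cut may already have been swapped.\<close>

lemma swap_side:
  assumes UD: "(U, D) \<in> strands n" and c: "strand_cut U D i j"
    and D1: "saw D1" "take (Suc (Suc j)) D1 = take (Suc (Suc j)) D"
      "set (drop (Suc j) D1) \<subseteq> set (drop (Suc i) U) \<union> set (drop (Suc j) D)"
  shows "saw (take (Suc i) U @ D1 ! j # drop (Suc j) D1)"
    and "last (take (Suc i) U @ D1 ! j # drop (Suc j) D1) = last D1"
    and "hd (take (Suc i) U @ D1 ! j # drop (Suc j) D1) = 0"
    and "D1 ! j = D ! j" "Suc j < length D1"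
proof -
  have U: "saw U" "hd U = 0" "U \<noteq> []" "Suc i < length U"
    and D: "saw D" "Suc j < length D"
    and f: "fst (U ! i) = fst (D ! j)" "\<bar>snd (U ! i) - snd (D ! j)\<bar> = 1"
    using UD c by (auto simp: strands_def strand_cut_def)
  have "length (take (Suc (Suc j)) D1) = Suc (Suc j)" using D by (simp add: D1)
  then show l1: "Suc j < length D1" by simp
  have "take (Suc (Suc j)) D1 ! j = take (Suc (Suc j)) D ! j" by (simp only: D1)
  then show e: "D1 ! j = D ! j" by simp
  have "D1 = take j D1 @ drop j D1" by simp
  then have "saw (drop j D1)" using D1(1) saw_append by metis
  moreover have "drop j D1 = D1 ! j # drop (Suc j) D1" using l1 by (simp add: Cons_nth_drop_Suc)
  ultimately have s1: "saw (D1 ! j # drop (Suc j) D1)" by simp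
  have "U = take (Suc i) U @ drop (Suc i) U" by simp
  then have s2: "saw (take (Suc i) U)" using U(1) saw_append by metis
  have "D ! j \<notin> set U" using strand_cut_interior(4)[OF strands_sym[OF UD]] c strand_cut_sym by blast
  then have "D1 ! j \<notin> set (take (Suc i) U)" using e in_set_takeD by metis
  moreover have "set (take (Suc i) U) \<inter> set (drop (Suc j) D1) = {}"
    using strands_separate[OF UD c] D1(3) by blast
  moreover have "last (take (Suc i) U) = U ! i" using U by (simp add: last_conv_nth)
  moreover have "adj (U ! i) (D1 ! j)" using f by (simp add: adj_def e)
  ultimately show "saw (take (Suc i) U @ D1 ! j # drop (Suc j) D1)"
    using s1 s2 by (simp add: saw_append)
  show "last (take (Suc i) U @ D1 ! j # drop (Suc j) D1) = last D1"
    using l1 by (simp add: last_drop)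
  show "hd (take (Suc i) U @ D1 ! j # drop (Suc j) D1) = 0"
    using U by (cases U) auto
qed

text \<open>The last clause is the invariant for cuts still to be performed: both strands are
  unchanged up to the vertex after \<open>i\<close> and \<open>j\<close>, and their remainders use
  only vertices of the original remainders. A cut at \<open>(i, j)\<close> separates those from the
  initial pieces, so that the next swap creates no self-intersection.\<close>

lemma foldr_swap:
  assumes UD: "(U, D) \<in> strands n"
  shows "cut_chain U D cs \<Longrightarrow> foldr swap_at cs (U, D) = (U', D') \<Longrightarrow>
    U' \<noteq> [] \<and> D' \<noteq> [] \<and> saw U' \<and> saw D' \<and> hd U' = 0 \<and> hd D' = 0 \<and> last U' = last U \<and> last D' = last U \<and>
    set U' \<union> set D' = set U \<union> set D \<and>
    length U' + length D' = length U + length D + 2 * length cs \<and>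
    (\<forall>i j. (\<forall>c\<in>set cs. i < fst c \<and> j < snd c) \<longrightarrow>
      take (Suc (Suc i)) U' = take (Suc (Suc i)) U \<and> take (Suc (Suc j)) D' = take (Suc (Suc j)) D \<and>
      set (drop (Suc i) U') \<subseteq> set (drop (Suc i) U) \<union> set (drop (Suc j) D) \<and>
      set (drop (Suc j) D') \<subseteq> set (drop (Suc i) U) \<union> set (drop (Suc j) D))"
proof (induction cs arbitrary: U' D')
  case Nil
  then show ?case using UD by (auto simp: strands_def)
next
  case (Cons c cs)
  obtain i j where c: "c = (i, j)" by fastforce
  obtain U1 D1 where UD1: "foldr swap_at cs (U, D) = (U1, D1)" by fastforce
  have cut: "strand_cut U D i j" and less: "\<forall>c\<in>set cs. i < fst c \<and> j < snd c" and ch: "cut_chain U D cs"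
    using Cons.prems(1) unfolding c cut_chain_Cons by blast+
  note IH = Cons.IH[OF ch UD1]
  have U1: "saw U1" and D1: "saw D1" and last: "last U1 = last U" "last D1 = last U"
    and set1: "set U1 \<union> set D1 = set U \<union> set D"
    and len1: "length U1 + length D1 = length U + length D + 2 * length cs"
    using IH by blast+
  have tk: "take (Suc (Suc i)) U1 = take (Suc (Suc i)) U" "take (Suc (Suc j)) D1 = take (Suc (Suc j)) D"
    and dr: "set (drop (Suc i) U1) \<subseteq> set (drop (Suc i) U) \<union> set (drop (Suc j) D)"
      "set (drop (Suc j) D1) \<subseteq> set (drop (Suc i) U) \<union> set (drop (Suc j) D)"
    using IH less by blast+
  have tk': "take (Suc i) U1 = take (Suc i) U" "take (Suc j) D1 = take (Suc j) D"
    using arg_cong[OF tk(1), of "take (Suc i)"] arg_cong[OF tk(2), of "take (Suc j)"] by simp_all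
  have U': "U' = take (Suc i) U @ D1 ! j # drop (Suc j) D1"
    and D': "D' = take (Suc j) D @ U1 ! i # drop (Suc i) U1"
    using Cons.prems(2) by (simp_all add: UD1 c swap_at_apply tk')
  have cut': "strand_cut D U j i" and DU: "(D, U) \<in> strands n"
    using cut strand_cut_sym strands_sym[OF UD] by blast+
  note s = swap_side[OF UD cut D1 tk(2) dr(2), folded U']
  note s' = swap_side[OF DU cut' U1 tk(1) dr(1)[unfolded Un_commute[of "set (drop (Suc i) U)"]], folded D']
  have lU: "Suc i < length U" "Suc j < length D" using cut by (auto simp: strand_cut_def)
  have "set U' \<union> set D' = set U1 \<union> set D1"
  proof -
    have "set U1 = set (take (Suc i) U) \<union> set (drop (Suc i) U1)"
      "set D1 = set (take (Suc j) D) \<union> set (drop (Suc j) D1)"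
      using tk' by (metis append_take_drop_id set_append)+
    moreover have "D1 ! j \<in> set D1" "U1 ! i \<in> set U1" using s(5) s'(5) by auto
    ultimately show ?thesis unfolding U' D' by auto
  qed
  then have set': "set U' \<union> set D' = set U \<union> set D" using set1 by simp
  have len': "length U' + length D' = length U + length D + 2 * length (c # cs)"
    using len1 lU s(5) s'(5) unfolding U' D' by simp
  have rest: "take (Suc (Suc k)) U' = take (Suc (Suc k)) U \<and> take (Suc (Suc l)) D' = take (Suc (Suc l)) D \<and>
      set (drop (Suc k) U') \<subseteq> set (drop (Suc k) U) \<union> set (drop (Suc l) D) \<and>
      set (drop (Suc l) D') \<subseteq> set (drop (Suc k) U) \<union> set (drop (Suc l) D)"
    if "\<forall>c\<in>set (c # cs). k < fst c \<and> l < snd c" for k l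
  proof (intro conjI)
    have kl: "k < i" "l < j" using that c by auto
    show "take (Suc (Suc k)) U' = take (Suc (Suc k)) U" "take (Suc (Suc l)) D' = take (Suc (Suc l)) D"
      unfolding U' D' using kl lU by (simp_all add: min_def)
    have sub: "set (drop (Suc i) U) \<subseteq> set (drop (Suc k) U)" "set (drop (Suc j) D) \<subseteq> set (drop (Suc l) D)"
      using kl by (auto intro!: set_drop_subset_set_drop)
    have m: "D ! j \<in> set (drop (Suc l) D)" "U ! i \<in> set (drop (Suc k) U)"
      using kl lU by (auto intro!: nth_in_drop)
    have t: "set (drop (Suc k) (take (Suc i) U)) \<subseteq> set (drop (Suc k) U)"
      "set (drop (Suc l) (take (Suc j) D)) \<subseteq> set (drop (Suc l) D)"
      by (metis drop_take in_set_takeD subsetI)+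
    have "drop (Suc k) U' = drop (Suc k) (take (Suc i) U) @ D1 ! j # drop (Suc j) D1"
      unfolding U' using kl lU by simp
    then show "set (drop (Suc k) U') \<subseteq> set (drop (Suc k) U) \<union> set (drop (Suc l) D)"
      using t(1) m(1) dr(2) sub s(4) by auto
    have "drop (Suc l) D' = drop (Suc l) (take (Suc j) D) @ U1 ! i # drop (Suc i) U1"
      unfolding D' using kl lU by simp
    then show "set (drop (Suc l) D') \<subseteq> set (drop (Suc k) U) \<union> set (drop (Suc l) D)"
      using t(2) m(2) dr(1) sub s'(4) by auto
  qed
  have ne': "U' \<noteq> []" "D' \<noteq> []" by (simp_all add: U' D')
  have last': "last U' = last U" "last D' = last U" using s(2) s'(2) last by simp_all
  show ?case
    by (intro conjI allI impI ne' s(1,3) s'(1,3) last' set' len'; drule rest; elim conjE; assumption)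
qed

lemma foldr_swap_Cons:
  assumes UD: "(U, D) \<in> strands n" and ch: "cut_chain U D ((i, j) # cs)"
    and UD1: "foldr swap_at cs (U, D) = (U1, D1)"
  shows "foldr swap_at ((i, j) # cs) (U, D) =
      (take (Suc i) U @ D ! j # drop (Suc j) D1, take (Suc j) D @ U ! i # drop (Suc i) U1)"
    and "take (Suc i) U1 = take (Suc i) U" "take (Suc j) D1 = take (Suc j) D"
    and "set (drop (Suc i) U1) \<subseteq> set (drop (Suc i) U) \<union> set (drop (Suc j) D)"
proof -
  have cut: "strand_cut U D i j" and less: "\<forall>c\<in>set cs. i < fst c \<and> j < snd c" and ch': "cut_chain U D cs"
    using ch unfolding cut_chain_Cons by blast+
  have tk: "take (Suc (Suc i)) U1 = take (Suc (Suc i)) U" "take (Suc (Suc j)) D1 = take (Suc (Suc j)) D"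
    and dr: "set (drop (Suc i) U1) \<subseteq> set (drop (Suc i) U) \<union> set (drop (Suc j) D)"
    using foldr_swap[OF UD ch' UD1] less by blast+
  show tk': "take (Suc i) U1 = take (Suc i) U" "take (Suc j) D1 = take (Suc j) D"
    using arg_cong[OF tk(1), of "take (Suc i)"] arg_cong[OF tk(2), of "take (Suc j)"] by simp_all
  have "U1 ! i = U ! i" "D1 ! j = D ! j"
    using arg_cong[OF tk(1), of "\<lambda>xs. xs ! i"] arg_cong[OF tk(2), of "\<lambda>xs. xs ! j"] by simp_all
  then show "foldr swap_at ((i, j) # cs) (U, D) =
      (take (Suc i) U @ D ! j # drop (Suc j) D1, take (Suc j) D @ U ! i # drop (Suc i) U1)"
    by (simp add: UD1 swap_at_apply tk')
  show "set (drop (Suc i) U1) \<subseteq> set (drop (Suc i) U) \<union> set (drop (Suc j) D)" by (rule dr)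
qed

text \<open>The first common interior vertex of the swapped strands is where the first swap took place.\<close>

lemma first_swap:
  assumes UD: "(U, D) \<in> strands n" and ch: "cut_chain U D ((i, j) # cs)"
    and sw: "foldr swap_at ((i, j) # cs) (U, D) = (U', D')"
  shows "i = (LEAST k. 0 < k \<and> U' ! k \<in> set D')" "U' ! i = U ! i" "U' ! i \<in> set D'"
proof -
  obtain U1 D1 where UD1: "foldr swap_at cs (U, D) = (U1, D1)" by fastforce
  note f = foldr_swap_Cons[OF UD ch UD1]
  have cut: "strand_cut U D i j" using ch unfolding cut_chain_Cons by blast
  have U': "U' = take (Suc i) U @ D ! j # drop (Suc j) D1"
    and D': "D' = take (Suc j) D @ U ! i # drop (Suc i) U1" using f(1) sw by simp_all
  have len: "Suc i < length U" "0 < i" using cut by (auto simp: strand_cut_def)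
  have nth: "U' ! k = U ! k" if "k \<le> i" for k
    unfolding U' using that len by (simp add: nth_append)
  have int: "set U \<inter> set D = {0, last U}" and U: "distinct U" "hd U = 0" "U \<noteq> []"
    using UD by (auto simp: strands_def saw_def)
  show "U' ! i = U ! i" by (simp add: nth)
  then show i: "U' ! i \<in> set D'" unfolding D' by simp
  show "i = (LEAST k. 0 < k \<and> U' ! k \<in> set D')"
  proof (rule Least_equality[symmetric])
    show "0 < i \<and> U' ! i \<in> set D'" using i len by simp
    fix k assume k: "0 < k \<and> U' ! k \<in> set D'"
    show "i \<le> k"
    proof (rule ccontr)
      assume "\<not> i \<le> k"
      then have ki: "k < i" by simp
      have "U ! k \<in> set D'" using k nth[of k] ki by simp
      have "U ! k \<noteq> 0" using U k ki len nth_eq_iff_index_eq[of U k 0] by (auto simp: hd_conv_nth)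
      moreover have "U ! k \<noteq> last U"
        using U ki len nth_eq_iff_index_eq[of U k "length U - 1"] by (auto simp: last_conv_nth)
      moreover have "U ! k \<in> set U" using ki len by simp
      ultimately have nD: "U ! k \<notin> set D" using int by blast
      then have 1: "U ! k \<notin> set (take (Suc j) D)" "U ! k \<notin> set (drop (Suc j) D)"
        by (meson in_set_takeD in_set_dropD)+
      have "U ! k \<noteq> U ! i" using U ki len by (simp add: nth_eq_iff_index_eq)
      moreover have "U ! k \<in> set (take (Suc i) U)" using ki len by (intro nth_in_take) auto
      then have "U ! k \<notin> set (drop (Suc i) U)"
        using set_take_disj_set_drop_if_distinct[OF U(1), of "Suc i" "Suc i"] by blast
      ultimately have "U ! k \<notin> set D'" unfolding D' using 1 f(4) by auto
      then show False using \<open>U ! k \<in> set D'\<close> by simp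
    qed
  qed
qed

lemma foldr_swap_sym:
  "foldr swap_at cs (U, D) = (U', D') \<longleftrightarrow> foldr swap_at (map prod.swap cs) (D, U) = (D', U')"
proof (induction cs arbitrary: U' D')
  case (Cons c cs)
  obtain i j where c: "c = (i, j)" by fastforce
  obtain U1 D1 where UD1: "foldr swap_at cs (U, D) = (U1, D1)" by fastforce
  then have "foldr swap_at (map prod.swap cs) (D, U) = (D1, U1)" using Cons.IH by blast
  then show ?case using UD1 by (auto simp: c swap_at_apply)
qed auto

lemma cut_chain_sym: "cut_chain U D cs \<Longrightarrow> cut_chain D U (map prod.swap cs)"
  unfolding cut_chain_def sorted_wrt_map using strand_cut_sym
  by (fastforce elim!: sorted_wrt_mono_rel[rotated])

text \<open>The swaps are undone one at a time. The first common interior vertex along either strand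
  gives the indices of the first cut; the prefixes there are original, and the suffixes belong to
  the strands as they were before this swap.\<close>

lemma foldr_swap_inj:
  assumes "(U, D) \<in> strands n" "(V, E) \<in> strands n'" "cut_chain U D cs" "cut_chain V E ds"
    and "foldr swap_at cs (U, D) = foldr swap_at ds (V, E)"
  shows "U = V \<and> D = E \<and> cs = ds"
proof -
  \<comment> \<open>After at least one swap the strands have a common interior vertex and are not a
    pair of strands any more. This settles the case in which exactly one chain is empty.\<close>
  have empty: False
    if A: "(U, D) \<in> strands n" "(V, E) \<in> strands n'" "cut_chain U D (c # cs)"
      "foldr swap_at (c # cs) (U, D) = (V, E)" for U D V E n n' c and cs :: "(nat \<times> nat) list"
  proof -
    obtain i j where c: "c = (i, j)" by fastforce
    have cut: "strand_cut U D i j" using A(3) unfolding c cut_chain_Cons by blast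
    note f = first_swap[OF A(1) A(3,4)[unfolded c]]
    have len: "i < length (take (Suc i) U)" using cut by (auto simp: strand_cut_def)
    obtain U1 D1 where UD1: "foldr swap_at cs (U, D) = (U1, D1)" by fastforce
    have "V = take (Suc i) U @ D ! j # drop (Suc j) D1"
      using foldr_swap_Cons(1)[OF A(1) A(3)[unfolded c] UD1] A(4) c by simp
    then have "i < length V" using len by simp
    then have "V ! i \<in> set V \<inter> set E" using f(3) by simp
    moreover have "set V \<inter> set E = {0, last V}" using A(2) by (auto simp: strands_def)
    moreover have "last V = last U" using foldr_swap[OF A(1,3,4)] by blast
    ultimately have "U ! i \<in> {0, last U}" using f(2) by simp
    then show False using strand_cut_interior[OF A(1) cut] by auto
  qed
  show ?thesis
    using assms(3-5)
  proof (induction cs arbitrary: ds)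
    case Nil
    show ?case
    proof (cases ds)
      case (Cons d ds')
      then have "foldr swap_at (d # ds') (V, E) = (U, D)" using Nil.prems(3) by simp
      then show ?thesis using empty[OF assms(2,1)] Nil.prems(2) Cons by blast
    qed (use Nil in auto)
  next
    case (Cons c cs)
    show ?case
    proof (cases ds)
      case Nil
      then have "foldr swap_at (c # cs) (U, D) = (V, E)" using Cons.prems(3) by simp
      then show ?thesis using empty[OF assms(1,2)] Cons.prems(1) by blast
    next
      case (Cons d ds')
      obtain i j where c: "c = (i, j)" by fastforce
      obtain i' j' where d: "d = (i', j')" by fastforce
      obtain U' D' where sw: "foldr swap_at (c # cs) (U, D) = (U', D')" by fastforce
      then have sw': "foldr swap_at (d # ds') (V, E) = (U', D')" using Cons.prems(3) Cons by simp
      have ch: "cut_chain U D ((i, j) # cs)" "cut_chain V E ((i', j') # ds')"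
        using Cons.prems(1,2) c d Cons by auto
      have i: "i = i'"
        using first_swap(1)[OF assms(1) ch(1) sw[unfolded c]] first_swap(1)[OF assms(2) ch(2) sw'[unfolded d]]
        by simp
      have s1: "foldr swap_at ((j, i) # map prod.swap cs) (D, U) = (D', U')"
        using sw foldr_swap_sym[of "c # cs" U D U' D'] by (simp add: c)
      have s2: "foldr swap_at ((j', i') # map prod.swap ds') (E, V) = (D', U')"
        using sw' foldr_swap_sym[of "d # ds'" V E U' D'] by (simp add: d)
      have ch': "cut_chain D U ((j, i) # map prod.swap cs)" "cut_chain E V ((j', i') # map prod.swap ds')"
        using cut_chain_sym[OF ch(1)] cut_chain_sym[OF ch(2)] by simp_all
      have j: "j = j'"
        using first_swap(1)[OF strands_sym[OF assms(1)] ch'(1) s1]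
          first_swap(1)[OF strands_sym[OF assms(2)] ch'(2) s2] by simp
      obtain U1 D1 where UD1: "foldr swap_at cs (U, D) = (U1, D1)" by fastforce
      obtain V1 E1 where VE1: "foldr swap_at ds' (V, E) = (V1, E1)" by fastforce
      note f = foldr_swap_Cons[OF assms(1) ch(1) UD1]
      note g = foldr_swap_Cons[OF assms(2) ch(2) VE1]
      have eqs: "take (Suc i) U @ D ! j # drop (Suc j) D1 = take (Suc i) V @ E ! j # drop (Suc j) E1"
        "take (Suc j) D @ U ! i # drop (Suc i) U1 = take (Suc j) E @ V ! i # drop (Suc i) V1"
        using f(1) g(1) sw sw' unfolding c d i j by simp_all
      have len: "Suc i < length U" "Suc j < length D" "Suc i < length V" "Suc j < length E"
        using ch unfolding cut_chain_Cons strand_cut_def i j by auto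
      have "length (take (Suc i) U) = length (take (Suc i) V)"
        "length (take (Suc j) D) = length (take (Suc j) E)" using len by simp_all
      then have "take (Suc i) U = take (Suc i) V" "drop (Suc j) D1 = drop (Suc j) E1"
        "take (Suc j) D = take (Suc j) E" "drop (Suc i) U1 = drop (Suc i) V1"
        using eqs by (simp_all add: append_eq_append_conv)
      then have "U1 = V1" "D1 = E1"
        using f(2,3) g(2,3) unfolding i j by (metis append_take_drop_id)+
      then have "foldr swap_at cs (U, D) = foldr swap_at ds' (V, E)" using UD1 VE1 by simp
      moreover have "cut_chain U D cs" "cut_chain V E ds'" using ch unfolding cut_chain_Cons by blast+
      ultimately show ?thesis using Cons.IH[of ds'] c d i j Cons by simp
    qed
  qed
qed

section \<open>Polygons with many cuts are rare\<close>

definition bridge_pairs :: "nat \<Rightarrow> (point list \<times> point list) set" where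
  "bridge_pairs N = (\<Union>a\<in>{..N}. bridges a \<times> bridges (N - a))"

lemma finite_bridge_pairs: "finite (bridge_pairs N)"
  by (simp add: bridge_pairs_def finite_bridges)

text \<open>The fifth power arises from two factors for the end point of each bridge and one for the
  division of \<open>N\<close> into two lengths.\<close>

lemma card_bridge_pairs: "real (card (bridge_pairs N)) \<le> (2 * real N + 1) ^ 5 * \<mu> ^ (N + 2)"
proof -
  have mu: "\<mu> \<ge> 1" by (rule connective_constant_bounds)
  have "card (bridge_pairs N) \<le> (\<Sum>a\<le>N. card (bridges a \<times> bridges (N - a)))"
    unfolding bridge_pairs_def by (rule card_UN_le) simp
  then have "real (card (bridge_pairs N)) \<le> (\<Sum>a\<le>N. real (card (bridges a)) * real (card (bridges (N - a))))"
    unfolding card_cartesian_product by (simp only: of_nat_le_iff of_nat_sum[symmetric] of_nat_mult[symmetric])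
  also have "\<dots> \<le> (\<Sum>a\<le>N. (2 * real N + 1) ^ 4 * \<mu> ^ (N + 2))"
  proof (rule sum_mono)
    fix a assume a: "a \<in> {..N}"
    have b: "real (card (bridges b)) \<le> (2 * real N + 1)\<^sup>2 * \<mu> ^ Suc b" if "b \<le> N" for b
      using that mu by (intro order_trans[OF card_bridges_bound] mult_right_mono power_mono) auto
    have "real (card (bridges a)) * real (card (bridges (N - a)))
        \<le> ((2 * real N + 1)\<^sup>2 * \<mu> ^ Suc a) * ((2 * real N + 1)\<^sup>2 * \<mu> ^ Suc (N - a))"
      using a mu by (intro mult_mono b) auto
    also have "\<dots> = ((2 * real N + 1)\<^sup>2 * (2 * real N + 1)\<^sup>2) * (\<mu> ^ Suc a * \<mu> ^ Suc (N - a))"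
      by (simp only: mult_ac)
    also have "\<dots> = (2 * real N + 1) ^ 4 * \<mu> ^ (N + 2)"
      using a unfolding power_add[symmetric] by simp
    finally show "real (card (bridges a)) * real (card (bridges (N - a))) \<le> (2 * real N + 1) ^ 4 * \<mu> ^ (N + 2)" .
  qed
  also have "\<dots> = (real N + 1) * ((2 * real N + 1) ^ 4 * \<mu> ^ (N + 2))" by simp
  also have "\<dots> \<le> (2 * real N + 1) * ((2 * real N + 1) ^ 4 * \<mu> ^ (N + 2))"
    using mu by (intro mult_right_mono) auto
  also have "\<dots> = (2 * real N + 1) ^ 5 * \<mu> ^ (N + 2)"
    by (simp only: mult.assoc[symmetric] power_Suc[symmetric]) simp
  finally show ?thesis .
qed

text \<open>Swapping moves no vertex out of the rows between the origin and \<open>last U\<close>,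
  and these stay the ends of both paths.\<close>

lemma swapped_in_bridge_pairs:
  assumes UD: "(U, D) \<in> strands n" and ch: "cut_chain U D cs"
  shows "foldr swap_at cs (U, D) \<in> bridge_pairs (n + 2 * length cs)"
proof -
  obtain U' D' where sw: "foldr swap_at cs (U, D) = (U', D')" by fastforce
  note f = foldr_swap[OF UD ch sw]
  have len: "length U' + length D' = n + 2 * length cs + 2"
    using f UD by (auto simp: strands_def)
  have rows: "0 \<le> snd p \<and> snd p \<le> snd (last U)" if "p \<in> set U' \<union> set D'" for p
    using that f UD unfolding strands_def by blast
  have l: "length U' \<ge> 1" "length D' \<ge> 1" using f by (simp_all add: Suc_le_eq)
  have "U' \<in> bridges (length U' - 1)" "D' \<in> bridges (length D' - 1)"
    using f rows l by (auto simp: bridges_def)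
  moreover have "length D' - 1 = n + 2 * length cs - (length U' - 1)" "length U' - 1 \<le> n + 2 * length cs"
    using len l by simp_all
  ultimately show ?thesis unfolding sw bridge_pairs_def by fastforce
qed

definition cut_partner :: "point list \<Rightarrow> point list \<Rightarrow> nat \<Rightarrow> nat" where
  "cut_partner U D i = (THE j. strand_cut U D i j)"

text \<open>By \<open>strand_cut_mono\<close>, sorting the positions on \<open>U\<close> also sorts
  the partners on \<open>D\<close>, so any set of cuts can be swapped.\<close>

lemma cut_chain_of_indices:
  assumes UD: "(U, D) \<in> strands n" and S: "S \<subseteq> cut_indices U D"
  shows "cut_chain U D (map (\<lambda>i. (i, cut_partner U D i)) (sorted_list_of_set S))"
proof -
  have fin: "finite S" using S finite_cut_indices finite_subset by blast
  have cut: "strand_cut U D i (cut_partner U D i)" if i: "i \<in> S" for i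
  proof -
    obtain j where j: "strand_cut U D i j" using subsetD[OF S i] unfolding cut_indices_def by blast
    then have "\<exists>!j. strand_cut U D i j" using strand_cut_unique[OF UD] by blast
    then show ?thesis unfolding cut_partner_def by (rule theI')
  qed
  have mono: "cut_partner U D i < cut_partner U D j" if "i \<in> S" "j \<in> S" "i < j" for i j
    by (rule strand_cut_mono[OF UD cut[OF that(1)] cut[OF that(2)] that(3)])
  have "sorted_wrt (\<lambda>i j. i < j \<and> cut_partner U D i < cut_partner U D j) (sorted_list_of_set S)"
    by (rule sorted_wrt_mono_rel[OF _ strict_sorted_list_of_set])
      (use mono fin in auto)
  then show ?thesis using cut fin by (auto simp: cut_chain_def sorted_wrt_map)
qed

lemma card_cuts_le_length:
  assumes "G \<in> normal_polygons n"
  shows "card (cuts G) \<le> n"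
proof -
  obtain U D where UD: "(U, D) \<in> strands n" "G = path_edges U \<union> path_edges D"
    using ex_strands[OF assms] .
  have "card (cuts G) \<le> card (cut_indices U D)" by (rule card_cuts_le[OF UD])
  also have "\<dots> \<le> length U" using card_mono[OF _ cut_indices_subset[of U D]] by simp
  also have "\<dots> \<le> n" using UD(1) by (auto simp: strands_def)
  finally show ?thesis .
qed

text \<open>The swapped pair determines both the polygon and the \<open>m\<close>-element set of
  cuts that was used; \<open>2 * m\<close> is the length added by the swaps.\<close>

lemma many_cuts_choose:
  "card {G \<in> normal_polygons n. k \<le> card (cuts G)} * (k choose m) \<le> card (bridge_pairs (n + 2 * m))"
proof -
  define X where "X = {G \<in> normal_polygons n. k \<le> card (cuts G)}"
  define str where "str G = (SOME s. s \<in> strands n \<and> G = path_edges (fst s) \<union> path_edges (snd s))" for G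
  have str: "str G \<in> strands n \<and> G = path_edges (fst (str G)) \<union> path_edges (snd (str G))" if "G \<in> X" for G
  proof -
    have "G \<in> normal_polygons n" using that by (simp add: X_def)
    then obtain U D where "(U, D) \<in> strands n" "G = path_edges U \<union> path_edges D"
      using ex_strands by blast
    then have "\<exists>s. s \<in> strands n \<and> G = path_edges (fst s) \<union> path_edges (snd s)"
      by (intro exI[of _ "(U, D)"]) simp
    then show ?thesis unfolding str_def by (rule someI_ex)
  qed
  define I where "I G = cut_indices (fst (str G)) (snd (str G))" for G
  define cs where "cs G S = map (\<lambda>i. (i, cut_partner (fst (str G)) (snd (str G)) i)) (sorted_list_of_set S)"
    for G and S :: "nat set"
  define \<F> where "\<F> = (SIGMA G:X. {S. S \<subseteq> I G \<and> card S = m})"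
  have finX: "finite X" unfolding X_def using finite_normal_polygons by simp
  have finI: "finite (I G)" for G unfolding I_def by (rule finite_cut_indices)
  have st: "(fst (str G), snd (str G)) \<in> strands n" if "G \<in> X" for G using str[OF that] by simp
  have ch: "cut_chain (fst (str G)) (snd (str G)) (cs G S)" if "G \<in> X" "S \<subseteq> I G" for G S
    unfolding cs_def using cut_chain_of_indices[OF st[OF that(1)]] that(2) by (simp add: I_def)
  have "inj_on (\<lambda>(G, S). foldr swap_at (cs G S) (str G)) \<F>"
  proof
    fix a b
    assume "a \<in> \<F>" "b \<in> \<F>"
    then obtain G S H T where a: "a = (G, S)" "G \<in> X" "S \<subseteq> I G" and b: "b = (H, T)" "H \<in> X" "T \<subseteq> I H"
      unfolding \<F>_def by blast
    assume "(case a of (G, S) \<Rightarrow> foldr swap_at (cs G S) (str G)) = (case b of (G, S) \<Rightarrow> foldr swap_at (cs G S) (str G))"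
    then have "foldr swap_at (cs G S) (fst (str G), snd (str G)) = foldr swap_at (cs H T) (fst (str H), snd (str H))"
      by (simp add: a b)
    from foldr_swap_inj[OF st[OF a(2)] st[OF b(2)] ch[OF a(2,3)] ch[OF b(2,3)] this]
    have "str G = str H" and cs: "cs G S = cs H T" by (auto simp: prod_eq_iff)
    then have "G = H" using str[OF a(2)] str[OF b(2)] by metis
    moreover have "S = fst ` set (cs G S)" "T = fst ` set (cs H T)"
      using finite_subset[OF a(3) finI] finite_subset[OF b(3) finI] by (simp_all add: cs_def image_image)
    then have "S = T" using cs by simp
    ultimately show "a = b" using a b by simp
  qed
  moreover have "(\<lambda>(G, S). foldr swap_at (cs G S) (str G)) ` \<F> \<subseteq> bridge_pairs (n + 2 * m)"
  proof
    fix z assume "z \<in> (\<lambda>(G, S). foldr swap_at (cs G S) (str G)) ` \<F>"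
    then obtain p where p: "p \<in> \<F>" "z = (case p of (G, S) \<Rightarrow> foldr swap_at (cs G S) (str G))"
      by (rule imageE)
    obtain G S where GS: "p = (G, S)" by fastforce
    then have G: "G \<in> X" "S \<subseteq> I G" "card S = m" and z: "z = foldr swap_at (cs G S) (str G)"
      using p by (simp_all add: \<F>_def)
    have "length (cs G S) = m" using G by (simp add: cs_def)
    then show "z \<in> bridge_pairs (n + 2 * m)"
      using swapped_in_bridge_pairs[OF st[OF G(1)] ch[OF G(1,2)]] by (simp add: z)
  qed
  ultimately have "card \<F> \<le> card (bridge_pairs (n + 2 * m))"
    using finite_bridge_pairs by (rule card_inj_on_le)
  moreover have "card \<F> = (\<Sum>G\<in>X. card (I G) choose m)"
    unfolding \<F>_def using finX finI by (simp add: n_subsets)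
  moreover have "(\<Sum>G\<in>X. k choose m) \<le> (\<Sum>G\<in>X. card (I G) choose m)"
  proof (intro sum_mono binomial_right_mono)
    fix G assume G: "G \<in> X"
    then have "k \<le> card (cuts G)" by (simp add: X_def)
    also have "\<dots> \<le> card (I G)"
      unfolding I_def using card_cuts_le[OF st[OF G]] str[OF G] by blast
    finally show "k \<le> card (I G)" .
  qed
  ultimately show ?thesis unfolding X_def[symmetric] by simp
qed

text \<open>Swapping at \<open>m\<close> cuts costs a factor \<open>\<mu> ^ (2 * m)\<close>. Giving
  every cut in the subset the weight \<open>1 / \<mu>\<^sup>2\<close> cancels it, and the binomial
  theorem sums the weights to a quantity that is exponential in \<open>k\<close>, whatever the value
  of \<open>\<mu>\<close>.\<close>

lemma many_cuts_rare:
  assumes "k \<le> n"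
  shows "real (card {G \<in> normal_polygons n. k \<le> card (cuts G)}) * (1 + 1 / \<mu>\<^sup>2) ^ k
    \<le> (real k + 1) * (6 * real n + 1) ^ 5 * \<mu> ^ (n + 2)"
proof -
  have mu: "\<mu> \<ge> 1" by (rule connective_constant_bounds)
  let ?c = "real (card {G \<in> normal_polygons n. k \<le> card (cuts G)})"
  have summand: "?c * (real (k choose m) * (1 / \<mu>\<^sup>2) ^ m) \<le> (6 * real n + 1) ^ 5 * \<mu> ^ (n + 2)"
    if "m \<le> k" for m
  proof -
    have "?c * real (k choose m) \<le> real (card (bridge_pairs (n + 2 * m)))"
      using many_cuts_choose[of n k m] by (simp only: of_nat_le_iff flip: of_nat_mult)
    also have "\<dots> \<le> (2 * real (n + 2 * m) + 1) ^ 5 * \<mu> ^ (n + 2 * m + 2)"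
      by (rule card_bridge_pairs)
    also have "\<dots> \<le> (6 * real n + 1) ^ 5 * \<mu> ^ (n + 2 * m + 2)"
      using that assms mu by (intro mult_right_mono power_mono) auto
    also have "\<mu> ^ (n + 2 * m + 2) = \<mu> ^ (n + 2) * (\<mu>\<^sup>2) ^ m"
      unfolding power_mult[symmetric] power_add[symmetric] by (rule arg_cong[of _ _ "(^) \<mu>"]) simp
    finally have "?c * real (k choose m) \<le> (6 * real n + 1) ^ 5 * \<mu> ^ (n + 2) * (\<mu>\<^sup>2) ^ m"
      by (simp only: mult.assoc)
    moreover have "(\<mu>\<^sup>2) ^ m > 0" using mu by simp
    ultimately have "?c * real (k choose m) / (\<mu>\<^sup>2) ^ m \<le> (6 * real n + 1) ^ 5 * \<mu> ^ (n + 2)"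
      by (simp add: pos_divide_le_eq)
    then show ?thesis by (simp add: power_divide)
  qed
  have "(1 + 1 / \<mu>\<^sup>2) ^ k = (\<Sum>m\<le>k. real (k choose m) * (1 / \<mu>\<^sup>2) ^ m)"
    using binomial_ring[of "1 / \<mu>\<^sup>2" 1 k] by (simp add: add.commute)
  then have "?c * (1 + 1 / \<mu>\<^sup>2) ^ k = (\<Sum>m\<le>k. ?c * (real (k choose m) * (1 / \<mu>\<^sup>2) ^ m))"
    by (simp only: sum_distrib_left)
  also have "\<dots> \<le> (\<Sum>m\<le>k. (6 * real n + 1) ^ 5 * \<mu> ^ (n + 2))"
    using summand by (intro sum_mono) auto
  finally show ?thesis by (simp add: mult.assoc add.commute)
qed

section \<open>Joining polygons by sliding\<close>

definition sym_diff_edges :: "'a set \<Rightarrow> 'a set \<Rightarrow> 'a set" where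
  "sym_diff_edges P Q = (P - Q) \<union> (Q - P)"

definition square :: "point \<Rightarrow> int \<Rightarrow> point set" where
  "square c R = {p. \<bar>fst p - fst c\<bar> \<le> R \<and> \<bar>snd p - snd c\<bar> \<le> R}"

section \<open>Growing a tip towards the other polygon\<close>

text \<open>A change of bounded extent that produces a vertical edge with a free view to the right
  in its two rows. It turns an arbitrary contact into one at which a plaquette join is
  possible.\<close>

definition tip :: "point set set \<Rightarrow> point set set \<Rightarrow> int \<Rightarrow> bool" where
  "tip P P' x \<longleftrightarrow> polygon P' \<and> {(x, 0), (x, -1)} \<in> P' \<and> sym_diff_edges P P' \<subseteq> Pow (square 0 3) \<and>
     \<Union>P' \<subseteq> \<Union>P \<union> {p. 0 < fst p \<and> fst p \<le> 3 \<and> \<bar>snd p\<bar> \<le> 1} \<and>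
     (\<forall>t>x. (t, 0) \<notin> \<Union>P' \<and> (t, -1) \<notin> \<Union>P')"

lemma sym_diff_replace:
  "sym_diff_edges P P' \<subseteq> S \<Longrightarrow> D \<subseteq> S \<Longrightarrow> E \<subseteq> S \<Longrightarrow> sym_diff_edges P (P' - D \<union> E) \<subseteq> S"
  by (auto simp: sym_diff_edges_def)

lemma sym_diff_self: "sym_diff_edges P P = {}"
  by (simp add: sym_diff_edges_def)

lemma tip_replace_edge:
  assumes P: "polygon P'" "{p, q} \<in> P'" and mid: "saw (p # mid @ [q])" "set mid \<inter> \<Union>P' = {}"
    and near: "sym_diff_edges P P' \<subseteq> Pow (square 0 3)" "set (p # mid @ [q]) \<subseteq> square 0 3"
    and V: "\<Union>P' \<subseteq> \<Union>P \<union> N" "set mid \<subseteq> N"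
    and N: "N = {p. 0 < fst p \<and> fst p \<le> 3 \<and> \<bar>snd p\<bar> \<le> 1}"
    and e: "{(x, 0), (x, -1)} \<in> path_edges (p # mid @ [q])"
    and free: "\<forall>t>x. (t, 0) \<notin> \<Union>P' \<union> set mid \<and> (t, -1) \<notin> \<Union>P' \<union> set mid"
  shows "tip P (P' - {{p, q}} \<union> path_edges (p # mid @ [q])) x"
proof -
  note r = replace_edge[OF P mid]
  have "path_edges (p # mid @ [q]) \<subseteq> Pow (square 0 3)"
    using path_edges_subset near(2) by blast
  moreover have "{{p, q}} \<subseteq> Pow (square 0 3)" using near(2) by simp
  ultimately have "sym_diff_edges P (P' - {{p, q}} \<union> path_edges (p # mid @ [q])) \<subseteq> Pow (square 0 3)"
    using near(1) by (intro sym_diff_replace)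
  moreover have "{(x, 0), (x, -1)} \<in> P' - {{p, q}} \<union> path_edges (p # mid @ [q])" using e by blast
  moreover have "\<Union>P' \<union> set mid \<subseteq> \<Union>P \<union> N" using V by blast
  ultimately show ?thesis using r(1) free unfolding tip_def r(2) N by blast
qed

text \<open>Pushes the end edge one column outwards. All tips are brought to column 3 in this way,
  so that the distance at contact is the same in every case.\<close>

lemma tip_extend:
  assumes "tip P P' x" "0 \<le> x" "x < 3"
  shows "\<exists>P''. tip P P'' (x + 1)"
proof -
  have t: "polygon P'" "{(x, 0), (x, -1)} \<in> P'" "sym_diff_edges P P' \<subseteq> Pow (square 0 3)"
    "\<Union>P' \<subseteq> \<Union>P \<union> {p. 0 < fst p \<and> fst p \<le> 3 \<and> \<bar>snd p\<bar> \<le> 1}"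
    and free: "\<And>t. t > x \<Longrightarrow> (t, 0) \<notin> \<Union>P' \<and> (t, -1) \<notin> \<Union>P'"
    using assms(1) unfolding tip_def by blast+
  have "tip P (P' - {{(x, 0), (x, -1)}} \<union> path_edges ((x, 0) # [(x + 1, 0), (x + 1, -1)] @ [(x, -1)])) (x + 1)"
  proof (rule tip_replace_edge[OF t(1,2) _ _ t(3) _ t(4) _ refl])
    show "saw ((x, 0) # [(x + 1, 0), (x + 1, - 1)] @ [(x, - 1)])"
      by (auto simp: saw_def adj_def)
    show "set [(x + 1, 0), (x + 1, - 1)] \<inter> \<Union>P' = {}" using free[of "x + 1"] by simp
    show "set ((x, 0) # [(x + 1, 0), (x + 1, - 1)] @ [(x, - 1)]) \<subseteq> square 0 3"
      using assms by (auto simp: square_def)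
    show "\<forall>t>x + 1. (t, 0) \<notin> \<Union>P' \<union> set [(x + 1, 0), (x + 1, - 1)] \<and>
        (t, - 1) \<notin> \<Union>P' \<union> set [(x + 1, 0), (x + 1, - 1)]"
    proof (intro allI impI)
      fix t assume "t > x + 1"
      then show "(t, 0) \<notin> \<Union>P' \<union> set [(x + 1, 0), (x + 1, - 1)] \<and>
        (t, - 1) \<notin> \<Union>P' \<union> set [(x + 1, 0), (x + 1, - 1)]" using free[of t] by simp
    qed
  qed (use assms in auto)
  then show ?thesis by blast
qed

text \<open>The origin may lack an edge downwards. A vertical edge between the rows 0 and -1 is then
  made by a detour through their free part, and the cases are the ways in which
  \<open>(1, 1)\<close> and \<open>(2, 1)\<close> can be occupied.\<close>

lemma ex_tip:
  assumes P: "polygon P" and 0: "(0, 0) \<in> \<Union>P"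
    and free: "\<And>t. t > 0 \<Longrightarrow> (t, 0) \<notin> \<Union>P \<and> (t, -1) \<notin> \<Union>P"
  shows "\<exists>P'. tip P P' 3"
proof -
  have two: "\<exists>p q. p \<noteq> q \<and> {v, p} \<in> P \<and> {v, q} \<in> P \<and> adj v p \<and> adj v q" if "v \<in> \<Union>P" for v
    using two_neighbours[OF P that] polygon_adj[OF P] by metis
  have inV: "p \<in> \<Union>P \<and> q \<in> \<Union>P" if "{p, q} \<in> P" for p q using that by blast
  have start: "sym_diff_edges P P \<subseteq> Pow (square 0 3)" by (simp add: sym_diff_self)
  have V0: "\<Union>P \<subseteq> \<Union>P \<union> {p. 0 < fst p \<and> fst p \<le> 3 \<and> \<bar>snd p\<bar> \<le> 1}" by blast
  have "\<exists>P'. tip P P' 0 \<or> tip P P' 2 \<or> tip P P' 3"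
  proof (cases "{(0, 0), (0, -1)} \<in> P")
    case True
    then have "tip P P 0" unfolding tip_def using P free start V0 by blast
    then show ?thesis by blast
  next
    case False
    obtain p q where pq: "p \<noteq> q" "{(0, 0), p} \<in> P" "{(0, 0), q} \<in> P" "adj (0, 0) p" "adj (0, 0) q"
      using two[OF 0] by blast
    have "p \<noteq> (1, 0)" "q \<noteq> (1, 0)" using inV[OF pq(2)] inV[OF pq(3)] free[of 1] by auto
    \<comment> \<open>With nothing on the right and no edge downwards, the neighbours are
      \<open>(-1, 0)\<close> and \<open>(0, 1)\<close>.\<close>
    then have e0: "{(0, 0), (0, 1)} \<in> P" using pq False by (auto simp: adj_iff)
    have n: "(1, 0) \<notin> \<Union>P" "(1, -1) \<notin> \<Union>P" "(2, 0) \<notin> \<Union>P" "(2, -1) \<notin> \<Union>P"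
      "(3, 0) \<notin> \<Union>P" "(3, -1) \<notin> \<Union>P"
      using free[of 1] free[of 2] free[of 3] by auto
    \<comment> \<open>An edge in row 1 above the free region can be lowered into it.\<close>
    have bump: "tip P (P - {{(x, 1), (x + 1, 1)}} \<union> path_edges ((x, 1) # [(x, 0), (x, -1), (x + 1, -1), (x + 1, 0)] @ [(x + 1, 1)])) (x + 1)"
      if "{(x, 1), (x + 1, 1)} \<in> P" "x = 1 \<or> x = 2" for x
    proof (rule tip_replace_edge[OF P that(1) _ _ start _ V0 _ refl])
      show "saw ((x, 1) # [(x, 0), (x, - 1), (x + 1, - 1), (x + 1, 0)] @ [(x + 1, 1)])"
        by (auto simp: saw_def adj_def)
      show "set [(x, 0), (x, - 1), (x + 1, - 1), (x + 1, 0)] \<inter> \<Union>P = {}"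
        using free[of x] free[of "x + 1"] that(2) by auto
      show "set ((x, 1) # [(x, 0), (x, - 1), (x + 1, - 1), (x + 1, 0)] @ [(x + 1, 1)]) \<subseteq> square 0 3"
        using that(2) by (auto simp: square_def)
      show "\<forall>t>x + 1. (t, 0) \<notin> \<Union>P \<union> set [(x, 0), (x, - 1), (x + 1, - 1), (x + 1, 0)] \<and>
        (t, - 1) \<notin> \<Union>P \<union> set [(x, 0), (x, - 1), (x + 1, - 1), (x + 1, 0)]"
      proof (intro allI impI)
        fix t assume "t > x + 1"
        then show "(t, 0) \<notin> \<Union>P \<union> set [(x, 0), (x, - 1), (x + 1, - 1), (x + 1, 0)] \<and>
        (t, - 1) \<notin> \<Union>P \<union> set [(x, 0), (x, - 1), (x + 1, - 1), (x + 1, 0)]"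
          using free[of t] that(2) by auto
      qed
    qed (use that(2) in \<open>auto simp: insert_commute\<close>)
    show ?thesis
    proof (cases "{(1, 1), (2, 1)} \<in> P \<or> {(2, 1), (3, 1)} \<in> P")
      case True
      then show ?thesis using bump[of 1] bump[of 2] by auto
    next
      case no: False
      \<comment> \<open>Otherwise \<open>(2, 2)\<close> would be its only possible
        neighbour.\<close>
      have n21: "(2, 1) \<notin> \<Union>P"
      proof
        assume "(2, 1) \<in> \<Union>P"
        then obtain p q where pq: "p \<noteq> q" "{(2, 1), p} \<in> P" "{(2, 1), q} \<in> P" "adj (2, 1) p" "adj (2, 1) q"
          using two by blast
        have "p \<noteq> (2, 0)" "q \<noteq> (2, 0)" using inV[OF pq(2)] inV[OF pq(3)] n by auto
        moreover have "p \<noteq> (1, 1)" "q \<noteq> (1, 1)" "p \<noteq> (3, 1)" "q \<noteq> (3, 1)"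
          using pq(2,3) no by (auto simp: insert_commute)
        ultimately show False using pq by (auto simp: adj_iff)
      qed
      have free2: "(t, 0) \<notin> \<Union>P \<and> (t, -1) \<notin> \<Union>P" if "t > 2" for t using free[of t] that by simp
      show ?thesis
      proof (cases "(1, 1) \<in> \<Union>P")
        case False
        have "tip P (P - {{(0, 0), (0, 1)}} \<union> path_edges ((0, 0) # [(1, 0), (1, -1), (2, -1), (2, 0), (2, 1), (1, 1)] @ [(0, 1)])) 2"
        proof (rule tip_replace_edge[OF P e0 _ _ start _ V0 _ refl])
          show "set [(1, 0), (1, - 1), (2, - 1), (2, 0), (2, 1), (1, 1)] \<inter> \<Union>P = {}"
            using n n21 False by auto
          show "\<forall>t>2. (t, 0) \<notin> \<Union>P \<union> set [(1, 0), (1, - 1), (2, - 1), (2, 0), (2, 1), (1, 1)] \<and>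
            (t, - 1) \<notin> \<Union>P \<union> set [(1, 0), (1, - 1), (2, - 1), (2, 0), (2, 1), (1, 1)]"
            using free2 by simp
        qed (auto simp: saw_def adj_def square_def insert_commute)
        then show ?thesis by blast
      next
        case True
        obtain p q where pq: "p \<noteq> q" "{(1, 1), p} \<in> P" "{(1, 1), q} \<in> P" "adj (1, 1) p" "adj (1, 1) q"
          using two[OF True] by blast
        have "p \<noteq> (1, 0)" "q \<noteq> (1, 0)" "p \<noteq> (2, 1)" "q \<noteq> (2, 1)"
          using inV[OF pq(2)] inV[OF pq(3)] n n21 by auto
        then have e1: "{(0, 1), (1, 1)} \<in> P" using pq by (auto simp: adj_iff insert_commute)
        \<comment> \<open>The vertex \<open>(1, 1)\<close> blocks the detour of the previous case.
          Moving the corner \<open>(0, 1)\<close> to \<open>(1, 0)\<close> yields an edge from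
          \<open>(1, 0)\<close> to \<open>(1, 1)\<close>, which borders the free region and can be
          replaced instead.\<close>
        define P1 where "P1 = P - {{(0, 0), (0, 1)}, {(0, 1), (1, 1)}} \<union> {{(0, 0), (1, 0)}, {(1, 0), (1, 1)}}"
        have fl: "polygon P1" "\<Union>P1 = insert (1, 0) (\<Union>P - {(0, 1)})"
          using flip_corner[OF P e0 e1, of "(1, 0)"] n by (simp_all add: P1_def adj_def)
        have "tip P (P1 - {{(1, 0), (1, 1)}} \<union> path_edges ((1, 0) # [(1, -1), (2, -1), (2, 0), (2, 1)] @ [(1, 1)])) 2"
        proof (rule tip_replace_edge[OF fl(1) _ _ _ _ _ _ _ refl])
          show "{(1, 0), (1, 1)} \<in> P1" by (simp add: P1_def)
          show "set [(1, - 1), (2, - 1), (2, 0), (2, 1)] \<inter> \<Union>P1 = {}"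
            unfolding fl(2) using n n21 by auto
          show "sym_diff_edges P P1 \<subseteq> Pow (square 0 3)"
            unfolding P1_def by (rule sym_diff_replace[OF start]) (auto simp: square_def)
          show "\<Union>P1 \<subseteq> \<Union>P \<union> {p. 0 < fst p \<and> fst p \<le> 3 \<and> \<bar>snd p\<bar> \<le> 1}"
            unfolding fl(2) by auto
          show "\<forall>t>2. (t, 0) \<notin> \<Union>P1 \<union> set [(1, - 1), (2, - 1), (2, 0), (2, 1)] \<and>
            (t, - 1) \<notin> \<Union>P1 \<union> set [(1, - 1), (2, - 1), (2, 0), (2, 1)]"
            unfolding fl(2) using free2 by simp
        qed (auto simp: saw_def adj_def square_def insert_commute)
        then show ?thesis by blast
      qed
    qed
  qed
  then obtain P' where "tip P P' 0 \<or> tip P P' 2 \<or> tip P P' 3" by blast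
  moreover have "tip P Q 2 \<Longrightarrow> \<exists>P'. tip P P' 3" for Q using tip_extend[of P Q 2] by simp
  moreover have "tip P Q 1 \<Longrightarrow> \<exists>P'. tip P P' 2" for Q using tip_extend[of P Q 1] by simp
  moreover have "tip P Q 0 \<Longrightarrow> \<exists>P'. tip P P' 1" for Q using tip_extend[of P Q 0] by simp
  ultimately show ?thesis by blast
qed

text \<open>The signs reflect the picture: one polygon grows to the right and the other to the left,
  and the second row of a tip may lie below or above the contact vertex.\<close>

lemma ex_tip_oriented:
  fixes sx sy cx cy :: int
  assumes P: "polygon P" and s: "sx \<in> {1, -1}" "sy \<in> {1, -1}" and c: "(cx, cy) \<in> \<Union>P"
    and free: "\<And>p. p \<in> \<Union>P \<Longrightarrow> snd p = cy \<or> snd p = cy - sy \<Longrightarrow> sx * (fst p - cx) \<le> 0"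
  obtains P' where "polygon P'" "{(cx + 3 * sx, cy), (cx + 3 * sx, cy - sy)} \<in> P'"
    "sym_diff_edges P P' \<subseteq> Pow (square (cx, cy) 3)"
    "\<forall>p\<in>\<Union>P'. p \<in> \<Union>P \<or> 0 < sx * (fst p - cx) \<and> sx * (fst p - cx) \<le> 3 \<and> \<bar>snd p - cy\<bar> \<le> 1"
proof -
  define T where "T p = (cx + sx * fst p, cy + sy * snd p)" for p :: point
  define T' where "T' p = (sx * (fst p - cx), sy * (snd p - cy))" for p :: point
  have inv: "T (T' p) = p" "T' (T p) = p" for p
    using s by (auto simp: T_def T'_def prod_eq_iff)
  have inj: "inj T" "inj T'" using inv by (metis injI)+
  have adj: "adj p q \<Longrightarrow> adj (T p) (T q)" "adj p q \<Longrightarrow> adj (T' p) (T' q)" for p q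
    using s by (auto simp: T_def T'_def adj_def)
  define P0 where "P0 = (`) T' ` P"
  have P0: "polygon P0" unfolding P0_def by (rule polygon_image[OF inj(2) adj(2) P])
  have V0: "\<Union>P0 = T' ` \<Union>P" unfolding P0_def by (rule Union_image_image)
  have TP0: "(`) T ` P0 = P" unfolding P0_def image_image inv by simp
  have "T' (cx, cy) = (0, 0)" by (simp add: T'_def)
  then have "(0, 0) \<in> \<Union>P0" unfolding V0 using c by (metis imageI)
  moreover have "(t, 0) \<notin> \<Union>P0 \<and> (t, -1) \<notin> \<Union>P0" if t: "t > 0" for t
  proof -
    have "False" if "q \<in> \<Union>P" "T' q = (t, b)" "b = 0 \<or> b = -1" for q b
    proof -
      have "q = T (t, b)" using that inv(1)[of q] by simp
      then have "sx * (fst q - cx) = t" "snd q = cy \<or> snd q = cy - sy"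
        using s that by (auto simp: T_def)
      then show False using free[OF that(1)] t by simp
    qed
    then show ?thesis unfolding V0 by (metis imageE)
  qed
  ultimately obtain P1 where "tip P0 P1 3" using ex_tip[OF P0] by blast
  then have t: "polygon P1" "{(3, 0), (3, -1)} \<in> P1" "sym_diff_edges P0 P1 \<subseteq> Pow (square 0 3)"
    "\<Union>P1 \<subseteq> \<Union>P0 \<union> {p. 0 < fst p \<and> fst p \<le> 3 \<and> \<bar>snd p\<bar> \<le> 1}"
    unfolding tip_def by blast+
  define P' where "P' = (`) T ` P1"
  show thesis
  proof (rule that)
    show "polygon P'" unfolding P'_def by (rule polygon_image[OF inj(1) adj(1) t(1)])
    have "T ` {(3, 0), (3, -1)} = {(cx + 3 * sx, cy), (cx + 3 * sx, cy - sy)}"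
      by (simp add: T_def mult.commute)
    then show "{(cx + 3 * sx, cy), (cx + 3 * sx, cy - sy)} \<in> P'"
      unfolding P'_def using t(2) by (metis imageI)
    have eq: "sym_diff_edges P P' = (`) T ` sym_diff_edges P0 P1"
    proof -
      have i: "inj ((`) T)" using inj(1) by (simp add: inj_on_image inj_image_eq_iff inj_def)
      show ?thesis unfolding sym_diff_edges_def image_Un image_set_diff[OF i] TP0 P'_def ..
    qed
    have Tb: "T ` square 0 3 \<subseteq> square (cx, cy) 3"
      using s by (auto simp: T_def square_def)
    show "sym_diff_edges P P' \<subseteq> Pow (square (cx, cy) 3)"
    proof
      fix e assume "e \<in> sym_diff_edges P P'"
      then obtain f where f: "f \<in> sym_diff_edges P0 P1" "e = T ` f" unfolding eq by blast
      then have "f \<subseteq> square 0 3" using t(3) by (metis PowD subsetD)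
      then have "e \<subseteq> T ` square 0 3" unfolding f(2) by (rule image_mono)
      then show "e \<in> Pow (square (cx, cy) 3)" using Tb by simp
    qed
    show "\<forall>p\<in>\<Union>P'. p \<in> \<Union>P \<or> 0 < sx * (fst p - cx) \<and> sx * (fst p - cx) \<le> 3 \<and> \<bar>snd p - cy\<bar> \<le> 1"
    proof
    fix p assume "p \<in> \<Union>P'"
    then obtain q where q: "q \<in> \<Union>P1" "p = T q" unfolding P'_def Union_image_image by blast
    show "p \<in> \<Union>P \<or> 0 < sx * (fst p - cx) \<and> sx * (fst p - cx) \<le> 3 \<and> \<bar>snd p - cy\<bar> \<le> 1"
    proof (cases "q \<in> \<Union>P0")
      case True
      then have "p \<in> \<Union>P" using q(2) inv(1) unfolding V0 by auto
      then show ?thesis ..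
    next
      case False
      then have "0 < fst q \<and> fst q \<le> 3 \<and> \<bar>snd q\<bar> \<le> 1" using q(1) t(4) by blast
      then have "0 < sx * (fst p - cx) \<and> sx * (fst p - cx) \<le> 3 \<and> \<bar>snd p - cy\<bar> \<le> 1"
        using s q(2) by (auto simp: T_def)
      then show ?thesis ..
    qed
    qed
  qed
qed

section \<open>The join at the contact\<close>

lemma square_mono: "\<bar>fst c - fst d\<bar> + R \<le> S \<Longrightarrow> \<bar>snd c - snd d\<bar> + R \<le> S \<Longrightarrow> square c R \<subseteq> square d S"
  by (auto simp: square_def)

text \<open>Both polygons are modified near the contact. The modifications stay apart because a horizontal
  gap of at least \<open>7\<close> is kept even between vertices in neighbouring rows.\<close>

lemma contact_join:
  assumes A: "polygon A" and B: "polygon B"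
    and gap: "\<And>a b. a \<in> \<Union>A \<Longrightarrow> b \<in> \<Union>B \<Longrightarrow> \<bar>snd a - snd b\<bar> \<le> 1 \<Longrightarrow> fst a + 7 \<le> fst b"
    and ab: "a \<in> \<Union>A" "b \<in> \<Union>B" "\<bar>snd a - snd b\<bar> \<le> 1" "fst b = fst a + 7"
  obtains x y P Q where "polygon P" "polygon Q" "{(x, y), (x, y - 1)} \<in> P"
    "{(x + 1, y), (x + 1, y - 1)} \<in> Q"
    "\<forall>p\<in>\<Union>P. \<forall>q\<in>\<Union>Q. snd p = snd q \<longrightarrow> fst p < fst q"
    "sym_diff_edges A P \<subseteq> Pow (square (x, y) 8)" "sym_diff_edges B Q \<subseteq> Pow (square (x, y) 8)"
    "\<forall>p\<in>\<Union>P. p \<in> \<Union>A \<or> \<bar>snd p - snd a\<bar> \<le> 1"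
    "\<forall>q\<in>\<Union>Q. q \<in> \<Union>B \<or> \<bar>snd q - snd b\<bar> \<le> 1" "y = max (snd a) (snd b)"
proof -
  obtain ax ay where a: "a = (ax, ay)" by fastforce
  obtain bx by' where b: "b = (bx, by')" by fastforce
  \<comment> \<open>The plaquette occupies the rows \<open>y - 1\<close> and \<open>y\<close>, which
    contain both contact vertices; \<open>sa\<close> and \<open>sb\<close> make the second row of
    each tip the other one of these. The distance 7 is \<open>3 + 1 + 3\<close>: two tips and the
    width of the plaquette.\<close>
  define y where "y = max ay by'"
  define sa where "sa = (if ay = y then 1 else -1 :: int)"
  define sb where "sb = (if by' = y then 1 else -1 :: int)"
  have bx: "bx = ax + 7" using ab a b by simp
  have ra: "ay = y \<and> sa = 1 \<or> ay = y - 1 \<and> sa = -1" and rb: "by' = y \<and> sb = 1 \<or> by' = y - 1 \<and> sb = -1"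
    using ab(3) by (auto simp: a b y_def sa_def sb_def)
  have fa: "1 * (fst p - ax) \<le> 0" if "p \<in> \<Union>A" "snd p = ay \<or> snd p = ay - sa" for p
  proof -
    have "\<bar>snd p - snd b\<bar> \<le> 1" using that(2) ra rb b by auto
    then show ?thesis using gap[OF that(1) ab(2)] b bx by simp
  qed
  have fb: "- 1 * (fst p - bx) \<le> 0" if "p \<in> \<Union>B" "snd p = by' \<or> snd p = by' - sb" for p
  proof -
    have "\<bar>snd a - snd p\<bar> \<le> 1" using that(2) ra rb a by auto
    then show ?thesis using gap[OF ab(1) that(1)] a bx by simp
  qed
  have sg: "(1 :: int) \<in> {1, -1}" "(-1 :: int) \<in> {1, -1}" "sa \<in> {1, -1}" "sb \<in> {1, -1}"
    by (auto simp: sa_def sb_def)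
  obtain P where P: "polygon P" "{(ax + 3 * 1, ay), (ax + 3 * 1, ay - sa)} \<in> P"
    "sym_diff_edges A P \<subseteq> Pow (square (ax, ay) 3)"
    "\<forall>p\<in>\<Union>P. p \<in> \<Union>A \<or> 0 < 1 * (fst p - ax) \<and> 1 * (fst p - ax) \<le> 3 \<and> \<bar>snd p - ay\<bar> \<le> 1"
    using ex_tip_oriented[OF A sg(1,3) ab(1)[unfolded a] fa] .
  obtain Q where Q: "polygon Q" "{(bx + 3 * -1, by'), (bx + 3 * -1, by' - sb)} \<in> Q"
    "sym_diff_edges B Q \<subseteq> Pow (square (bx, by') 3)"
    "\<forall>p\<in>\<Union>Q. p \<in> \<Union>B \<or> 0 < -1 * (fst p - bx) \<and> -1 * (fst p - bx) \<le> 3 \<and> \<bar>snd p - by'\<bar> \<le> 1"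
    using ex_tip_oriented[OF B sg(2,4) ab(2)[unfolded b] fb] .
  show thesis
  proof (rule that[of P Q "ax + 3" y])
    show "{(ax + 3, y), (ax + 3, y - 1)} \<in> P"
      using P(2) ra by (auto simp: insert_commute)
    show "{(ax + 3 + 1, y), (ax + 3 + 1, y - 1)} \<in> Q"
      using Q(2) rb bx by (auto simp: insert_commute)
    \<comment> \<open>The centre is 3 columns from \<open>a\<close>, 4 columns from \<open>b\<close>
      and at most one row from either, so radius 8 covers both changes.\<close>
    have "square (ax, ay) 3 \<subseteq> square (ax + 3, y) 8" "square (bx, by') 3 \<subseteq> square (ax + 3, y) 8"
      by (rule square_mono; use ra rb bx in auto)+
    then show "sym_diff_edges A P \<subseteq> Pow (square (ax + 3, y) 8)" "sym_diff_edges B Q \<subseteq> Pow (square (ax + 3, y) 8)"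
      using P(3) Q(3) by (meson Pow_mono subset_trans)+
    show "\<forall>p\<in>\<Union>P. \<forall>q\<in>\<Union>Q. snd p = snd q \<longrightarrow> fst p < fst q"
    proof (intro ballI impI)
      fix p q assume pq: "p \<in> \<Union>P" "q \<in> \<Union>Q" "snd p = snd q"
      have p: "p \<in> \<Union>A \<or> fst p \<le> ax + 3 \<and> \<bar>snd p - ay\<bar> \<le> 1" using P(4)[rule_format, OF pq(1)] by auto
      have q: "q \<in> \<Union>B \<or> ax + 4 \<le> fst q \<and> \<bar>snd q - by'\<bar> \<le> 1" using Q(4)[rule_format, OF pq(2)] bx by auto
      consider "p \<in> \<Union>A" "q \<in> \<Union>B" | "p \<in> \<Union>A" "ax + 4 \<le> fst q" "\<bar>snd q - by'\<bar> \<le> 1"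
        | "q \<in> \<Union>B" "fst p \<le> ax + 3" "\<bar>snd p - ay\<bar> \<le> 1" | "fst p \<le> ax + 3" "ax + 4 \<le> fst q"
        using p q by blast
      then show "fst p < fst q"
      proof cases
        case 1
        then show ?thesis using gap[OF 1] pq(3) by simp
      next
        case 2
        then show ?thesis using gap[OF 2(1) ab(2)] pq(3) b bx by simp
      next
        case 3
        then have "\<bar>snd a - snd q\<bar> \<le> 1" using pq(3) a by auto
        from gap[OF ab(1) 3(1) this] show ?thesis using 3 a by simp
      qed simp
    qed
    show "\<forall>p\<in>\<Union>P. p \<in> \<Union>A \<or> \<bar>snd p - snd a\<bar> \<le> 1"
    proof
      fix p assume "p \<in> \<Union>P"
      from P(4)[rule_format, OF this] show "p \<in> \<Union>A \<or> \<bar>snd p - snd a\<bar> \<le> 1" using a by auto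
    qed
    show "\<forall>q\<in>\<Union>Q. q \<in> \<Union>B \<or> \<bar>snd q - snd b\<bar> \<le> 1"
    proof
      fix q assume "q \<in> \<Union>Q"
      from Q(4)[rule_format, OF this] show "q \<in> \<Union>B \<or> \<bar>snd q - snd b\<bar> \<le> 1" using b by auto
    qed
    show "y = max (snd a) (snd b)" by (simp add: y_def a b)
  qed (rule P(1) Q(1))+
qed

lemma polygon_rows:
  assumes P: "polygon P" and "p \<in> \<Union>P" "q \<in> \<Union>P" "snd p \<le> r" "r \<le> snd q"
  obtains z where "z \<in> \<Union>P" "snd z = r"
proof -
  obtain ys where ys: "cycle (p # ys)" "P = cycle_edges (p # ys)"
    using polygon_start_at[OF assms(1,2)] .
  have V: "\<Union>P = set (p # ys)" using ys Union_cycle_edges by blast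
  then obtain k where k: "k < length (p # ys)" "(p # ys) ! k = q"
    using assms(3) by (metis in_set_conv_nth)
  have "saw (p # ys)" using ys by (simp add: cycle_def)
  then obtain l where "l \<le> k" "snd ((p # ys) ! l) = r"
    using walk_intermediate_row[of "p # ys" 0 k r] k assms(4,5) by auto
  then show thesis using that[of "(p # ys) ! l"] V k(1) by (metis le_less_trans nth_mem)
qed

text \<open>A vertex away from the changes keeps all its edges. This is how the origin and a highest
  vertex survive the modification.\<close>

lemma vertex_outside_square:
  assumes "sym_diff_edges P Q \<subseteq> Pow S" "p \<in> \<Union>P" "p \<notin> S"
  shows "p \<in> \<Union>Q"
proof -
  obtain e where e: "e \<in> P" "p \<in> e" using assms(2) by blast
  have "e \<in> Q"
  proof (rule ccontr)
    assume "e \<notin> Q"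
    then have "e \<in> sym_diff_edges P Q" using e by (simp add: sym_diff_edges_def)
    then show False using assms(1,3) e(2) by blast
  qed
  then show ?thesis using e by blast
qed

definition height :: "point set set \<Rightarrow> int" where
  "height P = Max (snd ` \<Union>P)"

lemma height_ge: "polygon P \<Longrightarrow> p \<in> \<Union>P \<Longrightarrow> snd p \<le> height P"
  unfolding height_def by (intro Max_ge) (auto simp: finite_vertices)

lemma height_attained:
  assumes "polygon P"
  obtains p where "p \<in> \<Union>P" "snd p = height P"
proof -
  have "height P \<in> snd ` \<Union>P"
    unfolding height_def using assms finite_vertices polygon_ne by (intro Max_in) auto
  then show thesis
  proof (rule imageE)
    fix p assume "height P = snd p" "p \<in> \<Union>P"
    then show thesis using that[of p] by simp
  qed
qed

text \<open>\<open>B\<close> is lifted by \<open>s\<close> and brought in from the right until it is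
  as close to \<open>A\<close> as the gap allows. The margins of 12 exceed the radius 8 of the
  changes even after an offset by a row; they keep the origin in \<open>P\<close> and the top of
  \<open>B\<close> in \<open>Q\<close>, above all of \<open>P\<close>, as a global cut
  demands.\<close>

lemma slide_join:
  assumes A: "A \<in> normal_polygons j" and B: "B \<in> normal_polygons k"
    and s: "12 \<le> s" "s \<le> height A" "height A + 12 \<le> s + height B"
  obtains t G x y P Q where "global_cut G x y P Q" "normalized G"
    "sym_diff_edges A P \<subseteq> Pow (square (x, y) 8)"
    "sym_diff_edges (translate (t, s) B) Q \<subseteq> Pow (square (x, y) 8)"
proof -
  have pA: "polygon A" "0 \<in> \<Union>A" "\<And>p. p \<in> \<Union>A \<Longrightarrow> 0 < snd p \<or> snd p = 0 \<and> 0 \<le> fst p"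
    using A unfolding normal_polygons_def normalized_def by blast+
  have pB: "polygon B" "0 \<in> \<Union>B" "\<And>p. p \<in> \<Union>B \<Longrightarrow> 0 < snd p \<or> snd p = 0 \<and> 0 \<le> fst p"
    using B unfolding normal_polygons_def normalized_def by blast+
  \<comment> \<open>Horizontal offsets of vertices that are in equal or neighbouring rows after
    lifting. Thus \<open>Max Z + 7\<close> is the least shift that leaves the gap 7 everywhere, and
    the gap is exactly 7 for some pair.\<close>
  define Z where "Z = (\<lambda>(a, b). fst a - fst b) ` {(a, b) \<in> \<Union>A \<times> \<Union>B. \<bar>snd a - (snd b + s)\<bar> \<le> 1}"
  have finZ: "finite Z" unfolding Z_def
    by (rule finite_imageI, rule finite_subset[of _ "\<Union>A \<times> \<Union>B"]) (use pA(1) pB(1) finite_vertices in auto)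
  obtain top where top: "top \<in> \<Union>A" "snd top = height A" using height_attained[OF pA(1)] .
  have sr: "snd (0 :: point) \<le> s" "s \<le> snd top" using s top by auto
  obtain z where z: "z \<in> \<Union>A" "snd z = s"
    using polygon_rows[OF pA(1,2) top(1) sr] .
  have "fst z - fst (0 :: point) \<in> Z" unfolding Z_def
    by (rule image_eqI[of _ _ "(z, 0)"]) (use z pB in auto)
  then have neZ: "Z \<noteq> {}" by blast
  define t where "t = Max Z + 7"
  define B' where "B' = translate (t, s) B"
  have B': "polygon B'" unfolding B'_def by (rule polygon_translate[OF pB(1)])
  have VB': "\<Union>B' = (+) (t, s) ` \<Union>B" unfolding B'_def by (rule Union_translate)
  have gap: "fst a + 7 \<le> fst b" if h: "a \<in> \<Union>A" "b \<in> \<Union>B'" "\<bar>snd a - snd b\<bar> \<le> 1" for a b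
  proof -
    obtain c where c: "c \<in> \<Union>B" "b = (t, s) + c" using h(2) unfolding VB' by blast
    have "fst a - fst c \<in> Z" unfolding Z_def
      by (rule image_eqI[of _ _ "(a, c)"]) (use h c in \<open>auto simp: add.commute\<close>)
    then have "fst a - fst c \<le> Max Z" using finZ by simp
    then show ?thesis using c(2) by (simp add: t_def)
  qed
  have "Max Z \<in> Z" using finZ neZ by simp
  then obtain d where d: "d \<in> {(a, b) \<in> \<Union>A \<times> \<Union>B. \<bar>snd a - (snd b + s)\<bar> \<le> 1}"
    "Max Z = (case d of (a, b) \<Rightarrow> fst a - fst b)" unfolding Z_def by (rule imageE)
  obtain a c where "d = (a, c)" by (cases d)
  then have ac: "a \<in> \<Union>A" "c \<in> \<Union>B" "\<bar>snd a - (snd c + s)\<bar> \<le> 1" "Max Z = fst a - fst c"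
    using d by simp_all
  define b where "b = (t, s) + c"
  have b: "b \<in> \<Union>B'" "\<bar>snd a - snd b\<bar> \<le> 1" "fst b = fst a + 7"
    using ac unfolding VB' b_def by (auto simp: t_def add.commute)
  obtain x y P Q where J: "polygon P" "polygon Q" "{(x, y), (x, y - 1)} \<in> P"
    "{(x + 1, y), (x + 1, y - 1)} \<in> Q"
    "\<forall>p\<in>\<Union>P. \<forall>q\<in>\<Union>Q. snd p = snd q \<longrightarrow> fst p < fst q"
    "sym_diff_edges A P \<subseteq> Pow (square (x, y) 8)" "sym_diff_edges B' Q \<subseteq> Pow (square (x, y) 8)"
    "\<forall>p\<in>\<Union>P. p \<in> \<Union>A \<or> \<bar>snd p - snd a\<bar> \<le> 1"
    "\<forall>q\<in>\<Union>Q. q \<in> \<Union>B' \<or> \<bar>snd q - snd b\<bar> \<le> 1" "y = max (snd a) (snd b)"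
    using contact_join[OF pA(1) B' gap ac(1) b] .
  note VP = J(8)[rule_format] and VQ = J(9)[rule_format] and y = J(10)
  have rowB: "s \<le> snd q" if q: "q \<in> \<Union>B'" for q
  proof -
    obtain c where "c \<in> \<Union>B" "q = (t, s) + c" using q unfolding VB' by blast
    then show ?thesis using pB(3)[of c] by auto
  qed
  have rows: "s \<le> snd b" "snd a \<le> height A" using rowB[OF b(1)] height_ge[OF pA(1) ac(1)] by auto
  have rowP: "snd p \<le> height A + 1" if "p \<in> \<Union>P" for p
    using VP[OF that]
  proof
    assume "p \<in> \<Union>A"
    from height_ge[OF pA(1) this] show ?thesis by simp
  qed (use rows in auto)
  have rowQ: "0 < snd q" if "q \<in> \<Union>Q" for q
    using VQ[OF that]
  proof
    assume "q \<in> \<Union>B'"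
    from rowB[OF this] show ?thesis using s by simp
  qed (use rows s in auto)
  have disj: "\<Union>P \<inter> \<Union>Q = {}" using J(5) by force
  define G where "G = plaquette_join P Q x y"
  have VG: "\<Union>G = \<Union>P \<union> \<Union>Q" unfolding G_def by (rule plaquette_join(3)[OF J(1,3,2,4) disj])
  obtain u where u: "u \<in> \<Union>B" "snd u = height B" using height_attained[OF pB(1)] .
  have "(t, s) + u \<in> \<Union>B'" unfolding VB' using u by blast
  moreover have "(t, s) + u \<notin> square (x, y) 8"
    using u s rows y b(2) by (auto simp: square_def)
  ultimately have topQ: "(t, s) + u \<in> \<Union>Q" by (rule vertex_outside_square[OF J(7)])
  have "\<forall>p\<in>\<Union>P. snd p < snd ((t, s) + u)" using rowP u s by fastforce
  then have ex: "\<exists>q\<in>\<Union>Q. \<forall>p\<in>\<Union>P. snd p < snd q" using topQ by (rule bexI)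
  have y1: "1 < y" using y rows s by simp
  have all: "\<forall>q\<in>\<Union>Q. 0 < snd q" using rowQ by (rule ballI)
  have gc: "global_cut G x y P Q"
    unfolding global_cut_def by (intro conjI J(1-5) disj G_def all ex y1)
  have nG: "normalized G"
    unfolding normalized_def
  proof (intro conjI ballI)
    have "0 \<notin> square (x, y) 8" using y rows s by (auto simp: square_def)
    then have "0 \<in> \<Union>P" by (rule vertex_outside_square[OF J(6) pA(2)])
    then show "0 \<in> \<Union>G" unfolding VG by (rule UnI1)
    fix p assume "p \<in> \<Union>G"
    then have "p \<in> \<Union>P \<or> p \<in> \<Union>Q" unfolding VG by (rule UnE) (rule disjI1, assumption, rule disjI2, assumption)
    then consider "p \<in> \<Union>A" | "\<bar>snd p - snd a\<bar> \<le> 1" | "p \<in> \<Union>Q" using VP[of p] by argo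
    then show "0 < snd p \<or> snd p = 0 \<and> 0 \<le> fst p"
    proof cases
      case 1
      then show ?thesis by (rule pA(3))
    next
      case 2
      then show ?thesis using rows s b(2) by auto
    next
      case 3
      then show ?thesis using rowQ[of p] by simp
    qed
  qed
  show thesis by (rule that[OF gc nG J(6) J(7)[unfolded B'_def]])
qed

section \<open>Tall polygons\<close>

definition tall :: "nat \<Rightarrow> point set set set" where
  "tall n = {P \<in> normal_polygons n. int n \<le> (height P + 1)\<^sup>2}"

lemma height_nonneg: "P \<in> normal_polygons n \<Longrightarrow> 0 \<le> height P"
  using height_ge[of P 0] by (auto simp: normal_polygons_def normalized_def)

lemma card_le_width_height:
  assumes P: "P \<in> normal_polygons n" and Q: "Q \<in> normal_polygons n"
    and t: "Q = translate v ((`) prod.swap ` P)"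
  shows "int n \<le> (height Q + 1) * (height P + 1)"
proof -
  have pP: "polygon P" "card P = n" "\<And>p. p \<in> \<Union>P \<Longrightarrow> 0 \<le> snd p"
    using P unfolding normal_polygons_def normalized_def by fastforce+
  have pQ: "polygon Q" "\<And>p. p \<in> \<Union>Q \<Longrightarrow> 0 \<le> snd p"
    using Q unfolding normal_polygons_def normalized_def by fastforce+
  have VQ: "\<Union>Q = (+) v ` prod.swap ` \<Union>P" unfolding t Union_translate Union_image_image ..
  have "\<Union>P \<subseteq> {- snd v..height Q - snd v} \<times> {0..height P}"
  proof
    fix p assume p: "p \<in> \<Union>P"
    then have "v + prod.swap p \<in> \<Union>Q" unfolding VQ by (intro imageI)
    then have "0 \<le> snd (v + prod.swap p)" "snd (v + prod.swap p) \<le> height Q"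
      using pQ(2) height_ge[OF pQ(1)] by blast+
    moreover have "0 \<le> snd p" "snd p \<le> height P" using p pP(3) height_ge[OF pP(1)] by blast+
    ultimately show "p \<in> {- snd v..height Q - snd v} \<times> {0..height P}"
      by (cases p) auto
  qed
  then have "card (\<Union>P) \<le> card ({- snd v..height Q - snd v} \<times> {0..height P})"
    by (intro card_mono) auto
  then have "n \<le> nat (height Q + 1) * nat (height P + 1)"
    using card_vertices[OF pP(1)] pP(2) by (simp add: card_cartesian_product)
  then have "int n \<le> int (nat (height Q + 1) * nat (height P + 1))" by (simp only: of_nat_le_iff)
  then show ?thesis using height_nonneg[OF P] height_nonneg[OF Q] by simp
qed

text \<open>Transposition maps the other polygons injectively to tall ones: the \<open>n\<close>
  vertices fit into a box whose sides are the numbers of rows of the polygon and of its transpose,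
  so one of these is at least the square root of \<open>n\<close>.\<close>

lemma pcount_le_tall: "pcount n \<le> 2 * card (tall n)"
proof -
  have fin: "finite (tall n)" using finite_normal_polygons by (simp add: tall_def)
  have sub: "tall n \<subseteq> normal_polygons n" by (auto simp: tall_def)
  have swap: "inj (prod.swap :: point \<Rightarrow> point)" by (simp add: inj_def)
  have adj_swap: "adj (prod.swap p) (prod.swap q)" if "adj p q" for p q
    using that by (auto simp: adj_def)
  have "card (normal_polygons n - tall n) \<le> card (tall n)"
  proof (rule card_le_by_relation[where R = "\<lambda>P Q. \<exists>v. Q = translate v ((`) prod.swap ` P)"])
    fix P assume P: "P \<in> normal_polygons n - tall n"
    then have pP: "polygon P" "card P = n" by (auto simp: normal_polygons_def)
    have sP: "polygon ((`) prod.swap ` P)"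
      using polygon_image[OF swap adj_swap pP(1)] .
    obtain v where v: "normalized (translate v ((`) prod.swap ` P))" using ex_normalized[OF sP] .
    define Q where "Q = translate v ((`) prod.swap ` P)"
    have Q: "Q \<in> normal_polygons n"
      using v sP pP by (simp add: normal_polygons_def Q_def polygon_translate card_image_image[OF swap])
    have P': "P \<in> normal_polygons n" using P by blast
    have le: "int n \<le> (height Q + 1) * (height P + 1)" by (rule card_le_width_height[OF P' Q Q_def])
    have less: "(height P + 1)\<^sup>2 < int n" using P by (auto simp: tall_def)
    have h: "0 \<le> height P" "0 \<le> height Q" using height_nonneg P' Q by blast+
    have "int n \<le> (height Q + 1)\<^sup>2"
    proof (cases "height P \<le> height Q")
      case True
      then have "(height Q + 1) * (height P + 1) \<le> (height Q + 1) * (height Q + 1)"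
        using h by (intro mult_left_mono) auto
      then show ?thesis using le by (simp add: power2_eq_square)
    next
      case False
      then have "(height Q + 1) * (height P + 1) \<le> (height P + 1) * (height P + 1)"
        using h by (intro mult_right_mono) auto
      then show ?thesis using le less by (simp add: power2_eq_square)
    qed
    then have "Q \<in> tall n" using Q by (simp add: tall_def)
    then show "\<exists>Q\<in>tall n. \<exists>v. Q = translate v ((`) prod.swap ` P)" using Q_def by blast
  next
    fix P P' Q
    assume P: "P \<in> normal_polygons n - tall n" "P' \<in> normal_polygons n - tall n"
      and "\<exists>v. Q = translate v ((`) prod.swap ` P)" "\<exists>v. Q = translate v ((`) prod.swap ` P')"
    then obtain v v' where v: "Q = translate v ((`) prod.swap ` P)" "Q = translate v' ((`) prod.swap ` P')"
      by blast
    have *: "(`) prod.swap ` translate u ((`) prod.swap ` S) = translate (prod.swap u) S" for u and S :: "point set set"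
      unfolding translate_def image_image by (intro image_cong) (auto simp: image_image plus_prod_def)
    have "translate (prod.swap v) P = translate (prod.swap v') P'"
      using v unfolding *[symmetric] by simp
    then show "P = P'" using normalized_eq P by (auto simp: normal_polygons_def)
  qed (rule fin)
  moreover have "card (normal_polygons n - tall n) = card (normal_polygons n) - card (tall n)"
    using fin sub by (rule card_Diff_subset)
  ultimately show ?thesis unfolding pcount_def by linarith
qed

section \<open>Counting the joins\<close>

lemma finite_cuts:
  assumes "polygon G"
  shows "finite (cuts G)"
proof (rule finite_subset)
  let ?V = "\<Union>G"
  show "cuts G \<subseteq> (fst ` ?V) \<times> (snd ` ?V) \<times> Pow (Pow ?V) \<times> Pow (Pow ?V)"
  proof
    fix c assume "c \<in> cuts G"
    then obtain x y P Q where c: "c = (x, y, P, Q)" "global_cut G x y P Q" by (auto simp: cuts_def)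
    then have J: "polygon P" "{(x, y), (x, y - 1)} \<in> P" "polygon Q" "{(x + 1, y), (x + 1, y - 1)} \<in> Q"
      "\<Union>P \<inter> \<Union>Q = {}" "G = plaquette_join P Q x y"
      unfolding global_cut_def by blast+
    have V: "?V = \<Union>P \<union> \<Union>Q" unfolding J(6) by (rule plaquette_join(3)[OF J(1-5)])
    then have "(x, y) \<in> ?V" using J(2) by blast
    then have "x \<in> fst ` ?V" "y \<in> snd ` ?V" by (metis fst_conv imageI, metis snd_conv imageI)
    moreover have "P \<subseteq> Pow ?V" "Q \<subseteq> Pow ?V" using V by blast+
    ultimately show "c \<in> (fst ` ?V) \<times> (snd ` ?V) \<times> Pow (Pow ?V) \<times> Pow (Pow ?V)"
      by (simp add: c(1))
  qed
  show "finite ((fst ` ?V) \<times> (snd ` ?V) \<times> Pow (Pow ?V) \<times> Pow (Pow ?V))"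
    using finite_vertices[OF assms] by simp
qed

text \<open>The changes of the two polygons near their contact are recorded relative to the position of the
  cut, so that a joined polygon with a cut has boundedly many preimages.\<close>

definition changes :: "point set set set" where
  "changes = Pow (Pow (square 0 8))"

definition max_change :: nat where
  "max_change = 2 * card (Pow (square 0 8))"

lemma finite_square: "finite (square c R)"
proof (rule finite_subset)
  show "square c R \<subseteq> {fst c - R..fst c + R} \<times> {snd c - R..snd c + R}"
    by (auto simp: square_def)
qed simp

lemma finite_changes: "finite changes"
  by (simp add: changes_def finite_square)

lemma sym_diff_cancel: "sym_diff_edges A P = sym_diff_edges A' P \<Longrightarrow> A = A'"
  unfolding sym_diff_edges_def by blast

lemma translate_change:
  assumes "D \<subseteq> Pow (square (x, y) 8)"
  shows "translate (- (x, y)) D \<in> changes" "translate (x, y) (translate (- (x, y)) D) = D"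
    "card D \<le> card (Pow (square 0 8))"
proof -
  have "(+) (- (x, y)) ` square (x, y) 8 \<subseteq> square 0 8"
    by (auto simp: square_def)
  then show c: "translate (- (x, y)) D \<in> changes"
    using assms unfolding changes_def translate_def by blast
  show "translate (x, y) (translate (- (x, y)) D) = D"
    unfolding translate_translate right_minus by (rule translate_0)
  have "card D = card (translate (- (x, y)) D)" by simp
  also have "\<dots> \<le> card (Pow (square 0 8))"
    using c unfolding changes_def by (intro card_mono) (auto simp: finite_square)
  finally show "card D \<le> card (Pow (square 0 8))" .
qed

lemma card_sym_diff:
  assumes "finite A" "finite P"
  shows "card A \<le> card P + card (sym_diff_edges A P)" "card P \<le> card A + card (sym_diff_edges A P)"
proof -
  have fin: "finite (sym_diff_edges A P)" using assms by (simp add: sym_diff_edges_def)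
  have "A \<subseteq> P \<union> sym_diff_edges A P" "P \<subseteq> A \<union> sym_diff_edges A P" by (auto simp: sym_diff_edges_def)
  then have "card A \<le> card (P \<union> sym_diff_edges A P)" "card P \<le> card (A \<union> sym_diff_edges A P)"
    using fin assms by (auto intro!: card_mono)
  then show "card A \<le> card P + card (sym_diff_edges A P)" "card P \<le> card A + card (sym_diff_edges A P)"
    using card_Un_le order_trans by blast+
qed

text \<open>With a surplus of 11 over \<open>q\<close>, every offset \<open>i < q\<close> satisfies
  the margins of 12 in \<open>slide_join\<close>.\<close>

lemma tall_height:
  assumes "A \<in> tall j" "(q + 12)\<^sup>2 \<le> j"
  shows "int q + 11 \<le> height A"
proof (rule ccontr)
  assume "\<not> int q + 11 \<le> height A"
  then have "(height A + 1)\<^sup>2 \<le> (int q + 11)\<^sup>2"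
    using height_nonneg assms(1) by (intro power_mono) (auto simp: tall_def)
  also have "\<dots> < (int q + 12)\<^sup>2" by (intro power_strict_mono) auto
  also have "\<dots> = int ((q + 12)\<^sup>2)" by simp
  also have "\<dots> \<le> int j" using assms(2) by (simp only: of_nat_le_iff)
  finally show False using assms(1) by (simp add: tall_def)
qed

text \<open>A join is stored as a polygon with one of its cuts and the two changes. These determine
  \<open>A\<close> and the translated \<open>B\<close>; normality of \<open>B\<close> then separates
  \<open>B\<close> from the shift. Hence the multiplicity of the join is at most the number of cuts
  times a constant.\<close>

lemma join_count:
  assumes F: "finite F"
    and FN: "\<And>j k. (j, k) \<in> F \<Longrightarrow> j + k = N \<and> (q + 12)\<^sup>2 \<le> j \<and> (q + 12)\<^sup>2 \<le> k"
  shows "(\<Sum>(j, k)\<in>F. card (tall j) * card (tall k)) * q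
    \<le> (\<Sum>M\<in>{N - max_change..N + max_change}. \<Sum>G\<in>normal_polygons M. card (cuts G)) * (card changes)\<^sup>2"
proof -
  define \<T> where "\<T> = (SIGMA t:F. (tall (fst t) \<times> tall (snd t)) \<times> {..<q})"
  define \<X> where "\<X> = (SIGMA M:{N - max_change..N + max_change}. SIGMA G:normal_polygons M. cuts G)
    \<times> (changes \<times> changes)"
  \<comment> \<open>The vertical shift is measured downwards from the top of \<open>A\<close>, so
    that \<open>i\<close> can be read off once \<open>A\<close> is known.\<close>
  define R where "R = (\<lambda>((j :: nat, k :: nat), (A, B), i) ((M :: nat, G :: point set set, x, y, P, Q), c, c').
    \<exists>t. sym_diff_edges A P = translate (x, y) c \<and>
      sym_diff_edges (translate (t, height A - int i) B) Q = translate (x, y) c')"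
  have fintall: "finite (tall n)" for n using finite_normal_polygons by (simp add: tall_def)
  have fincuts: "finite (cuts G)" if "G \<in> normal_polygons M" for G M
    using that finite_cuts by (simp add: normal_polygons_def)
  have cardT: "card \<T> = (\<Sum>(j, k)\<in>F. card (tall j) * card (tall k)) * q"
    unfolding \<T>_def using F fintall
    by (simp add: card_cartesian_product sum_distrib_right case_prod_beta)
  have cardX: "card \<X> = (\<Sum>M\<in>{N - max_change..N + max_change}. \<Sum>G\<in>normal_polygons M. card (cuts G)) * (card changes)\<^sup>2"
  proof -
    have "card (SIGMA G:normal_polygons M. cuts G) = (\<Sum>G\<in>normal_polygons M. card (cuts G))" for M
      using finite_normal_polygons fincuts by (intro card_SigmaI) auto
    moreover have "finite (SIGMA G:normal_polygons M. cuts G)" for M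
      using finite_normal_polygons fincuts by (intro finite_SigmaI) auto
    ultimately show ?thesis
      unfolding \<X>_def by (simp add: card_cartesian_product power2_eq_square)
  qed
  have finX: "finite \<X>"
    unfolding \<X>_def using finite_normal_polygons fincuts finite_changes
    by (intro finite_cartesian_product finite_SigmaI) auto
  have "card \<T> \<le> card \<X>"
  proof (rule card_le_by_relation[where R = R, OF finX])
    fix t assume "t \<in> \<T>"
    then obtain j k A B i where t: "t = ((j, k), (A, B), i)" "(j, k) \<in> F" "A \<in> tall j" "B \<in> tall k" "i < q"
      unfolding \<T>_def by auto
    have N: "j + k = N" and jk: "(q + 12)\<^sup>2 \<le> j" "(q + 12)\<^sup>2 \<le> k" using FN[OF t(2)] by auto
    have nA: "A \<in> normal_polygons j" "B \<in> normal_polygons k" using t by (auto simp: tall_def)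
    then have cA: "polygon A" "card A = j" "polygon B" "card B = k" by (auto simp: normal_polygons_def)
    have h: "int q + 11 \<le> height A" "int q + 11 \<le> height B"
      using tall_height t jk by blast+
    have s: "12 \<le> height A - int i" "height A - int i \<le> height A"
      "height A + 12 \<le> height A - int i + height B" using h t(5) by auto
    obtain u G x y P Q where G: "global_cut G x y P Q" "normalized G"
      "sym_diff_edges A P \<subseteq> Pow (square (x, y) 8)"
      "sym_diff_edges (translate (u, height A - int i) B) Q \<subseteq> Pow (square (x, y) 8)"
      using slide_join[OF nA s] .
    have J: "polygon P" "{(x, y), (x, y - 1)} \<in> P" "polygon Q" "{(x + 1, y), (x + 1, y - 1)} \<in> Q"
      "\<Union>P \<inter> \<Union>Q = {}" "G = plaquette_join P Q x y"
      using G(1) unfolding global_cut_def by blast+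
    have pG: "polygon G" "card G = card P + card Q"
      unfolding J(6) by (rule plaquette_join[OF J(1-5)])+
    define B' where "B' = translate (u, height A - int i) B"
    have B': "polygon B'" "card B' = k" using cA by (simp_all add: B'_def polygon_translate)
    note c1 = translate_change[OF G(3)] and c2 = translate_change[OF G(4)[folded B'_def]]
    have "card A \<le> card P + card (sym_diff_edges A P)" "card P \<le> card A + card (sym_diff_edges A P)"
      "card B' \<le> card Q + card (sym_diff_edges B' Q)" "card Q \<le> card B' + card (sym_diff_edges B' Q)"
      by (rule card_sym_diff finite_polygon cA(1) B'(1) J(1,3))+
    then have M: "card G \<in> {N - max_change..N + max_change}"
      using c1(3) c2(3) pG(2) N cA(2) B'(2) unfolding max_change_def by auto
    have "G \<in> normal_polygons (card G)" using pG G(2) by (simp add: normal_polygons_def)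
    moreover have "(x, y, P, Q) \<in> cuts G" using G(1) by (simp add: cuts_def)
    ultimately have mem: "((card G, G, x, y, P, Q), translate (- (x, y)) (sym_diff_edges A P),
        translate (- (x, y)) (sym_diff_edges B' Q)) \<in> \<X>"
      using M c1(1) c2(1) by (simp add: \<X>_def)
    have "R t ((card G, G, x, y, P, Q), translate (- (x, y)) (sym_diff_edges A P),
        translate (- (x, y)) (sym_diff_edges B' Q))"
      unfolding R_def t(1) prod.case
      by (rule exI[of _ u]) (simp only: c1(2) c2(2) B'_def[symmetric])
    then show "\<exists>z\<in>\<X>. R t z" using mem by (rule bexI)
  next
    fix s t z
    assume "s \<in> \<T>" "t \<in> \<T>" "z \<in> \<X>" and R: "R s z" "R t z"
    obtain j k A B i where s: "s = ((j, k), (A, B), i)" "A \<in> tall j" "B \<in> tall k"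
      using \<open>s \<in> \<T>\<close> unfolding \<T>_def by auto
    obtain j' k' A' B' i' where t: "t = ((j', k'), (A', B'), i')" "A' \<in> tall j'" "B' \<in> tall k'"
      using \<open>t \<in> \<T>\<close> unfolding \<T>_def by auto
    obtain M G x y P Q c c' where z: "z = ((M, G, x, y, P, Q), c, c')" by (metis prod.exhaust)
    obtain u where u: "sym_diff_edges A P = translate (x, y) c"
      "sym_diff_edges (translate (u, height A - int i) B) Q = translate (x, y) c'"
      using R(1) unfolding R_def s(1) z prod.case by blast
    obtain u' where u': "sym_diff_edges A' P = translate (x, y) c"
      "sym_diff_edges (translate (u', height A' - int i') B') Q = translate (x, y) c'"
      using R(2) unfolding R_def t(1) z prod.case by blast
    have A: "A = A'" using sym_diff_cancel u(1) u'(1) by metis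
    have "translate (u, height A - int i) B = translate (u', height A' - int i') B'"
      using sym_diff_cancel u(2) u'(2) by metis
    moreover have "normalized B" "normalized B'" using s t by (auto simp: tall_def normal_polygons_def)
    ultimately have "B = B' \<and> (u, height A - int i) = (u', height A' - int i')"
      using normalized_eq by blast
    then have "B = B'" "i = i'" using A by auto
    moreover have "j = card A" "k = card B" "j' = card A'" "k' = card B'"
      using s t by (auto simp: tall_def normal_polygons_def)
    ultimately show "s = t" using s t A by simp
  qed
  then show ?thesis unfolding cardT cardX .
qed

section \<open>Density\<close>

definition cut_sum :: "nat \<Rightarrow> real" where
  "cut_sum n = real (\<Sum>G\<in>normal_polygons n. card (cuts G))"

text \<open>Polygons with fewer cuts than a multiple of the logarithm of \<open>n\<close> give the
  first term. For the others the trivial bound by \<open>n\<close> cuts suffices, as such polygons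
  are rare.\<close>

lemma cut_sum_bound:
  fixes \<epsilon> :: real
  assumes "\<epsilon> > 0"
  shows "\<forall>\<^sub>F n in sequentially. cut_sum n \<le> real n powr \<epsilon> * real (pcount n) + real n powr (-4) * \<mu> ^ n"
proof -
  have mu: "\<mu> \<ge> 1" by (rule connective_constant_bounds)
  define \<rho> where "\<rho> = 1 + 1 / \<mu>\<^sup>2"
  have rho: "\<rho> > 1" using mu by (simp add: \<rho>_def)
  \<comment> \<open>Chosen to make \<open>\<rho> ^ k n\<close> at least \<open>n ^ 12\<close>. Eight
    of these powers pay for the polynomial factors, and the remaining four make the second term
    negligible in \<open>eventually_gap\<close>.\<close>
  define c where "c = 12 / ln \<rho>"
  have c: "c > 0" using rho by (simp add: c_def)
  define k where "k n = nat \<lceil>c * ln (real n)\<rceil>" for n :: nat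
  have "\<forall>\<^sub>F n :: nat in sequentially. c * ln (real n) + 1 \<le> real n powr \<epsilon>"
    using c assms by real_asymp
  moreover have "\<forall>\<^sub>F n :: nat in sequentially. c * ln (real n) + 1 \<le> real n"
    using c by real_asymp
  moreover have "\<forall>\<^sub>F n :: nat in sequentially. real n * (real n + 1) * (6 * real n + 1) ^ 5 * \<mu>\<^sup>2 \<le> real n ^ 8"
  proof -
    have "m > 0 \<Longrightarrow> \<forall>\<^sub>F n :: nat in sequentially. real n * (real n + 1) * (6 * real n + 1) ^ 5 * m \<le> real n ^ 8"
      for m :: real by real_asymp
    then show ?thesis using mu by simp
  qed
  ultimately show ?thesis
    using eventually_ge_at_top[of 1]
  proof eventually_elim
    case (elim n)
    have n: "real n \<ge> 1" using elim by simp
    have k: "c * ln (real n) \<le> real (k n)" "real (k n) \<le> c * ln (real n) + 1"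
      using c n unfolding k_def by (auto simp: of_nat_nat)
    have kn: "k n \<le> n" using k(2) elim(2) by linarith
    let ?B = "{G \<in> normal_polygons n. k n \<le> card (cuts G)}"
    have fin: "finite ?B" using finite_normal_polygons by simp
    have "(\<Sum>G\<in>normal_polygons n. card (cuts G)) \<le> (\<Sum>G\<in>normal_polygons n. k n + (if G \<in> ?B then n else 0))"
      using card_cuts_le_length by (intro sum_mono) (auto intro: trans_le_add2)
    also have "\<dots> = k n * pcount n + n * card ?B"
    proof -
      have "(\<Sum>G\<in>normal_polygons n. if G \<in> ?B then n else 0) = (\<Sum>G\<in>normal_polygons n \<inter> ?B. n)"
        by (rule sum.inter_restrict[symmetric]) (rule finite_normal_polygons)
      also have "normal_polygons n \<inter> ?B = ?B" by auto
      finally show ?thesis by (simp add: sum.distrib pcount_def)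
    qed
    finally have "real (\<Sum>G\<in>normal_polygons n. card (cuts G)) \<le> real (k n * pcount n + n * card ?B)"
      by (simp only: of_nat_le_iff)
    then have 1: "cut_sum n \<le> real (k n) * real (pcount n) + real n * real (card ?B)"
      by (simp add: cut_sum_def)
    have "real n ^ 12 = exp (12 * ln (real n))"
      using n by (simp add: exp_of_nat_mult[of 12, simplified])
    also have "12 * ln (real n) = c * ln (real n) * ln \<rho>" using rho by (simp add: c_def)
    also have "exp \<dots> \<le> exp (real (k n) * ln \<rho>)" using k(1) rho by (simp add: mult_right_mono)
    also have "\<dots> = \<rho> ^ k n" using rho by (simp add: exp_of_nat_mult)
    finally have rk: "real n ^ 12 \<le> \<rho> ^ k n" .
    have "real (card ?B) * real n ^ 12 \<le> real (card ?B) * \<rho> ^ k n"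
      using rk by (intro mult_left_mono) auto
    also have "\<dots> \<le> (real (k n) + 1) * (6 * real n + 1) ^ 5 * \<mu> ^ (n + 2)"
      using many_cuts_rare[OF kn] by (simp add: \<rho>_def)
    also have "\<dots> \<le> (real n + 1) * (6 * real n + 1) ^ 5 * \<mu> ^ (n + 2)"
      using kn mu by (intro mult_right_mono) auto
    finally have "real n * (real (card ?B) * real n ^ 12) \<le> real n * ((real n + 1) * (6 * real n + 1) ^ 5 * \<mu> ^ (n + 2))"
      by (intro mult_left_mono) auto
    also have "\<dots> = (real n * (real n + 1) * (6 * real n + 1) ^ 5 * \<mu>\<^sup>2) * \<mu> ^ n"
      by (simp add: power_add mult_ac power2_eq_square)
    also have "\<dots> \<le> real n ^ 8 * \<mu> ^ n" using elim(3) mu by (intro mult_right_mono) auto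
    finally have "(real n * real (card ?B)) * real n ^ 12 \<le> real n ^ 8 * \<mu> ^ n" by (simp add: mult.assoc)
    then have "real n * real (card ?B) \<le> real n ^ 8 * \<mu> ^ n / real n ^ 12"
      using n by (simp add: pos_le_divide_eq)
    also have "real n ^ 8 * \<mu> ^ n / real n ^ 12 = \<mu> ^ n / real n ^ 4"
      using n by (simp add: field_simps flip: power_add)
    also have "\<dots> = real n powr (-4) * \<mu> ^ n"
      using n by (simp add: powr_minus powr_realpow' field_simps flip: powr_numeral)
    finally have 2: "real n * real (card ?B) \<le> real n powr (-4) * \<mu> ^ n" .
    have "real (k n) * real (pcount n) \<le> real n powr \<epsilon> * real (pcount n)"
      using k(2) elim(1) by (intro mult_right_mono) auto
    then show ?case using 1 2 by linarith
  qed
qed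

text \<open>In the notation of the paper the condition reads \<open>\<theta>\<^sub>n \<le> 3/2 - \<delta>\<close>.\<close>

definition large_set :: "real \<Rightarrow> nat set" where
  "large_set \<delta> = {n. n \<ge> 1 \<and> real (pcount n) \<ge> real n powr (\<delta> - 3/2) * \<mu> ^ n}"

section \<open>The gain in the exponent at popular sums\<close>

lemma powr_comparable:
  fixes n m f :: real
  assumes "0 < \<eta>" "\<eta> \<le> 1" "n > 0" "\<eta> * n \<le> m" "m \<le> 3 * n"
  shows "m powr f \<le> n powr f * (3 powr \<bar>f\<bar> + \<eta> powr (- \<bar>f\<bar>))"
proof -
  define r where "r = m / n"
  have r: "\<eta> \<le> r" "r \<le> 3" using assms by (auto simp: r_def field_simps)
  have "r powr f \<le> 3 powr \<bar>f\<bar> + \<eta> powr (- \<bar>f\<bar>)"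
  proof (cases "f \<ge> 0")
    case True
    then have "r powr f \<le> 3 powr f" using r assms by (intro powr_mono2) auto
    then show ?thesis using True by (simp add: add_increasing2)
  next
    case False
    then have "r powr f \<le> \<eta> powr f" using r assms by (intro powr_mono2') auto
    then show ?thesis using False by (simp add: add_increasing)
  qed
  moreover have "m powr f = n powr f * r powr f"
    using assms r by (simp add: r_def powr_mult[symmetric])
  ultimately show ?thesis using assms by (simp add: mult_left_mono)
qed

lemma powr_comparable':
  fixes n m f :: real
  assumes "0 < \<eta>" "\<eta> \<le> 1" "n > 0" "\<eta> * n \<le> m" "m \<le> n"
  shows "n powr f * \<eta> powr \<bar>f\<bar> \<le> m powr f"
proof -
  define r where "r = m / n"
  have r: "\<eta> \<le> r" "r \<le> 1" using assms by (auto simp: r_def field_simps)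
  have "\<eta> powr \<bar>f\<bar> \<le> r powr f"
  proof (cases "f \<ge> 0")
    case True
    then show ?thesis using r assms by (simp add: powr_mono2)
  next
    case False
    have "\<eta> powr \<bar>f\<bar> \<le> 1" using assms by (intro powr_le1) auto
    also have "1 \<le> r powr f" using False r assms powr_mono2'[of f r 1] by simp
    finally show ?thesis .
  qed
  moreover have "m powr f = n powr f * r powr f"
    using assms r by (simp add: r_def powr_mult[symmetric])
  ultimately show ?thesis using assms by (simp add: mult_left_mono)
qed

text \<open>On the right, about \<open>n\<close> pairs, \<open>sqrt n\<close> offsets and two large
  counts give the exponent \<open>1 + 1/2 + 2 * (\<delta> - 3/2) = 2 * \<delta> - 3/2\<close>. On
  the left stand the exponent \<open>3 * \<delta> / 2 - 3/2\<close> of a count that is not large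
  plus \<open>\<delta> / 4\<close> for the cuts, and the error from rare polygons.\<close>

lemma eventually_gap:
  fixes \<delta> c C C' :: real
  assumes "\<delta> > 0" "c > 0"
  shows "\<forall>\<^sub>F n in sequentially. C * real n powr (7 * \<delta> / 4 - 3/2) + C' * real n powr (-4)
    < c * (sqrt (real n) * real n * (real n powr (\<delta> - 3/2))\<^sup>2)"
proof -
  have "(\<lambda>n. C * real n powr (- (\<delta> / 4)) + C' * real n powr (- (2 * \<delta> + 5/2))) \<longlonglongrightarrow> C * 0 + C' * 0"
    using assms(1) by (intro tendsto_intros tendsto_neg_powr filterlim_real_sequentially) auto
  then have "\<forall>\<^sub>F n in sequentially. C * real n powr (- (\<delta> / 4)) + C' * real n powr (- (2 * \<delta> + 5/2)) < c"
    using assms(2) by (simp add: order_tendstoD)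
  then show ?thesis
    using eventually_gt_at_top[of 0]
  proof eventually_elim
    case (elim n)
    define x where "x = real n"
    have x: "x > 0" using elim by (simp add: x_def)
    have e1: "sqrt x * x * (x powr (\<delta> - 3/2))\<^sup>2 = x powr (2 * \<delta> - 3/2)"
    proof -
      have "sqrt x * x * (x powr (\<delta> - 3/2))\<^sup>2 = x powr (1/2) * x powr 1 * (x powr (\<delta> - 3/2) * x powr (\<delta> - 3/2))"
        using x by (simp add: powr_half_sqrt power2_eq_square)
      also have "\<dots> = x powr (1/2 + 1 + ((\<delta> - 3/2) + (\<delta> - 3/2)))"
        by (simp only: powr_add)
      also have "1/2 + 1 + ((\<delta> - 3/2) + (\<delta> - 3/2)) = 2 * \<delta> - 3/2" by simp
      finally show ?thesis .
    qed
    have e2: "x powr (7 * \<delta> / 4 - 3/2) = x powr (2 * \<delta> - 3/2) * x powr (- (\<delta> / 4))"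
      "x powr (-4) = x powr (2 * \<delta> - 3/2) * x powr (- (2 * \<delta> + 5/2))"
      by (simp_all flip: powr_add)
    have "(C * x powr (- (\<delta> / 4)) + C' * x powr (- (2 * \<delta> + 5/2))) * x powr (2 * \<delta> - 3/2) < c * x powr (2 * \<delta> - 3/2)"
      using elim(1) x unfolding x_def[symmetric] by (intro mult_strict_right_mono) auto
    then show ?case unfolding x_def[symmetric] e1 e2 by (simp add: algebra_simps)
  qed
qed

text \<open>If no length near \<open>N\<close> were large, the cut sums near \<open>N\<close> would
  be bounded by the left side of \<open>eventually_gap\<close>, while the pairs in \<open>F\<close>
  produce joins to the amount of its right side.\<close>

lemma large_set_sums:
  fixes \<delta> \<eta> :: real
  assumes "\<delta> > 0" and \<eta>: "0 < \<eta>" "\<eta> \<le> 1"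
  shows "\<forall>\<^sub>F n in sequentially. \<forall>N F. F \<subseteq> {(j, k). j \<in> large_set \<delta> \<and> k \<in> large_set \<delta> \<and>
      \<eta> * n \<le> j \<and> j \<le> n \<and> \<eta> * n \<le> k \<and> k \<le> n \<and> j + k = N} \<longrightarrow> \<eta>\<^sup>2 * n / 8 \<le> card F \<longrightarrow>
      (\<exists>M\<in>large_set (3 * \<delta> / 2). N \<le> M + max_change \<and> M \<le> N + max_change)"
proof -
  define f where "f = \<delta> - 3/2"
  define e where "e = 7 * \<delta> / 4 - 3/2"
  define b where "b = max_change"
  define \<kappa> where "\<kappa> = (real (card changes))\<^sup>2"
  have mu: "\<mu> \<ge> 1" by (rule connective_constant_bounds)
  define C where "C = \<kappa> * (2 * real b + 1) * \<mu> ^ b * (3 powr \<bar>e\<bar> + \<eta> powr (- \<bar>e\<bar>))"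
  define C' where "C' = \<kappa> * (2 * real b + 1) * \<mu> ^ b * (3 powr \<bar>-4\<bar> + \<eta> powr (- \<bar>-4\<bar>))"
  \<comment> \<open>The 16 consists of a factor 2 for each restriction to tall polygons and 4 for
    the estimate \<open>q4\<close>; the powers of \<open>\<eta>\<close> compare the lengths with
    \<open>n\<close>.\<close>
  define c where "c = (sqrt \<eta> / 16) * (\<eta>\<^sup>2 / 8) * (\<eta> powr \<bar>f\<bar>)\<^sup>2"
  have c: "c > 0" using \<eta> by (simp add: c_def)
  obtain n0 where n0: "\<And>n. n \<ge> n0 \<Longrightarrow> cut_sum n \<le> real n powr (\<delta>/4) * real (pcount n) + real n powr (-4) * \<mu> ^ n"
    using cut_sum_bound[of "\<delta> / 4"] assms(1) unfolding eventually_sequentially by auto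
  have "\<forall>\<^sub>F n :: nat in sequentially. 24 \<le> sqrt (\<eta> * real n)"
    using \<eta>(1) by real_asymp
  moreover have "\<forall>\<^sub>F n :: nat in sequentially. real b + real n0 + 1 \<le> \<eta> * real n"
    using \<eta>(1) by real_asymp
  moreover note eventually_gap[OF assms(1) c, of C C']
  ultimately show ?thesis
    using eventually_gt_at_top[of 0]
  proof eventually_elim
    case (elim n)
    show ?case
    proof (intro allI impI, rule ccontr)
      fix N and F :: "(nat \<times> nat) set"
      assume F: "F \<subseteq> {(j, k). j \<in> large_set \<delta> \<and> k \<in> large_set \<delta> \<and>
        \<eta> * n \<le> j \<and> j \<le> n \<and> \<eta> * n \<le> k \<and> k \<le> n \<and> j + k = N}" and cF: "\<eta>\<^sup>2 * n / 8 \<le> card F"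
        and no: "\<not> (\<exists>M\<in>large_set (3 * \<delta> / 2). N \<le> M + max_change \<and> M \<le> N + max_change)"
      have n: "real n > 0" using elim by simp
      have Fd: "j \<in> large_set \<delta>" "k \<in> large_set \<delta>" "\<eta> * n \<le> j" "j \<le> n" "\<eta> * n \<le> k" "k \<le> n" "j + k = N"
        if "(j, k) \<in> F" for j k using F that by auto
      have finF: "finite F"
        by (rule finite_subset[of _ "{..n} \<times> {..n}"]) (use Fd in auto)
      have "real (card F) > 0" using cF \<eta> n by (intro less_le_trans[OF _ cF]) auto
      then have "F \<noteq> {}" by auto
      then obtain j0 k0 where jk0: "(j0, k0) \<in> F" by (metis ex_in_conv prod.exhaust)
      have N: "2 * (\<eta> * n) \<le> N" "N \<le> 2 * n" using Fd[OF jk0] by auto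
      \<comment> \<open>Half the square root leaves room for the margin:
        \<open>(q + 12)\<^sup>2\<close> stays below \<open>\<eta> * n\<close>, hence below every
        length in \<open>F\<close>.\<close>
      define q where "q = nat \<lfloor>sqrt (\<eta> * real n) / 2\<rfloor>"
      have q: "real q \<le> sqrt (\<eta> * real n) / 2" "sqrt (\<eta> * real n) / 2 < real q + 1"
        using elim(1) unfolding q_def by linarith+
      have q4: "sqrt (\<eta> * real n) / 4 \<le> real q" using q(2) elim(1) by linarith
      have qq: "real ((q + 12)\<^sup>2) \<le> \<eta> * real n"
      proof -
        have "real q + 12 \<le> sqrt (\<eta> * real n)" using q(1) elim(1) by linarith
        then have "(real q + 12)\<^sup>2 \<le> (sqrt (\<eta> * real n))\<^sup>2" by (intro power_mono) auto
        then show ?thesis using \<eta> n by simp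
      qed
      have jc: "(\<Sum>(j, k)\<in>F. card (tall j) * card (tall k)) * q
        \<le> (\<Sum>M\<in>{N - b..N + b}. \<Sum>G\<in>normal_polygons M. card (cuts G)) * (card changes)\<^sup>2"
        unfolding b_def
      proof (rule join_count[OF finF])
        fix j k assume jk: "(j, k) \<in> F"
        have "real ((q + 12)\<^sup>2) \<le> real j" "real ((q + 12)\<^sup>2) \<le> real k"
          using Fd[OF jk] qq by linarith+
        then show "j + k = N \<and> (q + 12)\<^sup>2 \<le> j \<and> (q + 12)\<^sup>2 \<le> k"
          using Fd[OF jk] by (simp only: of_nat_le_iff)
      qed
      define L where "L = real n powr f * \<eta> powr \<bar>f\<bar>"
      have L0: "L \<ge> 0" by (simp add: L_def)
      have half: "L * \<mu> ^ j / 2 \<le> real (card (tall j))"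
        if "j \<in> large_set \<delta>" "\<eta> * n \<le> j" "j \<le> n" for j
      proof -
        have "L \<le> real j powr f" unfolding L_def using that \<eta> n by (intro powr_comparable') auto
        then have "L * \<mu> ^ j \<le> real j powr f * \<mu> ^ j" using mu by (intro mult_right_mono) auto
        also have "\<dots> \<le> real (pcount j)" using that(1) by (simp add: large_set_def f_def)
        also have "\<dots> \<le> 2 * real (card (tall j))" using pcount_le_tall[of j] by linarith
        finally show ?thesis by simp
      qed
      have pair: "L\<^sup>2 * \<mu> ^ N / 4 \<le> real (card (tall j) * card (tall k))" if "(j, k) \<in> F" for j k
      proof -
        have "L\<^sup>2 * \<mu> ^ N / 4 = (L * \<mu> ^ j / 2) * (L * \<mu> ^ k / 2)"
          unfolding Fd(7)[OF that, symmetric] by (simp add: power_add power2_eq_square)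
        also have "\<dots> \<le> real (card (tall j)) * real (card (tall k))"
          using half Fd[OF that] L0 mu by (intro mult_mono) auto
        finally show ?thesis by simp
      qed
      have "(\<eta>\<^sup>2 * n / 8) * (L\<^sup>2 * \<mu> ^ N / 4) * (sqrt (\<eta> * real n) / 4)
          \<le> real (card F) * (L\<^sup>2 * \<mu> ^ N / 4) * real q"
        using cF q4 mu \<eta> n by (intro mult_mono) auto
      also have "\<dots> = (\<Sum>(j, k)\<in>F. L\<^sup>2 * \<mu> ^ N / 4) * real q" by (simp add: case_prod_beta)
      also have "\<dots> \<le> (\<Sum>(j, k)\<in>F. real (card (tall j) * card (tall k))) * real q"
        using pair by (intro mult_right_mono sum_mono) auto
      also have "\<dots> = real ((\<Sum>(j, k)\<in>F. card (tall j) * card (tall k)) * q)"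
        by (simp add: case_prod_beta)
      also have "\<dots> \<le> real ((\<Sum>M\<in>{N - b..N + b}. \<Sum>G\<in>normal_polygons M. card (cuts G)) * (card changes)\<^sup>2)"
        using jc by (simp only: of_nat_le_iff)
      also have "\<dots> = (\<Sum>M\<in>{N - b..N + b}. cut_sum M) * \<kappa>"
        by (simp add: cut_sum_def \<kappa>_def)
      also have "\<dots> \<le> (\<Sum>M\<in>{N - b..N + b}. \<mu> ^ (N + b) *
          (real n powr e * (3 powr \<bar>e\<bar> + \<eta> powr (- \<bar>e\<bar>)) + real n powr (-4) * (3 powr \<bar>-4\<bar> + \<eta> powr (- \<bar>-4\<bar>)))) * \<kappa>"
      proof (intro mult_right_mono sum_mono)
        fix M assume M: "M \<in> {N - b..N + b}"
        have Mb: "N \<le> M + b" "M \<le> N + b" using M by auto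
        have "real N \<le> real M + real b" "real M \<le> real N + real b"
          using Mb by (simp_all only: of_nat_le_iff flip: of_nat_add)
        moreover have "\<eta> * real n \<le> real n" using \<eta> n by simp
        ultimately have Mn: "\<eta> * real n \<le> real M" "real M \<le> 3 * real n" "real n0 \<le> real M" "1 \<le> real M"
          using N elim(2) by linarith+
        have "M \<notin> large_set (3 * \<delta> / 2)" using no Mb unfolding b_def by blast
        then have p: "real (pcount M) \<le> real M powr (3 * \<delta> / 2 - 3/2) * \<mu> ^ M"
          using Mn(4) by (auto simp: large_set_def)
        have "cut_sum M \<le> real M powr (\<delta>/4) * real (pcount M) + real M powr (-4) * \<mu> ^ M"
          using Mn(3) by (intro n0) simp
        also have "\<dots> \<le> real M powr (\<delta>/4) * (real M powr (3 * \<delta> / 2 - 3/2) * \<mu> ^ M) + real M powr (-4) * \<mu> ^ M"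
          using p by (intro add_right_mono mult_left_mono) auto
        also have "\<dots> = \<mu> ^ M * (real M powr (\<delta>/4 + (3 * \<delta> / 2 - 3/2)) + real M powr (-4))"
          unfolding powr_add by (simp add: algebra_simps)
        also have "\<delta>/4 + (3 * \<delta> / 2 - 3/2) = e" by (simp add: e_def)
        also have "\<mu> ^ M * (real M powr e + real M powr (-4)) \<le> \<mu> ^ (N + b) * (real n powr e * (3 powr \<bar>e\<bar> + \<eta> powr (- \<bar>e\<bar>)) + real n powr (-4) * (3 powr \<bar>-4\<bar> + \<eta> powr (- \<bar>-4\<bar>)))"
          using mu Mb(2) Mn \<eta> n
          by (intro mult_mono add_mono powr_comparable power_increasing) auto
        finally show "cut_sum M \<le> \<mu> ^ (N + b) * (real n powr e * (3 powr \<bar>e\<bar> + \<eta> powr (- \<bar>e\<bar>)) + real n powr (-4) * (3 powr \<bar>-4\<bar> + \<eta> powr (- \<bar>-4\<bar>)))" .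
      qed (simp add: \<kappa>_def)
      also have "\<dots> = real (card {N - b..N + b}) * (\<mu> ^ (N + b) *
          (real n powr e * (3 powr \<bar>e\<bar> + \<eta> powr (- \<bar>e\<bar>)) + real n powr (-4) * (3 powr \<bar>-4\<bar> + \<eta> powr (- \<bar>-4\<bar>)))) * \<kappa>"
        by simp
      also have "\<dots> \<le> (2 * real b + 1) * (\<mu> ^ (N + b) *
          (real n powr e * (3 powr \<bar>e\<bar> + \<eta> powr (- \<bar>e\<bar>)) + real n powr (-4) * (3 powr \<bar>-4\<bar> + \<eta> powr (- \<bar>-4\<bar>)))) * \<kappa>"
        using mu by (intro mult_right_mono) (auto simp: \<kappa>_def)
      also have "\<dots> = \<mu> ^ N * (C * real n powr e + C' * real n powr (-4))"
        unfolding C_def C'_def power_add by (simp add: algebra_simps)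
      finally have main: "(\<eta>\<^sup>2 * n / 8) * (L\<^sup>2 * \<mu> ^ N / 4) * (sqrt (\<eta> * real n) / 4)
        \<le> \<mu> ^ N * (C * real n powr e + C' * real n powr (-4))" .
      have eq: "(\<eta>\<^sup>2 * n / 8) * (L\<^sup>2 * \<mu> ^ N / 4) * (sqrt (\<eta> * real n) / 4)
        = \<mu> ^ N * (c * (sqrt (real n) * real n * (real n powr f)\<^sup>2))"
        unfolding c_def L_def by (simp add: real_sqrt_mult power_mult_distrib)
      have "\<mu> ^ N * (c * (sqrt (real n) * real n * (real n powr f)\<^sup>2))
        \<le> \<mu> ^ N * (C * real n powr e + C' * real n powr (-4))" using main unfolding eq .
      then have "c * (sqrt (real n) * real n * (real n powr f)\<^sup>2) \<le> C * real n powr e + C' * real n powr (-4)"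
        using mu by simp
      then show False using elim(3) unfolding e_def f_def by linarith
    qed
  qed
qed

text \<open>There are at least \<open>(\<eta> * n)\<^sup>2\<close> pairs. Unpopular sums account for
  at most 3/8 of this number and a popular one for at most \<open>2 * n\<close> pairs, so at least
  \<open>5 * \<eta>\<^sup>2 * n / 16\<close> sums are popular.\<close>

lemma popular_sums:
  fixes \<eta> :: real and E :: "nat set"
  assumes E: "E \<subseteq> {..n}" and n: "n \<ge> 1" and \<eta>: "0 < \<eta>" and card: "\<eta> * n \<le> card E"
  defines "r \<equiv> \<lambda>N. {(j, k) \<in> E \<times> E. j + k = N}"
  shows "\<eta>\<^sup>2 * n / 4 \<le> card {N \<in> {..2 * n}. \<eta>\<^sup>2 * n / 8 \<le> card (r N)}"
proof -
  let ?\<N> = "{N \<in> {..2 * n}. \<eta>\<^sup>2 * n / 8 \<le> card (r N)}"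
  have finE: "finite E" using E finite_subset by blast
  have rsub: "r N \<subseteq> E \<times> E" for N by (auto simp: r_def)
  have finr: "finite (r N)" for N using rsub finE finite_subset by (metis finite_cartesian_product)
  have rle: "card (r N) \<le> 2 * n" for N
  proof -
    have "inj_on fst (r N)" by (auto simp: inj_on_def r_def)
    moreover have "fst ` r N \<subseteq> {..n}" using rsub E by fastforce
    ultimately have "card (r N) \<le> card {..n}" by (intro card_inj_on_le) auto
    then show ?thesis using n by simp
  qed
  have "E \<times> E = (\<Union>N\<in>{..2 * n}. r N)"
  proof (intro subset_antisym subsetI)
    fix p assume p: "p \<in> E \<times> E"
    then have "p \<in> r (fst p + snd p)" by (auto simp: r_def)
    moreover have "fst p \<in> {..n}" "snd p \<in> {..n}" 
      using p subsetD[OF E, of "fst p"] subsetD[OF E, of "snd p"] by auto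
    then have "fst p + snd p \<in> {..2 * n}" by simp
    ultimately show "p \<in> (\<Union>N\<in>{..2 * n}. r N)" by blast
  qed (use rsub in blast)
  then have "card (E \<times> E) \<le> (\<Sum>N\<in>{..2 * n}. card (r N))" by (simp add: card_UN_le)
  then have "real (card E) * real (card E) \<le> (\<Sum>N\<in>{..2 * n}. real (card (r N)))"
    unfolding card_cartesian_product by (metis of_nat_le_iff of_nat_mult of_nat_sum)
  moreover have "(\<eta> * n) * (\<eta> * n) \<le> real (card E) * real (card E)"
    using card \<eta> by (intro mult_mono) auto
  ultimately have "(\<eta> * n) * (\<eta> * n) \<le> (\<Sum>N\<in>{..2 * n}. real (card (r N)))" by linarith
  also have "\<dots> \<le> (\<Sum>N\<in>{..2 * n}. (if N \<in> ?\<N> then 2 * real n else 0) + \<eta>\<^sup>2 * n / 8)"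
  proof (rule sum_mono)
    fix N assume "N \<in> {..2 * n}"
    have "real (card (r N)) \<le> 2 * real n" using rle[of N] by (metis of_nat_le_iff of_nat_mult of_nat_numeral)
    moreover have "0 \<le> \<eta>\<^sup>2 * n / 8" by simp
    ultimately show "real (card (r N)) \<le> (if N \<in> ?\<N> then 2 * real n else 0) + \<eta>\<^sup>2 * n / 8"
      using \<open>N \<in> {..2 * n}\<close> by (auto intro: add_increasing2)
  qed
  also have "\<dots> = real (card ?\<N>) * (2 * real n) + (2 * real n + 1) * (\<eta>\<^sup>2 * n / 8)"
  proof -
    have "(\<Sum>N\<in>{..2 * n}. if N \<in> ?\<N> then 2 * real n else 0) = (\<Sum>N\<in>{..2 * n} \<inter> ?\<N>. 2 * real n)"
      by (rule sum.inter_restrict[symmetric]) simp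
    also have "{..2 * n} \<inter> ?\<N> = ?\<N>" by auto
    finally show ?thesis by (simp add: sum.distrib)
  qed
  also have "\<dots> \<le> real (card ?\<N>) * (2 * real n) + (3 * real n) * (\<eta>\<^sup>2 * n / 8)"
    using n by (intro add_left_mono mult_right_mono) auto
  finally have "(\<eta> * n) * (\<eta> * n) \<le> real (card ?\<N>) * (2 * real n) + (3 * real n) * (\<eta>\<^sup>2 * n / 8)" .
  then have "2 * real n * (5 * \<eta>\<^sup>2 * n / 16) \<le> 2 * real n * real (card ?\<N>)"
    by (simp add: power2_eq_square algebra_simps)
  then have "5 * \<eta>\<^sup>2 * n / 16 \<le> real (card ?\<N>)" using n by (subst (asm) mult_le_cancel_left_pos) auto
  moreover have "\<eta>\<^sup>2 * n / 4 \<le> 5 * \<eta>\<^sup>2 * n / 16" by (simp add: field_simps)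
  ultimately show ?thesis by linarith
qed

lemma card_nearby:
  fixes S :: "nat set"
  assumes "finite S" "\<And>N. N \<in> \<N> \<Longrightarrow> \<exists>M\<in>S. N \<le> M + b \<and> M \<le> N + b"
  shows "card \<N> \<le> (2 * b + 1) * card S"
proof -
  have "\<N> \<subseteq> (\<Union>M\<in>S. {M - b..M + b})"
  proof
    fix N assume "N \<in> \<N>"
    then obtain M where "M \<in> S" "N \<le> M + b" "M \<le> N + b" using assms(2) by blast
    then show "N \<in> (\<Union>M\<in>S. {M - b..M + b})" by (intro UN_I[of M]) auto
  qed
  then have "card \<N> \<le> card (\<Union>M\<in>S. {M - b..M + b})" using assms(1) by (intro card_mono) auto
  also have "\<dots> \<le> (\<Sum>M\<in>S. card {M - b..M + b})" using assms(1) by (rule card_UN_le)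
  also have "\<dots> \<le> (\<Sum>M\<in>S. 2 * b + 1)" by (intro sum_mono) auto
  finally show ?thesis by (simp add: mult.commute)
qed

section \<open>Iteration of the density statement\<close>

definition window :: "real \<Rightarrow> real \<Rightarrow> nat \<Rightarrow> nat set" where
  "window \<delta> \<eta> n = {m \<in> large_set \<delta>. \<eta> * n \<le> m \<and> m \<le> n}"

lemma finite_window: "finite (window \<delta> \<eta> n)"
  by (rule finite_subset[of _ "{..n}"]) (auto simp: window_def)

text \<open>Positive upper density in a form that keeps all lengths within a constant factor of
  \<open>n\<close>, so that their powers are comparable. One \<eta> serves both as density and as
  lower cut-off.\<close>

definition dense_at :: "real \<Rightarrow> bool" where
  "dense_at \<delta> \<longleftrightarrow> (\<exists>\<eta> :: real. 0 < \<eta> \<and> \<eta> \<le> 1 \<and>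
     (\<forall>m. \<exists>n\<ge>m. \<eta> * real n \<le> card (window \<delta> \<eta> n)))"

text \<open>The sum of two lengths at which there are too many polygons is, for most popular sums, close to
  a length at which the excess exponent is larger by the factor \<open>3/2\<close>.\<close>

lemma dense_at_step:
  assumes "\<delta> > 0" "dense_at \<delta>"
  shows "dense_at (3 * \<delta> / 2)"
proof -
  obtain \<eta> :: real where "0 < \<eta> \<and> \<eta> \<le> 1 \<and> (\<forall>m. \<exists>n\<ge>m. \<eta> * real n \<le> card (window \<delta> \<eta> n))"
    using assms(2) unfolding dense_at_def ..
  then have \<eta>: "\<eta> > 0" "\<eta> \<le> 1" and inf: "\<exists>n\<ge>m. \<eta> * real n \<le> card (window \<delta> \<eta> n)" for m
    by simp_all
  let ?b = max_change
  \<comment> \<open>At least \<open>\<eta>\<^sup>2 * n / 4\<close> sums are popular, a large length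
    is close to at most \<open>2 * ?b + 1\<close> of them, and the new window ends at
    \<open>3 * n\<close> to leave room for sums up to \<open>2 * n\<close> and their changes. The 12
    is 4 times 3.\<close>
  define \<eta>' where "\<eta>' = \<eta>\<^sup>2 / (12 * (2 * real ?b + 1))"
  have sq: "\<eta>\<^sup>2 \<le> \<eta>" using \<eta> by (simp add: power2_eq_square mult_left_le)
  have \<eta>': "\<eta>' > 0" using \<eta> by (simp add: \<eta>'_def)
  have \<eta>'le: "3 * \<eta>' \<le> \<eta>"
  proof -
    have "3 * (x / (12 * d)) = x / (4 * d)" for x d :: real by simp
    then have "3 * \<eta>' = \<eta>\<^sup>2 / (4 * (2 * real ?b + 1))" unfolding \<eta>'_def by blast
    also have "\<dots> \<le> \<eta>\<^sup>2 / 1" by (intro divide_left_mono) auto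
    finally have "3 * \<eta>' \<le> \<eta>\<^sup>2 / 1" .
    then show ?thesis using sq by simp
  qed
  obtain n1 :: nat where n1: "\<forall>n\<ge>n1. \<forall>N F. F \<subseteq> {(j, k). j \<in> large_set \<delta> \<and> k \<in> large_set \<delta> \<and>
      \<eta> * n \<le> j \<and> j \<le> n \<and> \<eta> * n \<le> k \<and> k \<le> n \<and> j + k = N} \<longrightarrow> \<eta>\<^sup>2 * n / 8 \<le> card F \<longrightarrow>
      (\<exists>M\<in>large_set (3 * \<delta> / 2). N \<le> M + ?b \<and> M \<le> N + ?b)"
    using large_set_sums[OF assms(1) \<eta>] unfolding eventually_sequentially ..
  obtain n2 :: nat where n2: "real ?b / \<eta> \<le> n2" using real_arch_simple by blast
  have "\<exists>n'\<ge>m. \<eta>' * n' \<le> card (window (3 * \<delta> / 2) \<eta>' n')" for m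
  proof -
    obtain n where n: "n \<ge> max (max m n1) (max n2 1)" "\<eta> * n \<le> card (window \<delta> \<eta> n)" using inf by blast
    have nb: "real ?b \<le> \<eta> * n"
    proof -
      have "real ?b / \<eta> \<le> n" using n2 n(1) by linarith
      then show ?thesis using \<eta> by (simp add: field_simps)
    qed
    let ?E = "window \<delta> \<eta> n"
    let ?r = "\<lambda>N. {(j, k) \<in> ?E \<times> ?E. j + k = N}"
    let ?\<N> = "{N \<in> {..2 * n}. \<eta>\<^sup>2 * n / 8 \<le> card (?r N)}"
    let ?S = "window (3 * \<delta> / 2) \<eta>' (3 * n)"
    have pop: "\<eta>\<^sup>2 * n / 4 \<le> card ?\<N>"
      using n \<eta> by (intro popular_sums) (auto simp: window_def)
    have "card ?\<N> \<le> (2 * ?b + 1) * card ?S"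
    proof (rule card_nearby[OF finite_window])
      fix N assume N: "N \<in> ?\<N>"
      have sub: "?r N \<subseteq> {(j, k). j \<in> large_set \<delta> \<and> k \<in> large_set \<delta> \<and>
        \<eta> * n \<le> j \<and> j \<le> n \<and> \<eta> * n \<le> k \<and> k \<le> n \<and> j + k = N}"
        by (auto simp: window_def)
      have "n1 \<le> n" "\<eta>\<^sup>2 * n / 8 \<le> card (?r N)" using n(1) N by simp_all
      from n1[rule_format, OF this(1) sub this(2)]
      obtain M where M: "M \<in> large_set (3 * \<delta> / 2)" "N \<le> M + ?b" "M \<le> N + ?b" by blast
      have "real (card (?r N)) > 0"
      proof -
        have "0 < \<eta>\<^sup>2 * n / 8" using \<eta> n(1) by simp
        then show ?thesis using N by auto
      qed
      then have "?r N \<noteq> {}" by (metis card.empty less_irrefl of_nat_0)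
      then obtain j k where jk: "j \<in> ?E" "k \<in> ?E" "j + k = N" by auto
      have "\<eta> * n \<le> j" "\<eta> * n \<le> k" using jk by (auto simp: window_def)
      moreover have "real N = real j + real k" using jk(3) by auto
      moreover have "real N \<le> real M + real ?b" "real M \<le> real N + real ?b"
        using M(2,3) by (simp_all only: of_nat_le_iff flip: of_nat_add)
      moreover have "real N \<le> 2 * real n" using N by auto
      moreover have "3 * \<eta>' * n \<le> \<eta> * n" using \<eta>'le by (intro mult_right_mono) auto
      moreover have "\<eta> * n \<le> n" using \<eta> by (simp add: mult_left_le_one_le)
      ultimately have "3 * \<eta>' * n \<le> M" "real M \<le> 3 * real n" using nb by linarith+
      then have "M \<in> ?S" using M(1) by (auto simp: window_def)
      then show "\<exists>M\<in>?S. N \<le> M + ?b \<and> M \<le> N + ?b" using M by blast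
    qed
    then have "real (card ?\<N>) \<le> (2 * real ?b + 1) * real (card ?S)"
      by (metis (no_types, lifting) of_nat_1 of_nat_add of_nat_le_iff of_nat_mult of_nat_numeral)
    then have "\<eta>\<^sup>2 * n / 4 \<le> (2 * real ?b + 1) * real (card ?S)" using pop by linarith
    then have "\<eta>\<^sup>2 * n / 4 / (2 * real ?b + 1) \<le> real (card ?S)"
      by (subst pos_divide_le_eq) (simp, simp only: mult.commute)
    moreover have "\<eta>' * real (3 * n) = \<eta>\<^sup>2 * n / 4 / (2 * real ?b + 1)"
      by (simp add: \<eta>'_def field_simps)
    ultimately have "\<eta>' * real (3 * n) \<le> card ?S" by simp
    moreover have "3 * n \<ge> m" using n(1) by simp
    ultimately show ?thesis by blast
  qed
  moreover have "\<eta>' \<le> 1" using \<eta>'le \<eta>' \<eta> by linarith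
  ultimately show ?thesis unfolding dense_at_def using \<eta>' by blast
qed

text \<open>For such \<delta>, a large length beyond 1 would have more than \<open>\<mu> ^ n\<close>
  polygons.\<close>

lemma not_dense_at_large:
  assumes "\<delta> > 3/2"
  shows "\<not> dense_at \<delta>"
proof
  assume "dense_at \<delta>"
  then obtain \<eta> :: real where "0 < \<eta> \<and> \<eta> \<le> 1 \<and> (\<forall>m. \<exists>n\<ge>m. \<eta> * real n \<le> card (window \<delta> \<eta> n))"
    unfolding dense_at_def ..
  then have \<eta>: "\<eta> > 0" and inf: "\<exists>n\<ge>m. \<eta> * real n \<le> card (window \<delta> \<eta> n)" for m
    by simp_all
  obtain m :: nat where m: "2 / \<eta> \<le> m" using real_arch_simple by blast
  obtain n where n: "n \<ge> max m 1" "\<eta> * n \<le> card (window \<delta> \<eta> n)" using inf by blast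
  have "2 / \<eta> \<le> n" using m n(1) by linarith
  then have n2: "2 \<le> \<eta> * n" using \<eta> by (simp add: field_simps)
  have "window \<delta> \<eta> n = {}"
  proof (rule ccontr)
    assume "window \<delta> \<eta> n \<noteq> {}"
    then obtain k where k: "k \<in> large_set \<delta>" "\<eta> * n \<le> k" by (auto simp: window_def)
    have k2: "real k \<ge> 2" using k n2 by linarith
    have "real k powr (\<delta> - 3/2) * \<mu> ^ k \<le> real (pcount k)" using k(1) by (simp add: large_set_def)
    also have "\<dots> \<le> 1 * \<mu> ^ k" using connective_constant_bounds(2)[of k] by simp
    finally have "real k powr (\<delta> - 3/2) \<le> 1"
      using connective_constant_bounds(1) by (simp add: mult_le_cancel_right)
    moreover have "real k powr (\<delta> - 3/2) > 1" using assms k2 by (intro gr_one_powr) auto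
    ultimately show False by simp
  qed
  then show False using n(2) n2 by simp
qed

lemma not_dense_at:
  assumes "\<delta> > 0"
  shows "\<not> dense_at \<delta>"
proof
  assume d: "dense_at \<delta>"
  have "dense_at ((3/2) ^ i * \<delta>)" for i
  proof (induction i)
    case (Suc i)
    have "(3/2) ^ i * \<delta> > 0" using assms by simp
    from dense_at_step[OF this Suc.IH] show ?case by (simp add: mult.assoc)
  qed (use d in simp)
  moreover obtain i where "(3/2) / \<delta> < (3/2 :: real) ^ i" using real_arch_pow[of "3/2"] by auto
  then have "3/2 < (3/2) ^ i * \<delta>" using assms by (simp add: field_simps)
  ultimately show False using not_dense_at_large by blast
qed

lemma large_set_density_0:
  assumes "\<delta> > 0"
  shows "(\<lambda>n. real (card (large_set \<delta> \<inter> {0..2 * n})) / real n) \<longlonglongrightarrow> 0"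
proof (rule LIMSEQ_I)
  fix e :: real assume e: "e > 0"
  \<comment> \<open>The window up to \<open>2 * n\<close> and the lengths below it contribute about
    \<open>2 * \<eta> * n\<close> each, together at most half of \<open>e * n\<close> plus
    1.\<close>
  define \<eta> where "\<eta> = min 1 (e / 8)"
  have \<eta>: "\<eta> > 0" "\<eta> \<le> 1" "\<eta> \<le> e / 8" using e by (auto simp: \<eta>_def)
  obtain m where m: "\<And>n. n \<ge> m \<Longrightarrow> real (card (window \<delta> \<eta> n)) < \<eta> * n"
    using not_dense_at[OF assms] \<eta> unfolding dense_at_def by (meson not_le)
  obtain m' :: nat where m': "4 / e \<le> m'" using real_arch_simple by blast
  have "norm (real (card (large_set \<delta> \<inter> {0..2 * n})) / real n - 0) < e" if n: "n \<ge> max (max m m') 1" for n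
  proof -
    have sub: "large_set \<delta> \<inter> {0..2 * n} \<subseteq> window \<delta> \<eta> (2 * n) \<union> {..nat \<lfloor>\<eta> * (2 * n)\<rfloor>}"
    proof
      fix k assume k: "k \<in> large_set \<delta> \<inter> {0..2 * n}"
      show "k \<in> window \<delta> \<eta> (2 * n) \<union> {..nat \<lfloor>\<eta> * (2 * n)\<rfloor>}"
      proof (cases "\<eta> * (2 * n) \<le> k")
        case True
        then show ?thesis using k by (auto simp: window_def)
      next
        case False
        then have "int k \<le> \<lfloor>\<eta> * (2 * n)\<rfloor>" by (simp add: le_floor_iff)
        then have "k \<le> nat \<lfloor>\<eta> * (2 * n)\<rfloor>" by linarith
        then show ?thesis by simp
      qed
    qed
    have "card (large_set \<delta> \<inter> {0..2 * n}) \<le> card (window \<delta> \<eta> (2 * n) \<union> {..nat \<lfloor>\<eta> * (2 * n)\<rfloor>})"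
      using sub finite_window by (intro card_mono) auto
    also have "\<dots> \<le> card (window \<delta> \<eta> (2 * n)) + (nat \<lfloor>\<eta> * (2 * n)\<rfloor> + 1)"
      using card_Un_le[of "window \<delta> \<eta> (2 * n)" "{..nat \<lfloor>\<eta> * (2 * n)\<rfloor>}"] by simp
    finally have "real (card (large_set \<delta> \<inter> {0..2 * n}))
        \<le> real (card (window \<delta> \<eta> (2 * n))) + (real (nat \<lfloor>\<eta> * (2 * n)\<rfloor>) + 1)" by linarith
    also have "real (card (window \<delta> \<eta> (2 * n))) < \<eta> * real (2 * n)" using n by (intro m) simp
    also have "real (nat \<lfloor>\<eta> * (2 * n)\<rfloor>) \<le> \<eta> * (2 * n)" using \<eta> by simp
    finally have "real (card (large_set \<delta> \<inter> {0..2 * n})) < 4 * (\<eta> * n) + 1" by simp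
    also have "\<eta> * n \<le> e / 8 * n" using \<eta> by (intro mult_right_mono) auto
    also have "4 * (e / 8 * n) + 1 \<le> e * n"
    proof -
      have "4 / e \<le> n" using m' n by linarith
      then have "4 \<le> e * n" using e by (simp add: field_simps)
      then show ?thesis by simp
    qed
    finally have "real (card (large_set \<delta> \<inter> {0..2 * n})) < e * n" by simp
    then show ?thesis using n by (simp add: field_simps)
  qed
  then show "\<exists>no. \<forall>n\<ge>no. norm (real (card (large_set \<delta> \<inter> {0..2 * n})) / real n - 0) < e" by blast
qed

section \<open>From counts to exponents\<close>

text \<open>As the count and \<open>\<mu>\<close> are positive and \<open>n > 1\<close>, the
  defining equation of the exponent has exactly one solution, and a larger exponent means a smaller
  count.\<close>

lemma polygon_exponent_ge_iff:
  assumes "even n" "n \<ge> 4"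
  shows "polygon_exponent TYPE(2) n \<ge> 3 / 2 - \<delta> \<longleftrightarrow> real (pcount n) \<le> real n powr (\<delta> - 3/2) * \<mu> ^ n"
proof -
  have p: "real (pcount n) > 0" using pcount_pos[OF assms] by simp
  have mu0: "\<mu> > 0" using connective_constant_bounds(1) by simp
  then have mu: "\<mu> ^ n > 0" by simp
  have n: "real n > 1" using assms by simp
  define \<theta> where "\<theta> = - log (real n) (real (pcount n) / \<mu> ^ n)"
  have eq: "real (pcount n) = real n powr (- \<theta>) * \<mu> ^ n"
    using p mu0 n by (simp add: \<theta>_def)
  have "polygon_exponent TYPE(2) n = \<theta>"
    unfolding polygon_exponent_def num_polygons_eq
  proof (rule the_equality)
    show "real (pcount n) = real n powr (- \<theta>) * \<mu> ^ n" by (rule eq)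
    fix t assume "real (pcount n) = real n powr (- t) * \<mu> ^ n"
    then have "real n powr (- t) = real n powr (- \<theta>)" using eq mu0 by simp
    then show "t = \<theta>" using n by (simp add: powr_inj)
  qed
  moreover have "3 / 2 - \<delta> \<le> \<theta> \<longleftrightarrow> real n powr (- \<theta>) \<le> real n powr (\<delta> - 3/2)"
    using n by (subst powr_le_cancel_iff) auto
  moreover have "real n powr (- \<theta>) \<le> real n powr (\<delta> - 3/2) \<longleftrightarrow>
      real n powr (- \<theta>) * \<mu> ^ n \<le> real n powr (\<delta> - 3/2) * \<mu> ^ n"
    using mu by (rule mult_le_cancel_right_pos[symmetric])
  ultimately show ?thesis using eq by simp
qed

theorem theorem1p3:
  fixes \<delta> :: real
  assumes "\<delta> > 0"
  shows "has_limiting_density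
    {n. even n \<and> n \<ge> 4 \<and> polygon_exponent TYPE(2) n \<ge> 3 / 2 - \<delta>} 1"
proof -
  let ?A = "{n. even n \<and> n \<ge> 4 \<and> polygon_exponent TYPE(2) n \<ge> 3 / 2 - \<delta>}"
  let ?f = "\<lambda>n. real (card (?A \<inter> {0..2 * n})) / real n"
  let ?g = "\<lambda>n. real (card (large_set \<delta> \<inter> {0..2 * n})) / real n"
  \<comment> \<open>The even numbers from 4 to \<open>2 * n\<close>. There is one fewer than
    \<open>n\<close>, which is the origin of the term \<open>1 / real n\<close> in the lower
    bound.\<close>
  have evens: "card ((\<lambda>k. 2 * k) ` {2..n}) = n - 1" for n :: nat
    by (subst card_image) (auto simp: inj_on_def)
  have upper: "?f n \<le> 1" for n
  proof -
    have "?A \<inter> {0..2 * n} \<subseteq> (\<lambda>k. 2 * k) ` {2..n}" by (auto elim!: evenE)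
    then have "card (?A \<inter> {0..2 * n}) \<le> n - 1" unfolding evens[symmetric] by (intro card_mono) auto
    then have "real (card (?A \<inter> {0..2 * n})) \<le> real n" by linarith
    then show ?thesis by (cases "n = 0") (auto simp: field_simps)
  qed
  have lower: "1 - 1 / real n - ?g n \<le> ?f n" if n: "n \<ge> 1" for n
  proof -
    have "(\<lambda>k. 2 * k) ` {2..n} \<subseteq> (?A \<inter> {0..2 * n}) \<union> (large_set \<delta> \<inter> {0..2 * n})"
    proof
      fix m assume "m \<in> (\<lambda>k. 2 * k) ` {2..n}"
      then have m: "even m" "m \<ge> 4" "m \<in> {0..2 * n}" by auto
      show "m \<in> (?A \<inter> {0..2 * n}) \<union> (large_set \<delta> \<inter> {0..2 * n})"
      proof (cases "polygon_exponent TYPE(2) m \<ge> 3 / 2 - \<delta>")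
        case False
        then have "m \<in> large_set \<delta>"
          using polygon_exponent_ge_iff[OF m(1,2), of \<delta>] m by (auto simp: large_set_def)
        then show ?thesis using m by blast
      qed (use m in blast)
    qed
    then have "card ((\<lambda>k. 2 * k) ` {2..n}) \<le> card ((?A \<inter> {0..2 * n}) \<union> (large_set \<delta> \<inter> {0..2 * n}))"
      by (intro card_mono) auto
    also have "\<dots> \<le> card (?A \<inter> {0..2 * n}) + card (large_set \<delta> \<inter> {0..2 * n})" by (rule card_Un_le)
    finally have "real n - 1 \<le> real (card (?A \<inter> {0..2 * n})) + real (card (large_set \<delta> \<inter> {0..2 * n}))"
      unfolding evens using n by linarith
    then have "(real n - 1) / real n \<le> (real (card (?A \<inter> {0..2 * n})) + real (card (large_set \<delta> \<inter> {0..2 * n}))) / real n"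
      by (intro divide_right_mono) auto
    then show ?thesis using n by (simp add: add_divide_distrib diff_divide_distrib)
  qed
  have "(\<lambda>n. 1 - 1 / real n - ?g n) \<longlonglongrightarrow> 1 - 0 - 0"
    by (intro tendsto_diff tendsto_const lim_1_over_n large_set_density_0 assms)
  then have "(\<lambda>n. 1 - 1 / real n - ?g n) \<longlonglongrightarrow> 1" by simp
  moreover have "\<forall>\<^sub>F n in sequentially. 1 - 1 / real n - ?g n \<le> ?f n"
    using lower unfolding eventually_sequentially by blast
  moreover have "\<forall>\<^sub>F n in sequentially. ?f n \<le> 1" using upper by simp
  ultimately have "?f \<longlonglongrightarrow> 1" by (rule tendsto_sandwich[OF _ _ _ tendsto_const, rotated 2])
  then have "(\<lambda>n. ereal (?f n)) \<longlonglongrightarrow> ereal 1" by simp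
  then show ?thesis
    unfolding has_limiting_density_def limsup_density_def liminf_density_def
    using lim_imp_Limsup lim_imp_Liminf trivial_limit_sequentially by blast
qed

end
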